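(* Let $E_{\mathfrak{D}}:\mathcal{O}_2\to\mathfrak{D}$ be the canonical conditional expectation of the Cuntz algebra $\mathcal{O}_2$ onto its diagonal subalgebra $\mathfrak{D}$, and let $N\in\mathcal{O}_2$ be a normal operator such that $\sigma(N)=\{\alpha_k\}_{k=1}^n$. Then \[ \overline{\mathcal{D}_{\mathfrak{D}}(N)}^{\|\cdot\|}=\overline{\left\{\sum_{k=1}^n\alpha_kA_k\ \middle|\ \{A_k\}_{k=1}^n\text{ a partition of unity in }\mathfrak{D}\right\}}^{\|\cdot\|}. \]
   Context: The Cuntz algebra $\mathcal{O}_2$ is the C$^*$-algebra generated by two isometries $S_1,S_2$ with $S_1S_1^*+S_2S_2^*=I$. It contains a copy $\mathcal{F}_2$ of the $2^\infty$-UHF C$^*$-algebra (the closed span of the $S_\mu S_\nu^*$ with $\mu,\nu$ words of equal length in $\{1,2\}$), and there is a canonical conditional expectation $E_{\mathcal{F}_2}:\mathcal{O}_2\to\mathcal{F}_2$. $\mathfrak{D}$ denotes the diagonal subalgebra of $\mathcal{F}_2$ (the closed span of the $S_\mu S_\mu^*$), $E:\mathcal{F}_2\to\mathfrak{D}$ is the conditional expectation onto the diagonal, and $E_{\mathfrak{D}}:=E\circ E_{\mathcal{F}_2}$. Here $\mathcal{D}_{\mathfrak{D}}(N):=\{E_{\mathfrak{D}}(U^*NU)\mid U\in\mathcal{O}_2\text{ unitary}\}$, and $\overline{\,\cdot\,}^{\|\cdot\|}$ denotes norm closure. A partition of unity in $\mathfrak{D}$ is a finite collection $\{A_k\}_{k=1}^n\subseteq\mathfrak{D}$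 with $0\le A_k\le I$ for all $k$ and $\sum_{k=1}^nA_k=I$. The $\alpha_k$ are the distinct points of the spectrum of $N$. *)

theory Defs
  imports "HOL-Analysis.Analysis"
begin

text \<open>
  Unital C*-algebras over the complex numbers.  The library offers Banach algebras over the
  reals only, so complex scalars and the involution are added here.  Closures and limits always
  refer to the norm topology of the type.
\<close>

class cstar_algebra = real_normed_algebra_1 + banach +
  fixes scaleC :: "complex \<Rightarrow> 'a \<Rightarrow> 'a"  (infixr "*\<^sub>C" 75)
    and star :: "'a \<Rightarrow> 'a"
  assumes scaleC_add_right: "c *\<^sub>C (x + y) = c *\<^sub>C x + c *\<^sub>C y"
    and scaleC_add_left: "(c + d) *\<^sub>C x = c *\<^sub>C x + d *\<^sub>C x"
    and scaleC_scaleC: "c *\<^sub>C (d *\<^sub>C x) = (c * d) *\<^sub>C x"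
    and scaleC_of_real: "complex_of_real r *\<^sub>C x = r *\<^sub>R x"
    and scaleC_mult_left: "(c *\<^sub>C x) * y = c *\<^sub>C (x * y)"
    and scaleC_mult_right: "x * (c *\<^sub>C y) = c *\<^sub>C (x * y)"
    and norm_scaleC: "norm (c *\<^sub>C x) = cmod c * norm x"
    and star_add: "star (x + y) = star x + star y"
    and star_scaleC: "star (c *\<^sub>C x) = cnj c *\<^sub>C star x"
    and star_mult: "star (x * y) = star y * star x"
    and star_star: "star (star x) = x"
    and cstar_identity: "norm (star x * x) = (norm x)\<^sup>2"

interpretation cvector_space: vector_space "scaleC :: complex \<Rightarrow> 'a \<Rightarrow> 'a::cstar_algebra"
proof
  show "1 *\<^sub>C x = x" for x :: 'a
    using scaleC_of_real[of 1 x] by simp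
qed (simp_all add: scaleC_add_right scaleC_add_left scaleC_scaleC)

definition closed_cspan :: "'a::cstar_algebra set \<Rightarrow> 'a set" where
  "closed_cspan X = closure (cvector_space.span X)"

definition unital_cstar_subalgebra :: "'a::cstar_algebra set \<Rightarrow> bool" where
  "unital_cstar_subalgebra B \<longleftrightarrow>
     cvector_space.subspace B \<and> closed B \<and> 1 \<in> B \<and>
     (\<forall>x\<in>B. \<forall>y\<in>B. x * y \<in> B) \<and> (\<forall>x\<in>B. star x \<in> B)"

definition cstar_generated :: "'a::cstar_algebra set \<Rightarrow> 'a set" where
  "cstar_generated X = \<Inter> {B. unital_cstar_subalgebra B \<and> X \<subseteq> B}"

definition spectrum :: "'a::cstar_algebra \<Rightarrow> complex set" where
  "spectrum x = {c. \<not> (\<exists>y. y * (c *\<^sub>C 1 - x) = 1 \<and> (c *\<^sub>C 1 - x) * y = 1)}"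

definition normal_elem :: "'a::cstar_algebra \<Rightarrow> bool" where
  "normal_elem x \<longleftrightarrow> star x * x = x * star x"

definition unitary_elem :: "'a::cstar_algebra \<Rightarrow> bool" where
  "unitary_elem u \<longleftrightarrow> star u * u = 1 \<and> u * star u = 1"

definition isometry_elem :: "'a::cstar_algebra \<Rightarrow> bool" where
  "isometry_elem s \<longleftrightarrow> star s * s = 1"

definition positive_elem :: "'a::cstar_algebra \<Rightarrow> bool" where
  "positive_elem x \<longleftrightarrow> star x = x \<and> spectrum x \<subseteq> \<real>\<^sub>\<ge>\<^sub>0"

definition cstar_le :: "'a::cstar_algebra \<Rightarrow> 'a \<Rightarrow> bool"  (infix "\<preceq>" 50) where
  "x \<preceq> y \<longleftrightarrow> positive_elem (y - x)"

text \<open>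
  Only the values of \<open>E\<close> on \<open>A\<close> matter.  By Tomiyama's theorem the last three clauses follow from
  the others, but they are customarily part of the notion.
\<close>

definition conditional_expectation ::
    "'a::cstar_algebra set \<Rightarrow> 'a set \<Rightarrow> ('a \<Rightarrow> 'a) \<Rightarrow> bool" where
  "conditional_expectation A B E \<longleftrightarrow>
     unital_cstar_subalgebra A \<and> unital_cstar_subalgebra B \<and> B \<subseteq> A \<and>
     (\<forall>x\<in>A. E x \<in> B) \<and> (\<forall>b\<in>B. E b = b) \<and>
     (\<forall>x\<in>A. \<forall>y\<in>A. E (x + y) = E x + E y) \<and>
     (\<forall>c. \<forall>x\<in>A. E (c *\<^sub>C x) = c *\<^sub>C E x) \<and>
     (\<forall>x\<in>A. norm (E x) \<le> norm x) \<and>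
     (\<forall>x\<in>A. 0 \<preceq> x \<longrightarrow> 0 \<preceq> E x) \<and>
     (\<forall>b\<in>B. \<forall>x\<in>A. E (b * x) = b * E x) \<and>
     (\<forall>b\<in>B. \<forall>x\<in>A. E (x * b) = E x * b)"

text \<open>
  The whole type \<open>'a\<close> plays the role of the Cuntz algebra; by Cuntz's theorem the relations
  determine it, together with its generators, up to isomorphism.  The generators are \<open>S 1\<close>
  and \<open>S 2\<close>; other values of \<open>S\<close> are irrelevant.
\<close>

definition cuntz_O2 :: "(nat \<Rightarrow> 'a::cstar_algebra) \<Rightarrow> bool" where
  "cuntz_O2 S \<longleftrightarrow>
     isometry_elem (S 1) \<and> isometry_elem (S 2) \<and>
     S 1 * star (S 1) + S 2 * star (S 2) = 1 \<and>
     cstar_generated {S 1, S 2} = UNIV"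

definition word_elem :: "(nat \<Rightarrow> 'a::cstar_algebra) \<Rightarrow> nat list \<Rightarrow> 'a" where
  "word_elem S \<mu> = prod_list (map S \<mu>)"

definition UHF_subalgebra :: "(nat \<Rightarrow> 'a::cstar_algebra) \<Rightarrow> 'a set" where
  "UHF_subalgebra S = closed_cspan
     {word_elem S \<mu> * star (word_elem S \<nu>) | \<mu> \<nu>.
        \<mu> \<in> lists {1, 2} \<and> \<nu> \<in> lists {1, 2} \<and> length \<mu> = length \<nu>}"

definition diagonal_subalgebra :: "(nat \<Rightarrow> 'a::cstar_algebra) \<Rightarrow> 'a set" where
  "diagonal_subalgebra S = closed_cspan
     {word_elem S \<mu> * star (word_elem S \<mu>) | \<mu>. \<mu> \<in> lists {1, 2}}"

text \<open>
  The canonical expectation onto the UHF subalgebra is the projection onto the fixed points of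
  the gauge action, so it annihilates the words that are not balanced; the one onto the diagonal
  annihilates the off-diagonal matrix units.  As the words span dense subspaces and the
  expectations are contractive, this determines both maps uniquely.
\<close>

definition canonical_expectation_UHF ::
    "(nat \<Rightarrow> 'a::cstar_algebra) \<Rightarrow> ('a \<Rightarrow> 'a) \<Rightarrow> bool" where
  "canonical_expectation_UHF S E \<longleftrightarrow>
     conditional_expectation UNIV (UHF_subalgebra S) E \<and>
     (\<forall>\<mu>\<in>lists {1, 2}. \<forall>\<nu>\<in>lists {1, 2}. length \<mu> \<noteq> length \<nu> \<longrightarrow>
        E (word_elem S \<mu> * star (word_elem S \<nu>)) = 0)"

definition canonical_expectation_UHF_diagonal ::
    "(nat \<Rightarrow> 'a::cstar_algebra) \<Rightarrow> ('a \<Rightarrow> 'a) \<Rightarrow> bool" where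
  "canonical_expectation_UHF_diagonal S E \<longleftrightarrow>
     conditional_expectation (UHF_subalgebra S) (diagonal_subalgebra S) E \<and>
     (\<forall>\<mu>\<in>lists {1, 2}. \<forall>\<nu>\<in>lists {1, 2}. length \<mu> = length \<nu> \<and> \<mu> \<noteq> \<nu> \<longrightarrow>
        E (word_elem S \<mu> * star (word_elem S \<nu>)) = 0)"

definition canonical_expectation_diagonal ::
    "(nat \<Rightarrow> 'a::cstar_algebra) \<Rightarrow> ('a \<Rightarrow> 'a) \<Rightarrow> bool" where
  "canonical_expectation_diagonal S E\<^sub>D \<longleftrightarrow>
     (\<exists>E\<^sub>F E. canonical_expectation_UHF S E\<^sub>F \<and> canonical_expectation_UHF_diagonal S E \<and>
        E\<^sub>D = E \<circ> E\<^sub>F)"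

definition unitary_orbit_image :: "('a::cstar_algebra \<Rightarrow> 'a) \<Rightarrow> 'a \<Rightarrow> 'a set" where
  "unitary_orbit_image E N = {E (star U * N * U) | U. unitary_elem U}"

definition partition_of_unity_in ::
    "'a::cstar_algebra set \<Rightarrow> nat \<Rightarrow> (nat \<Rightarrow> 'a) \<Rightarrow> bool" where
  "partition_of_unity_in D n A \<longleftrightarrow>
     (\<forall>k\<in>{1..n}. A k \<in> D \<and> 0 \<preceq> A k \<and> A k \<preceq> 1) \<and> (\<Sum>k=1..n. A k) = 1"

end

theory Submission
  imports Defs "HOL-Computational_Algebra.Fundamental_Theorem_Algebra"
begin

text \<open>
  Write \<open>N = \<Sum> \<alpha>\<^sub>k P\<^sub>k\<close> with its spectral projections.  Expectations of unitary conjugates of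
  the \<open>P\<^sub>k\<close> form a partition of unity, which gives one inclusion.  For the other one, a partition of
  unity is approximated by the diagonals of projections \<open>Q\<^sub>k\<close> built from discrete Fourier matrices.
  Since all nonzero projections of \<open>\<O>\<^sub>2\<close> are Murray--von Neumann equivalent, some unitary
  conjugates every \<open>P\<^sub>k\<close> to \<open>Q\<^sub>k\<close> at once.

  The equivalence is Cuntz's theorem: \<open>\<O>\<^sub>2\<close> is purely infinite, and the canonical shift is
  homotopic to the identity, so \<open>[p] = [p] + [p]\<close>.  Endomorphisms \<open>S\<^sub>i \<mapsto> T\<^sub>i\<close> exist because
  the contractive gauge expectation bounds a word polynomial of degree \<open>d\<close> in the \<open>T\<^sub>i\<close>
  by \<open>2d + 1\<close> times its norm in the \<open>S\<^sub>i\<close>, and by the C*-identity this factor disappears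
  on passing to high powers.
\<close>

text \<open>The orbit side lies inside the set of sums even before closures are taken; closures are
  forced by the other inclusion. There every \<open>Q k\<close> must be nonzero, since
  \<open>P k\<close> is, while \<open>A k\<close> may vanish: hence the rounding to fractions with
  positive numerators. Fourier matrices enter because each of the \<open>M\<close> range projections
  they give below a word has the constant diagonal \<open>1 / M\<close>, so choosing
  \<open>r\<close> of them produces the entry \<open>r / M\<close>.

  Pure infiniteness is made quantitative. An isometry pushed far by the shift compresses word
  polynomials of bounded length exactly to their balanced part, which acts as a matrix on the
  finite-dimensional space of words. A unit vector on which this matrix is large produces, under a
  given projection, an isometry up to a small error. That the balanced part is not small follows
  from comparing it with a finite gauge average of projections, the first few of which are close to
  the given one.\<close>

declare One_nat_def [simp del] \<comment> \<open>keeps the index in \<open>S 1\<close> from becoming \<open>Suc 0\<close>\<close>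

subsection \<open>Norm and involution\<close>

lemma star_scaleR: "star (r *\<^sub>R x) = r *\<^sub>R star (x :: 'a::cstar_algebra)"
  by (metis complex_cnj_complex_of_real scaleC_of_real star_scaleC)

lemma star_zero [simp]: "star (0 :: 'a::cstar_algebra) = 0"
  using star_scaleR[of 0 0] by simp

lemma star_one [simp]: "star (1 :: 'a::cstar_algebra) = 1"
  by (metis mult.right_neutral star_mult star_star)

lemma star_minus: "star (- x) = - star (x :: 'a::cstar_algebra)"
  using star_scaleR[of "-1" x] by simp

lemma star_diff: "star (x - y) = star x - star (y :: 'a::cstar_algebra)"
  using star_add[of x "- y"] star_minus[of y] by simp

lemma star_sum: "star (sum f A) = (\<Sum>i\<in>A. star (f i :: 'a::cstar_algebra))"
  by (induction A rule: infinite_finite_induct) (simp_all add: star_add)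

lemma star_power: "star (x ^ n) = star (x :: 'a::cstar_algebra) ^ n"
  by (induction n) (simp_all add: star_mult power_commutes)

lemma norm_star [simp]: "norm (star x) = norm (x :: 'a::cstar_algebra)"
proof -
  have le: "norm x \<le> norm (star x)" for x :: 'a
  proof (cases "x = 0")
    case False
    have "norm x * norm x \<le> norm (star x) * norm x"
      using cstar_identity[of x] norm_mult_ineq[of "star x" x] by (simp add: power2_eq_square)
    with False show ?thesis by simp
  qed simp
  from le[of x] le[of "star x"] show ?thesis by (simp add: star_star)
qed

lemma norm_mult_star: "norm (x * star x) = (norm (x :: 'a::cstar_algebra))\<^sup>2"
  using cstar_identity[of "star x"] by (simp add: star_star)

lemma bounded_linear_star: "bounded_linear (star :: 'a::cstar_algebra \<Rightarrow> 'a)"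
  by (rule bounded_linear_intro[where K = 1]) (simp_all add: star_add star_scaleR)

lemmas tendsto_star = bounded_linear.tendsto[OF bounded_linear_star]
lemmas continuous_on_star = bounded_linear.continuous_on[OF bounded_linear_star]

lemma bounded_bilinear_scaleC: "bounded_bilinear (scaleC :: complex \<Rightarrow> 'a::cstar_algebra \<Rightarrow> 'a)"
proof
  fix a a' :: complex and b b' :: 'a and r :: real
  show "(r *\<^sub>R a) *\<^sub>C b = r *\<^sub>R a *\<^sub>C b"
    by (metis scaleC_of_real scaleC_scaleC scaleR_conv_of_real)
  show "a *\<^sub>C r *\<^sub>R b = r *\<^sub>R a *\<^sub>C b"
    by (metis scaleC_of_real scaleC_scaleC mult.commute)
  show "\<exists>K. \<forall>a (b::'a). norm (a *\<^sub>C b) \<le> norm a * norm b * K"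
    by (rule exI[of _ 1]) (simp add: norm_scaleC)
qed (simp_all add: scaleC_add_left scaleC_add_right)

lemmas tendsto_scaleC = bounded_bilinear.tendsto[OF bounded_bilinear_scaleC]
lemmas continuous_on_scaleC = bounded_bilinear.continuous_on[OF bounded_bilinear_scaleC]

lemma scaleC_power: "(c *\<^sub>C x) ^ n = c ^ n *\<^sub>C (x :: 'a::cstar_algebra) ^ n"
  by (induction n) (simp_all add: scaleC_mult_left scaleC_mult_right scaleC_scaleC mult.commute)

lemma norm_isometry: "isometry_elem v \<Longrightarrow> norm (v :: 'a::cstar_algebra) = 1"
  using cstar_identity[of v] power2_eq_1_iff[of "norm v"] norm_ge_zero[of v]
  by (auto simp: isometry_elem_def simp del: norm_ge_zero)

lemma selfadjoint_norm_power2: "star x = x \<Longrightarrow> norm (x\<^sup>2) = (norm (x :: 'a::cstar_algebra))\<^sup>2"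
  using cstar_identity[of x] by (simp add: power2_eq_square)

text \<open>Iterating the C*-identity doubles the exponent, which is why the limiting arguments
  below run along \<open>2 ^ k\<close>.\<close>

lemma selfadjoint_norm_power_2power:
  "star x = x \<Longrightarrow> norm (x ^ (2 ^ k)) = norm (x :: 'a::cstar_algebra) ^ (2 ^ k)"
proof (induction k)
  case (Suc k)
  have "norm (x ^ (2 ^ Suc k)) = norm ((x ^ (2 ^ k))\<^sup>2)"
    by (simp add: power_mult[symmetric] mult.commute)
  also have "\<dots> = (norm (x ^ (2 ^ k)))\<^sup>2"
    using Suc.prems by (intro selfadjoint_norm_power2) (simp add: star_power)
  finally show ?case using Suc by (simp add: power_mult[symmetric] mult.commute)
qed simp

text \<open>Normality lets the factors of \<open>star (x * x) * (x * x)\<close> be regrouped as the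
  square of \<open>star x * x\<close>, to which the self-adjoint case applies.\<close>

lemma normal_norm_power2:
  assumes "normal_elem (x :: 'a::cstar_algebra)" shows "norm (x\<^sup>2) = (norm x)\<^sup>2"
proof -
  have "star (x * x) * (x * x) = star x * (star x * x) * x"
    by (simp only: star_mult mult.assoc)
  also have "star x * x = x * star x" using assms by (simp add: normal_elem_def)
  also have "star x * (x * star x) * x = (star x * x) * (star x * x)"
    by (simp only: mult.assoc)
  finally have "star (x * x) * (x * x) = (star x * x) * (star x * x)" .
  then have "(norm (x * x))\<^sup>2 = (norm (star x * x))\<^sup>2"
    using cstar_identity[of "x * x"] selfadjoint_norm_power2[of "star x * x"]
    by (simp add: power2_eq_square star_mult star_star)
  then show ?thesis
    using power2_eq_imp_eq[of "norm (x * x)" "norm (star x * x)"]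
    by (simp add: cstar_identity power2_eq_square)
qed

lemma normal_power: "normal_elem x \<Longrightarrow> normal_elem ((x :: 'a::cstar_algebra) ^ n)"
  unfolding normal_elem_def star_power
  using power_commuting_commutes[of "star x" "x ^ n" n] power_commuting_commutes[of x "star x" n]
  by simp

lemma normal_norm_power_2power:
  "normal_elem x \<Longrightarrow> norm (x ^ (2 ^ k)) = norm (x :: 'a::cstar_algebra) ^ (2 ^ k)"
proof (induction k)
  case (Suc k)
  have "norm (x ^ (2 ^ Suc k)) = norm ((x ^ (2 ^ k))\<^sup>2)"
    by (simp add: power_mult[symmetric] mult.commute)
  also have "\<dots> = (norm (x ^ (2 ^ k)))\<^sup>2"
    using Suc.prems by (intro normal_norm_power2 normal_power)
  finally show ?case using Suc by (simp add: power_mult[symmetric] mult.commute)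
qed simp

text \<open>The comparison behind all norm estimates below: subexponential factors disappear
  when an inequality between powers holds along a sequence of exponents.\<close>

lemma le_if_powers_le_linear:
  fixes a b C :: real
  assumes "0 \<le> a" "0 \<le> b" and le: "\<And>k. a ^ (2 ^ k) \<le> C * 2 ^ k * b ^ (2 ^ k)"
  shows "a \<le> b"
proof (rule ccontr)
  assume "\<not> a \<le> b"
  show False
  proof (cases "b = 0")
    case True
    with le[of 0] \<open>\<not> a \<le> b\<close> show False by simp
  next
    case False
    define q where "q = a / b"
    have q: "q > 1" "b > 0" using False assms \<open>\<not> a \<le> b\<close> by (auto simp: q_def)
    have "(\<lambda>n. real n / q ^ n) \<longlonglongrightarrow> 0"
      using lim_n_over_pown[of q] q by simp
    then have "(\<lambda>n. C * (real n / q ^ n)) \<longlonglongrightarrow> C * 0" by (intro tendsto_intros)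
    moreover have "filterlim (\<lambda>k. 2 ^ k :: nat) sequentially sequentially"
      by (intro filterlim_subseq strict_monoI) simp
    ultimately have "(\<lambda>k. C * (real (2 ^ k) / q ^ (2 ^ k))) \<longlonglongrightarrow> C * 0"
      by (rule filterlim_compose)
    moreover have "1 \<le> C * (real (2 ^ k) / q ^ (2 ^ k))" for k
      using le[of k] q by (simp add: q_def power_divide field_simps)
    ultimately show False
      using LIMSEQ_le_const[of "\<lambda>k. C * (real (2 ^ k) / q ^ (2 ^ k))" "C * 0" 1] by force
  qed
qed

subsection \<open>Roots of unity\<close>

definition unity_root :: "nat \<Rightarrow> nat \<Rightarrow> complex" where
  "unity_root n j = cis (2 * pi * real j / real n)"

lemma norm_unity_root [simp]: "cmod (unity_root n j) = 1"
  by (simp add: unity_root_def)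

lemma cnj_unity_root: "cnj (unity_root n j) * unity_root n j = 1"
  by (simp add: unity_root_def cis_cnj cis_mult)

lemma unity_root_power: "unity_root n j ^ k = unity_root n (j * k)"
  by (simp only: unity_root_def Complex.DeMoivre of_nat_mult times_divide_eq_right) (simp add: mult_ac)

lemma unity_root_power_self: "n > 0 \<Longrightarrow> unity_root n j ^ n = 1"
  using cis_multiple_2pi[of "real j"] by (simp add: unity_root_def Complex.DeMoivre)

lemma sum_unity_root:
  assumes "0 < k" "k < n" shows "(\<Sum>j<n. unity_root n j ^ k) = 0"
proof -
  have "unity_root n k = exp (2 * of_real pi * \<i> * of_nat k / of_nat n)"
    unfolding unity_root_def cis_conv_exp by (simp add: mult_ac)
  then have ne: "unity_root n k \<noteq> 1"
    using complex_root_unity_eq_1[of n k] assms by (auto dest: dvd_imp_le)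
  have "(\<Sum>j<n. unity_root n j ^ k) = (\<Sum>j<n. unity_root n k ^ j)"
    by (simp add: unity_root_power mult.commute)
  also have "\<dots> = 0"
    using geometric_sum[OF ne, of n] unity_root_power_self[of n k] assms by simp
  finally show ?thesis .
qed

lemma sum_cnj_unity_root:
  assumes "0 < k" "k < n" shows "(\<Sum>j<n. cnj (unity_root n j) ^ k) = 0"
proof -
  have "(\<Sum>j<n. cnj (unity_root n j) ^ k) = cnj (\<Sum>j<n. unity_root n j ^ k)" by simp
  then show ?thesis using sum_unity_root[OF assms] by simp
qed

subsection \<open>The norm of a normal element\<close>

text \<open>The form \<open>1 - c *\<^sub>C x\<close> turns the outside of a disc in the spectral
  plane into a compact disc around 0. Continuity comes from the resolvent identity, whose right-hand
  side still contains \<open>f d\<close>; that occurrence has to be bounded first.\<close>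

lemma resolvent_continuous_on:
  fixes x :: "'a::cstar_algebra"
  assumes inv: "\<And>c. c \<in> D \<Longrightarrow> f c * (1 - c *\<^sub>C x) = 1 \<and> (1 - c *\<^sub>C x) * f c = 1"
  shows "continuous_on D f"
  unfolding continuous_on_def
proof
  fix c assume c: "c \<in> D"
  have eq: "f d - f c = (d - c) *\<^sub>C (f d * x * f c)" if d: "d \<in> D" for d
  proof -
    have "f d - f c = f d * ((1 - c *\<^sub>C x) * f c) - (f d * (1 - d *\<^sub>C x)) * f c"
      using inv[OF c] inv[OF d] by simp
    also have "\<dots> = f d * ((1 - c *\<^sub>C x) - (1 - d *\<^sub>C x)) * f c"
      by (simp add: algebra_simps)
    also have "(1 - c *\<^sub>C x) - (1 - d *\<^sub>C x) = (d - c) *\<^sub>C x"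
      by (simp add: cvector_space.scale_left_diff_distrib)
    finally show ?thesis by (simp add: scaleC_mult_left scaleC_mult_right mult.assoc)
  qed
  have bd: "norm (f d - f c) \<le> cmod (d - c) * (norm (f d) * norm x * norm (f c))" if "d \<in> D" for d
  proof -
    have "norm (f d * x * f c) \<le> norm (f d) * norm x * norm (f c)"
      by (metis (no_types) mult_right_mono norm_ge_zero norm_mult_ineq order_trans)
    then show ?thesis by (simp add: eq[OF that] norm_scaleC mult_left_mono)
  qed
  define K where "K = norm x * norm (f c)"
  have "K \<ge> 0" by (simp add: K_def)
  \<comment> \<open>Self-improvement: close to \<open>c\<close> the term with
    \<open>norm (f d)\<close> on the right is at most half of it and is absorbed on the
    left.\<close>
  have small: "norm (f d) \<le> 2 * norm (f c)" if "d \<in> D" "cmod (d - c) * K \<le> 1/2" for d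
  proof -
    have "norm (f d) \<le> norm (f c) + norm (f d - f c)" by (rule norm_triangle_sub)
    also have "norm (f d - f c) \<le> (cmod (d - c) * K) * norm (f d)"
      using bd[OF that(1)] by (simp add: K_def mult_ac)
    also have "\<dots> \<le> 1/2 * norm (f d)" using that(2) by (intro mult_right_mono) auto
    finally show ?thesis by simp
  qed
  have lim: "((\<lambda>d. cmod (d - c) * K) \<longlongrightarrow> 0) (at c within D)"
    by (rule tendsto_eq_intros | simp)+
  have ev: "eventually (\<lambda>d. cmod (d - c) * K < 1/2) (at c within D)"
    using order_tendstoD(2)[OF lim, of "1/2"] by simp
  have evD: "eventually (\<lambda>d. d \<in> D) (at c within D)"
    by (simp add: eventually_at_filter)
  have "eventually (\<lambda>d. norm (f d - f c) \<le> (cmod (d - c) * K) * (2 * norm (f c))) (at c within D)"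
    using ev evD
  proof eventually_elim
    case (elim d)
    have "norm (f d - f c) \<le> (cmod (d - c) * K) * norm (f d)"
      using bd[OF elim(2)] by (simp add: K_def mult_ac)
    also have "\<dots> \<le> (cmod (d - c) * K) * (2 * norm (f c))"
      using small[of d] elim \<open>K \<ge> 0\<close> by (intro mult_left_mono) auto
    finally show ?case .
  qed
  moreover have "((\<lambda>d. (cmod (d - c) * K) * (2 * norm (f c))) \<longlongrightarrow> 0) (at c within D)"
    using tendsto_mult_left_zero[OF lim] by simp
  ultimately have "((\<lambda>d. f d - f c) \<longlongrightarrow> 0) (at c within D)"
    by (rule Lim_null_comparison)
  then show "(f \<longlongrightarrow> f c) (at c within D)" by (simp add: LIM_zero_iff)
qed

lemma geometric_sum_noncomm: "(1 - y) * (\<Sum>k<n. y ^ k) = 1 - (y :: 'a::ring_1) ^ n"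
proof (induction n)
  case (Suc n)
  have "(1 - y) * (\<Sum>k<Suc n. y ^ k) = (1 - y) * (\<Sum>k<n. y ^ k) + (1 - y) * y ^ n"
    by (simp add: distrib_left)
  also have "\<dots> = 1 - y ^ Suc n" unfolding Suc by (simp add: left_diff_distrib)
  finally show ?case .
qed simp

text \<open>Rickart's elementary substitute for Cauchy's integral formula: the average of the resolvent
  over the \<open>n\<close>-th roots of unity is the resolvent of the \<open>n\<close>-th power.\<close>

lemma resolvent_average:
  fixes x :: "'a::cstar_algebra"
  assumes inv: "\<And>c. cmod c \<le> R \<Longrightarrow> f c * (1 - c *\<^sub>C x) = 1 \<and> (1 - c *\<^sub>C x) * f c = 1"
    and r: "0 \<le> r" "r \<le> R" and n: "n > 0"
  shows "((1 / real n) *\<^sub>R (\<Sum>j<n. f (of_real r * unity_root n j))) * (1 - (r *\<^sub>R x) ^ n) = 1"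
proof -
  let ?u = "unity_root n" and ?y = "r *\<^sub>R x"
  have resolvent_term: "f (of_real r * ?u j) * (1 - ?y ^ n) = (\<Sum>k<n. ?u j ^ k *\<^sub>C ?y ^ k)" for j
  proof -
    let ?c = "of_real r * ?u j"
    have c: "?c *\<^sub>C x = ?u j *\<^sub>C ?y"
      by (metis mult.commute scaleC_of_real scaleC_scaleC)
    have "1 - ?y ^ n = 1 - (?c *\<^sub>C x) ^ n"
      unfolding c scaleC_power unity_root_power_self[OF n] by simp
    also have "\<dots> = (1 - ?c *\<^sub>C x) * (\<Sum>k<n. (?c *\<^sub>C x) ^ k)"
      by (simp add: geometric_sum_noncomm)
    finally have "f ?c * (1 - ?y ^ n) = f ?c * (1 - ?c *\<^sub>C x) * (\<Sum>k<n. (?c *\<^sub>C x) ^ k)"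
      by (simp add: mult.assoc)
    also have "f ?c * (1 - ?c *\<^sub>C x) = 1"
      using inv[of ?c] r by (simp add: norm_mult)
    finally show ?thesis unfolding c scaleC_power by simp
  qed
  have "(\<Sum>j<n. f (of_real r * ?u j)) * (1 - ?y ^ n) = (\<Sum>j<n. \<Sum>k<n. ?u j ^ k *\<^sub>C ?y ^ k)"
    unfolding sum_distrib_right resolvent_term ..
  also have "\<dots> = (\<Sum>k<n. (\<Sum>j<n. ?u j ^ k) *\<^sub>C ?y ^ k)"
    by (subst sum.swap) (simp add: cvector_space.scale_sum_left)
  also have "\<dots> = (\<Sum>k<n. if k = 0 then of_nat n *\<^sub>C 1 else 0)"
    by (intro sum.cong refl) (auto simp: sum_unity_root)
  also have "\<dots> = of_nat n *\<^sub>C 1" using n by (simp add: sum.delta)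
  also have "\<dots> = real n *\<^sub>R 1" by (metis of_real_of_nat_eq scaleC_of_real)
  finally show ?thesis using n by simp
qed

text \<open>\<open>F n r\<close> is a left inverse of \<open>1 - (r *\<^sub>R x) ^ n\<close>, and
  uniform continuity of \<open>f\<close> on the compact disc makes \<open>F n r\<close> vary little
  in \<open>r\<close>, uniformly in \<open>n\<close>. So decay at one radius spreads to all radii
  within a fixed distance \<open>\<delta>\<close>, and finitely many such steps starting at 0 reach
  every \<open>r < R\<close>.\<close>

lemma resolvent_decay:
  fixes x :: "'a::cstar_algebra"
  assumes inv: "\<And>c. cmod c \<le> R \<Longrightarrow> f c * (1 - c *\<^sub>C x) = 1 \<and> (1 - c *\<^sub>C x) * f c = 1"
    and r: "0 \<le> r" "r < R"
  shows "(\<lambda>n. (r *\<^sub>R x) ^ n) \<longlonglongrightarrow> 0"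
proof -
  have cont: "continuous_on (cball 0 R) f"
    by (rule resolvent_continuous_on) (use inv in auto)
  then have "uniformly_continuous_on (cball 0 R) f"
    by (intro compact_uniformly_continuous) auto
  then obtain \<delta> where \<delta>: "\<delta> > 0"
    "\<And>c d. c \<in> cball 0 R \<Longrightarrow> d \<in> cball 0 R \<Longrightarrow> dist d c < \<delta> \<Longrightarrow> dist (f d) (f c) < 1/4"
    unfolding uniformly_continuous_on_def by (metis zero_less_divide_1_iff zero_less_numeral)
  define F where "F n r = (1 / real n) *\<^sub>R (\<Sum>j<n. f (of_real r * unity_root n j))" for n r
  have F: "F n r * (1 - (r *\<^sub>R x) ^ n) = 1" if "0 \<le> r" "r \<le> R" "n > 0" for n r
    unfolding F_def using resolvent_average[OF inv that] by simp
  have F_diff: "norm (F n r - F n s) \<le> 1/4"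
    if "0 \<le> r" "r \<le> R" "0 \<le> s" "s \<le> R" "\<bar>r - s\<bar> < \<delta>" "n > 0" for n r s
  proof -
    have "norm (f (of_real r * unity_root n j) - f (of_real s * unity_root n j)) \<le> 1/4" for j
    proof -
      have "of_real r * unity_root n j - of_real s * unity_root n j = of_real (r - s) * unity_root n j"
        by (simp add: algebra_simps)
      then have "dist (of_real r * unity_root n j) (of_real s * unity_root n j) = \<bar>r - s\<bar>"
        by (simp only: dist_norm norm_mult norm_unity_root norm_of_real) simp
      then show ?thesis
        using \<delta>(2)[of "of_real s * unity_root n j" "of_real r * unity_root n j"] that
        by (simp add: dist_norm norm_mult less_imp_le)
    qed
    then have "norm (\<Sum>j<n. f (of_real r * unity_root n j) - f (of_real s * unity_root n j)) \<le> real n * (1/4)"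
      using sum_norm_bound[of "{..<n}" "\<lambda>j. f (of_real r * unity_root n j) - f (of_real s * unity_root n j)" "1/4"]
      by simp
    then have "norm ((1 / real n) *\<^sub>R (\<Sum>j<n. f (of_real r * unity_root n j) - f (of_real s * unity_root n j))) \<le> 1/4"
      using that by (simp add: field_simps)
    then show ?thesis
      unfolding F_def by (simp add: sum_subtractf scaleR_diff_right)
  qed
  have step: "(\<lambda>n. (s *\<^sub>R x) ^ n) \<longlonglongrightarrow> 0"
    if r: "0 \<le> r" "r \<le> R" "(\<lambda>n. (r *\<^sub>R x) ^ n) \<longlonglongrightarrow> 0" and s: "0 \<le> s" "s < R" "r \<le> s" "s < r + \<delta>" for r s
  proof -
    \<comment> \<open>Mere boundedness at a slightly larger \<open>t\<close> suffices: it yields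
      decay at \<open>s\<close> with the factor \<open>(s / t) ^ n\<close>.\<close>
    obtain t where t: "s < t" "t < R" "t < r + \<delta>"
      using dense[of s "min R (r + \<delta>)"] s by auto
    have "eventually (\<lambda>n. norm ((r *\<^sub>R x) ^ n) < 1/4) sequentially"
      using order_tendstoD(2)[OF tendsto_norm_zero[OF r(3)], of "1/4"] by simp
    then have ev: "eventually (\<lambda>n. norm ((t *\<^sub>R x) ^ n) \<le> 2) sequentially"
      using eventually_gt_at_top[of 0]
    proof eventually_elim
      case (elim n)
      let ?y = "(r *\<^sub>R x) ^ n" and ?z = "(t *\<^sub>R x) ^ n"
      have 1: "F n r - 1 = F n r * ?y"
        using F[of r n] r elim by (simp add: algebra_simps)
      have "norm (F n r * ?y) \<le> norm (F n r) * (1/4)"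
        using elim(1) by (intro order_trans[OF norm_mult_ineq] mult_left_mono) auto
      moreover have "norm (F n r) \<le> norm (F n r - 1) + 1"
        using norm_triangle_sub[of "F n r" 1] by simp
      ultimately have 2: "norm (F n r - 1) \<le> 1/3" using 1 by simp
      \<comment> \<open>As \<open>norm e\<close> will be at most 7/12, hence below 1, the identity
        \<open>?z = e * ?z - e\<close> bounds \<open>?z\<close> directly.\<close>
      define e where "e = 1 - F n t"
      have "norm e \<le> norm (F n r - F n t) + norm (F n r - 1)"
        using norm_triangle_ineq4[of "F n r - F n t" "F n r - 1"] by (simp add: e_def)
      also have "\<dots> \<le> 1/4 + 1/3"
        using F_diff[of r t n] 2 r t s elim by (intro add_mono) auto
      finally have e: "norm e \<le> 7/12" by simp
      have "(1 - e) * (1 - ?z) = 1" using F[of t n] t s elim by (simp add: e_def)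
      then have "?z = e * ?z - e" by (simp add: algebra_simps)
      then have "norm ?z \<le> norm (e * ?z) + norm e" by (metis norm_triangle_ineq4)
      also have "\<dots> \<le> 7/12 * norm ?z + 7/12"
        by (intro add_mono e order_trans[OF norm_mult_ineq] mult_right_mono) auto
      finally show "norm ?z \<le> 2" by simp
    qed
    have eq: "(s *\<^sub>R x) ^ n = (s / t) ^ n *\<^sub>R (t *\<^sub>R x) ^ n" for n
      using t s by (simp add: scaleR_power power_divide)
    have "eventually (\<lambda>n. norm ((s *\<^sub>R x) ^ n) \<le> (s / t) ^ n * 2) sequentially"
      using ev
    proof eventually_elim
      case (elim n)
      have "norm ((s *\<^sub>R x) ^ n) = (s / t) ^ n * norm ((t *\<^sub>R x) ^ n)"
        unfolding eq norm_scaleR using t s by simp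
      also have "\<dots> \<le> (s / t) ^ n * 2"
        using elim t s by (intro mult_left_mono) auto
      finally show ?case .
    qed
    moreover have "(\<lambda>n. (s / t) ^ n * 2) \<longlonglongrightarrow> 0"
      using t s by (intro tendsto_mult_left_zero LIMSEQ_power_zero) simp
    ultimately show ?thesis by (rule Lim_null_comparison)
  qed
  \<comment> \<open>Each round extends the range by \<open>\<delta> / 2\<close>, while the
    predecessor used is \<open>s - 3/4 * \<delta>\<close>: near enough for \<open>step\<close> and
    inside the previous range with room to spare.\<close>
  have "\<forall>s. 0 \<le> s \<and> s < R \<and> s < real k * (\<delta> / 2) \<longrightarrow> (\<lambda>n. (s *\<^sub>R x) ^ n) \<longlonglongrightarrow> 0" for k
  proof (induction k)
    case (Suc k)
    show ?case
    proof (intro allI impI, elim conjE)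
      fix s assume s: "0 \<le> s" "s < R" "s < real (Suc k) * (\<delta> / 2)"
      have zero: "(\<lambda>n. (0 *\<^sub>R x) ^ n) \<longlonglongrightarrow> 0"
        by (rule tendsto_eventually) (auto simp: eventually_sequentially power_0_left intro!: exI[of _ 1])
      show "(\<lambda>n. (s *\<^sub>R x) ^ n) \<longlonglongrightarrow> 0"
      proof (cases "s < \<delta>")
        case True
        then show ?thesis using step[of 0 s] zero s r by simp
      next
        case False
        have "0 \<le> s - 3/4 * \<delta>" "s - 3/4 * \<delta> < real k * (\<delta> / 2)"
          using False s \<delta>(1) by (auto simp: algebra_simps)
        then show ?thesis using step[of "s - 3/4 * \<delta>" s] Suc s \<delta>(1) by simp
      qed
    qed
  qed auto
  moreover obtain k where "r < real k * (\<delta> / 2)"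
    using reals_Archimedean3[of "\<delta> / 2"] \<delta>(1) by auto
  ultimately show ?thesis using r by blast
qed

text \<open>The spectral radius formula for normal elements: were \<open>norm x\<close> larger than
  \<open>r\<close>, the powers of \<open>x / t\<close> would tend to 0 for some
  \<open>t < norm x\<close>, but along \<open>2 ^ k\<close> their norms are exactly powers of
  \<open>norm x / t > 1\<close>.\<close>

lemma normal_norm_le:
  fixes x :: "'a::cstar_algebra"
  assumes "normal_elem x" and "r \<ge> 0" and sp: "\<And>c. c \<in> spectrum x \<Longrightarrow> cmod c \<le> r"
  shows "norm x \<le> r"
proof (rule ccontr)
  assume "\<not> norm x \<le> r"
  then obtain t where t: "r < t" "t < norm x" using dense[of r "norm x"] by auto
  obtain u where u: "r < u" "u < t" using dense[of r t] t by auto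
  define inv where "inv c y \<longleftrightarrow> y * (1 - c *\<^sub>C x) = 1 \<and> (1 - c *\<^sub>C x) * y = 1" for c y
  have ex: "\<exists>y. inv c y" if "cmod c \<le> 1 / u" for c
  proof (cases "c = 0")
    case False
    have "cmod (1 / c) > r"
    proof -
      have "u \<le> 1 / cmod c" using that u \<open>r \<ge> 0\<close> False by (simp add: field_simps)
      then show ?thesis using u by (simp add: norm_divide)
    qed
    then have "1 / c \<notin> spectrum x" using sp by force
    then obtain y where "y * ((1 / c) *\<^sub>C 1 - x) = 1" "((1 / c) *\<^sub>C 1 - x) * y = 1"
      unfolding spectrum_def by blast
    moreover have "1 - c *\<^sub>C x = c *\<^sub>C ((1 / c) *\<^sub>C 1 - x)"
      using False by (simp add: cvector_space.scale_right_diff_distrib scaleC_scaleC)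
    ultimately have "inv c ((1 / c) *\<^sub>C y)"
      using False by (simp add: inv_def scaleC_mult_left scaleC_mult_right scaleC_scaleC)
    then show ?thesis ..
  qed (auto simp: inv_def)
  define f where "f c = (SOME y. inv c y)" for c
  have "inv c (f c)" if "cmod c \<le> 1 / u" for c
    using ex[OF that] unfolding f_def by (rule someI_ex)
  then have lim: "(\<lambda>n. ((1 / t) *\<^sub>R x) ^ n) \<longlonglongrightarrow> 0"
    using resolvent_decay[of "1 / u" f x "1 / t"] u t \<open>r \<ge> 0\<close> unfolding inv_def
    by (simp add: frac_less2)
  then have "(\<lambda>n. norm (((1 / t) *\<^sub>R x) ^ n)) \<longlonglongrightarrow> 0" by (rule tendsto_norm_zero)
  then obtain N where N: "\<And>n. n \<ge> N \<Longrightarrow> norm (((1 / t) *\<^sub>R x) ^ n) < 1"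
    using order_tendstoD(2)[of _ 0 sequentially 1] unfolding eventually_sequentially by (metis zero_less_one)
  have "norm (((1 / t) *\<^sub>R x) ^ (2 ^ N)) = (norm x / t) ^ (2 ^ N)"
    using normal_norm_power_2power[OF assms(1), of N] t \<open>r \<ge> 0\<close>
    by (simp add: scaleR_power power_divide)
  moreover have "(norm x / t) ^ (2 ^ N) \<ge> 1"
    using t \<open>r \<ge> 0\<close> by (intro one_le_power) simp
  ultimately show False using N[of "2 ^ N"] less_exp[of N] by (simp add: less_imp_le)
qed

section \<open>Inverses, spectrum and positivity\<close>

lemma neumann_inverse:
  fixes x :: "'a::cstar_algebra"
  assumes "norm x < 1"
  shows "\<exists>y. y * (1 - x) = 1 \<and> (1 - x) * y = 1"
proof -
  have s: "summable (\<lambda>n. x ^ n)"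
    using assms by (rule complete_algebra_summable_geometric)
  let ?y = "\<Sum>n. x ^ n"
  have sp: "?y = 1 + (\<Sum>n. x ^ Suc n)"
    using suminf_split_head[OF s] by simp
  have "x * ?y = (\<Sum>n. x ^ Suc n)" using suminf_mult[OF s, of x] by simp
  moreover have "?y * x = (\<Sum>n. x ^ Suc n)" using suminf_mult2[OF s, of x] by (simp add: power_commutes)
  ultimately show ?thesis using sp by (intro exI[of _ ?y]) (simp add: algebra_simps)
qed

lemma spectrum_norm_le:
  fixes x :: "'a::cstar_algebra"
  assumes "c \<in> spectrum x" shows "cmod c \<le> norm x"
proof (rule ccontr)
  assume "\<not> cmod c \<le> norm x"
  then have lt: "norm x < cmod c" and c: "c \<noteq> 0" by auto
  then have "norm ((1 / c) *\<^sub>C x) < 1" by (simp add: norm_scaleC norm_divide divide_simps)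
  from neumann_inverse[OF this] obtain y where
    "y * (1 - (1 / c) *\<^sub>C x) = 1" "(1 - (1 / c) *\<^sub>C x) * y = 1" by blast
  moreover have "c *\<^sub>C 1 - x = c *\<^sub>C (1 - (1 / c) *\<^sub>C x)"
    using c by (simp add: cvector_space.scale_right_diff_distrib scaleC_scaleC)
  ultimately have "((1 / c) *\<^sub>C y) * (c *\<^sub>C 1 - x) = 1 \<and> (c *\<^sub>C 1 - x) * ((1 / c) *\<^sub>C y) = 1"
    using c by (simp add: scaleC_mult_left scaleC_mult_right scaleC_scaleC)
  with assms show False unfolding spectrum_def by blast
qed

text \<open>The spectrum of the difference lies between 0 and \<open>norm x\<close>. This turns
  order into norm: in this form positivity of a member of a partition of unity bounds the entries of
  its diagonal approximations from below.\<close>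

lemma positive_norm_diff_le:
  fixes x :: "'a::cstar_algebra"
  assumes "positive_elem x"
  shows "norm (norm x *\<^sub>R 1 - x) \<le> norm x"
proof (rule normal_norm_le)
  have x: "star x = x" "spectrum x \<subseteq> \<real>\<^sub>\<ge>\<^sub>0" using assms by (auto simp: positive_elem_def)
  show "normal_elem (norm x *\<^sub>R 1 - x)" by (simp add: normal_elem_def star_diff star_scaleR x)
  fix c assume c: "c \<in> spectrum (norm x *\<^sub>R 1 - x)"
  have eq: "c *\<^sub>C 1 - (norm x *\<^sub>R 1 - x) = - ((of_real (norm x) - c) *\<^sub>C 1 - x)"
    by (simp add: cvector_space.scale_left_diff_distrib scaleC_of_real)
  have "of_real (norm x) - c \<in> spectrum x"
  proof (rule ccontr)
    assume "of_real (norm x) - c \<notin> spectrum x"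
    then obtain y where "y * ((of_real (norm x) - c) *\<^sub>C 1 - x) = 1"
      "((of_real (norm x) - c) *\<^sub>C 1 - x) * y = 1"
      unfolding spectrum_def by blast
    then have "(- y) * (c *\<^sub>C 1 - (norm x *\<^sub>R 1 - x)) = 1"
      "(c *\<^sub>C 1 - (norm x *\<^sub>R 1 - x)) * (- y) = 1"
      unfolding eq by (simp_all only: minus_mult_minus)
    with c show False unfolding spectrum_def by blast
  qed
  then have "of_real (norm x) - c \<in> \<real>\<^sub>\<ge>\<^sub>0" "cmod (of_real (norm x) - c) \<le> norm x"
    using x spectrum_norm_le by auto
  then obtain r where r: "of_real (norm x) - c = of_real r" "0 \<le> r" "r \<le> norm x"
    by (auto elim!: nonneg_Reals_cases)
  then have "c = of_real (norm x - r)" by (simp add: algebra_simps)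
  then show "cmod c \<le> norm x" using r by (simp del: of_real_diff)
qed simp

lemma left_right_inverse_eq:
  fixes a :: "'a::monoid_mult"
  assumes "l * a = 1" "a * r = 1" shows "l = r"
  using assms by (metis mult.assoc mult.left_neutral mult.right_neutral)

text \<open>With empty spectrum \<open>x\<close> would be invertible, its inverse \<open>z\<close>
  again normal, and \<open>spectrum z\<close> would contain at most 0; the norm bound for normal
  elements then gives \<open>z = 0\<close>. This replaces Liouville's theorem.\<close>

lemma spectrum_nonempty:
  fixes x :: "'a::cstar_algebra"
  assumes "normal_elem x" shows "spectrum x \<noteq> {}"
proof
  assume emp: "spectrum x = {}"
  then have "0 \<notin> spectrum x" by simp
  then obtain y where "y * (0 *\<^sub>C 1 - x) = 1" "(0 *\<^sub>C 1 - x) * y = 1"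
    unfolding spectrum_def mem_Collect_eq not_not by blast
  then have y: "(- y) * x = 1" "x * (- y) = 1" by simp_all
  define z where "z = - y"
  have z: "z * x = 1" "x * z = 1" using y by (auto simp: z_def)
  have sz: "star x * star z = 1" "star z * star x = 1" using z by (metis star_mult star_one)+
  have comm: "star x * x = x * star x" using assms by (simp add: normal_elem_def)
  \<comment> \<open>The inverse inherits normality: a factor 1 made of both inverses is inserted so
    that \<open>comm\<close> can be used inside the product.\<close>
  have "star z * z = (z * (star z * star x) * x) * (star z * z)"
    using z sz by simp
  also have "\<dots> = z * star z * (star x * x) * (star z * z)"
    by (simp only: mult.assoc)
  also have "\<dots> = z * star z * (x * (star x * star z) * z)"
    unfolding comm by (simp only: mult.assoc)
  also have "\<dots> = z * star z"
    using z sz by simp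
  finally have "normal_elem z" by (simp add: normal_elem_def)
  moreover have "c = 0" if "c \<in> spectrum z" for c
  proof (rule ccontr)
    assume c: "c \<noteq> 0"
    have "1 / c \<notin> spectrum x" using emp by simp
    then obtain w where w: "w * ((1 / c) *\<^sub>C 1 - x) = 1" "((1 / c) *\<^sub>C 1 - x) * w = 1"
      unfolding spectrum_def by blast
    define b where "b = (1 / c) *\<^sub>C 1 - x"
    have wb: "w * b = 1" "b * w = 1" using w by (simp_all add: b_def)
    have xb: "x * b = b * x"
      by (simp add: b_def algebra_simps scaleC_mult_left scaleC_mult_right)
    have eq: "c *\<^sub>C 1 - z = (- c) *\<^sub>C (z * b)" "c *\<^sub>C 1 - z = (- c) *\<^sub>C (b * z)"
      unfolding b_def using c z by (simp_all add: right_diff_distrib left_diff_distrib scaleC_mult_left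
          scaleC_mult_right scaleC_scaleC cvector_space.scale_right_diff_distrib)
    have "w * x * (b * z) = w * (x * b) * z" by (simp only: mult.assoc)
    also have "\<dots> = (w * b) * (x * z)" unfolding xb by (simp only: mult.assoc)
    finally have 1: "((- 1 / c) *\<^sub>C (w * x)) * (c *\<^sub>C 1 - z) = 1"
      unfolding eq(2) using c wb z by (simp add: scaleC_mult_left scaleC_mult_right scaleC_scaleC)
    have "z * b * (x * w) = z * (b * x) * w" by (simp only: mult.assoc)
    also have "\<dots> = (z * x) * (b * w)" unfolding xb[symmetric] by (simp only: mult.assoc)
    finally have 2: "(c *\<^sub>C 1 - z) * ((- 1 / c) *\<^sub>C (x * w)) = 1"
      unfolding eq(1) using c wb z by (simp add: scaleC_mult_left scaleC_mult_right scaleC_scaleC)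
    have "(- 1 / c) *\<^sub>C (w * x) = (- 1 / c) *\<^sub>C (x * w)"
      using 1 2 by (rule left_right_inverse_eq)
    with 2 have "(c *\<^sub>C 1 - z) * ((- 1 / c) *\<^sub>C (w * x)) = 1" by (simp only:)
    with 1 have "c \<notin> spectrum z" unfolding spectrum_def by blast
    with that show False by simp
  qed
  ultimately have "norm z \<le> 0" by (intro normal_norm_le[of z 0]) force+
  then have "z = 0" by simp
  with z(1) show False by simp
qed

subsection \<open>Square roots and projections\<close>

text \<open>Writing the root as \<open>1 - y\<close> turns \<open>k * k = h\<close> into the fixed
  point equation \<open>y = (1/2) *\<^sub>R (a + y * y)\<close> with \<open>a = 1 - h\<close>, a
  contraction with factor 1/2 on the ball of radius 1/2. Self-adjointness and commutation with
  everything commuting with \<open>h\<close> are built into the complete set \<open>X\<close>, so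
  the fixed point has them; \<open>l\<close> is the inverse root.\<close>

lemma selfadjoint_sqrt_near_one:
  fixes h :: "'a::cstar_algebra"
  assumes h: "star h = h" "norm (h - 1) \<le> 1/2"
  shows "\<exists>k l. star k = k \<and> star l = l \<and> k * k = h \<and> l * k = 1 \<and> k * l = 1 \<and>
    (\<forall>z. z * h = h * z \<longrightarrow> z * l = l * z)"
proof -
  define a where "a = 1 - h"
  have a: "star a = a" "norm a \<le> 1/2"
    using h norm_minus_commute[of h 1] by (auto simp: a_def star_diff)
  define X where "X = {y. norm y \<le> 1/2 \<and> star y = y \<and> (\<forall>z. z * h = h * z \<longrightarrow> z * y = y * z)}"
  have XI: "y \<in> X" if "norm y \<le> 1/2" "star y = y" "\<And>z. z * h = h * z \<Longrightarrow> z * y = y * z" for y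
    using that unfolding X_def by blast
  have XD: "norm y \<le> 1/2" "star y = y" "z * h = h * z \<Longrightarrow> z * y = y * z" if "y \<in> X" for y z
    using that unfolding X_def by blast+
  define g where "g y = (1/2) *\<^sub>R (a + y * y)" for y
  have "closed X"
    unfolding X_def
    by (intro closed_Collect_conj closed_Collect_all closed_Collect_le closed_Collect_eq closed_Collect_imp)
      (auto intro!: continuous_intros continuous_on_star)
  then have "complete X" by (simp add: complete_eq_closed)
  moreover have "X \<noteq> {}" using XI[of 0] by auto
  moreover have "g ` X \<subseteq> X"
  proof
    fix x assume "x \<in> g ` X"
    then obtain y where y: "y \<in> X" "x = g y" by auto
    have "norm (a + y * y) \<le> norm a + norm y * norm y"
      by (rule order_trans[OF norm_triangle_ineq]) (simp add: norm_mult_ineq)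
    also have "\<dots> \<le> 1/2 + 1/2 * (1/2)"
      using XD(1)[OF y(1)] a by (intro add_mono mult_mono) auto
    finally have "norm x \<le> 1/2" by (simp add: y g_def)
    moreover have "star x = x"
      using XD(2)[OF y(1)] a by (simp add: y(2) g_def star_scaleR star_add star_mult)
    moreover have "z * x = x * z" if z: "z * h = h * z" for z
    proof -
      have "z * y = y * z" by (rule XD(3)[OF y(1) z])
      then have zyy: "z * (y * y) = (y * y) * z" by (metis mult.assoc)
      have "z * (a + y * y) = (a + y * y) * z"
        unfolding a_def distrib_left distrib_right zyy right_diff_distrib left_diff_distrib z by simp
      then show ?thesis by (simp add: y(2) g_def)
    qed
    ultimately show "x \<in> X" by (rule XI)
  qed
  moreover have "\<forall>x\<in>X. \<forall>y\<in>X. dist (g x) (g y) \<le> 1/2 * dist x y"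
  proof (intro ballI)
    fix x y assume xy: "x \<in> X" "y \<in> X"
    have "x * x - y * y = x * (x - y) + (x - y) * y" by (simp add: algebra_simps)
    then have "norm (x * x - y * y) \<le> norm x * norm (x - y) + norm (x - y) * norm y"
      by (simp only:) (intro order_trans[OF norm_triangle_ineq] add_mono norm_mult_ineq)
    also have "\<dots> \<le> 1/2 * norm (x - y) + norm (x - y) * (1/2)"
      using xy XD(1) by (intro add_mono mult_right_mono mult_left_mono) auto
    finally have "norm (x * x - y * y) \<le> norm (x - y)" by simp
    moreover have "g x - g y = (1/2) *\<^sub>R (x * x - y * y)"
      by (simp add: g_def algebra_simps)
    ultimately show "dist (g x) (g y) \<le> 1/2 * dist x y" by (simp add: dist_norm)
  qed
  ultimately have "\<exists>!y. y \<in> X \<and> g y = y"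
    using Banach_fix[of X "1/2" g] by simp
  then obtain y where y: "y \<in> X" "g y = y" by blast
  have "2 *\<^sub>R y = 2 *\<^sub>R g y" using y(2) by simp
  then have "2 *\<^sub>R y = a + y * y" by (simp add: g_def)
  then have yy: "y + y = a + y * y" by (simp add: scaleR_2)
  define k where "k = 1 - y"
  have "norm y < 1" using XD(1)[OF y(1)] by simp
  from neumann_inverse[OF this] obtain l where l: "l * k = 1" "k * l = 1"
    unfolding k_def by blast
  have sk: "star k = k" using XD(2)[OF y(1)] by (simp add: k_def star_diff)
  have kk: "k * k = h"
  proof -
    have "k * k = 1 - (y + y) + y * y" by (simp add: k_def algebra_simps)
    then show ?thesis by (simp add: yy a_def)
  qed
  have sl: "star l = l"
  proof (rule left_right_inverse_eq)
    show "star l * k = 1" using l(2) sk by (metis star_mult star_one)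
  qed (rule l(2))
  have ck: "z * k = k * z" if "z * h = h * z" for z
    using XD(3)[OF y(1) that] by (simp add: k_def left_diff_distrib right_diff_distrib)
  have cl: "z * l = l * z" if "z * h = h * z" for z
  proof -
    have "l * (z * k) * l = l * (k * z) * l" using ck[OF that] by simp
    then show ?thesis using l by (metis mult.assoc mult_1_left mult_1_right)
  qed
  show ?thesis using sk sl kk l cl by blast
qed

section \<open>Projections and their equivalence when close\<close>

definition projection_elem :: "'a::cstar_algebra \<Rightarrow> bool" where
  "projection_elem p \<longleftrightarrow> star p = p \<and> p * p = p"

definition mvn_equiv :: "'a::cstar_algebra \<Rightarrow> 'a \<Rightarrow> bool"  (infix "\<sim>" 50) where
  "p \<sim> q \<longleftrightarrow> (\<exists>v. star v * v = p \<and> v * star v = q)"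

lemma projection_mult_left: "projection_elem p \<Longrightarrow> p * (p * x) = p * (x :: 'a::cstar_algebra)"
  by (simp add: projection_elem_def flip: mult.assoc)

lemma projection_diff_one: "projection_elem p \<Longrightarrow> projection_elem (1 - p :: 'a::cstar_algebra)"
  by (simp add: projection_elem_def star_diff algebra_simps)

lemma projection_norm_le_one:
  assumes "projection_elem (p :: 'a::cstar_algebra)" shows "norm p \<le> 1"
proof -
  have "norm p = (norm p)\<^sup>2"
    using cstar_identity[of p] assms by (simp add: projection_elem_def)
  then show ?thesis by (cases "norm p = 0") (auto simp: power2_eq_square)
qed

lemma positive_projection:
  assumes "projection_elem (p :: 'a::cstar_algebra)" shows "positive_elem p"
  unfolding positive_elem_def
proof
  have p: "star p = p" "p * p = p" using assms by (auto simp: projection_elem_def)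
  show "star p = p" by fact
  show "spectrum p \<subseteq> \<real>\<^sub>\<ge>\<^sub>0"
  proof
    fix c assume c: "c \<in> spectrum p"
    have "c = 0 \<or> c = 1"
    proof (rule ccontr)
      assume "\<not> (c = 0 \<or> c = 1)"
      then have c0: "c \<noteq> 0" "c - 1 \<noteq> 0" by auto
      define y where "y = (1 / c) *\<^sub>C (1 - p) + (1 / (c - 1)) *\<^sub>C p"
      have eq: "c *\<^sub>C 1 - p = c *\<^sub>C (1 - p) + (c - 1) *\<^sub>C p"
        by (simp add: cvector_space.scale_left_diff_distrib cvector_space.scale_right_diff_distrib)
      have orth: "(1 - p) * p = 0" "p * (1 - p) = 0" "(1 - p) * (1 - p) = 1 - p"
        using p by (simp_all add: algebra_simps)
      have "y * (c *\<^sub>C 1 - p) = 1" "(c *\<^sub>C 1 - p) * y = 1"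
        unfolding eq y_def distrib_left distrib_right scaleC_mult_left scaleC_mult_right orth p
        using c0 by (simp_all add: scaleC_scaleC)
      with c show False unfolding spectrum_def by blast
    qed
    then show "c \<in> \<real>\<^sub>\<ge>\<^sub>0" by auto
  qed
qed

text \<open>\<open>w\<close> intertwines the projections, \<open>w * p = q * w\<close>, and both
  \<open>star w * w\<close> and \<open>w * star w\<close> equal
  \<open>1 - (p - q) * (p - q)\<close>, which is near 1 and commutes with \<open>p\<close>.
  Multiplying by its inverse square root makes \<open>w\<close> unitary without spoiling the
  intertwining.\<close>

lemma mvn_equiv_if_close:
  fixes p q :: "'a::cstar_algebra"
  assumes "projection_elem p" "projection_elem q" and close: "norm (p - q) \<le> 1/2"
  shows "p \<sim> q"
proof -
  have p: "star p = p" "p * p = p" "\<And>x. p * (p * x) = p * x"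
    and q: "star q = q" "q * q = q" "\<And>x. q * (q * x) = q * x"
    using assms projection_mult_left by (auto simp: projection_elem_def)
  define w where "w = q * p + (1 - q) * (1 - p)"
  define h where "h = 1 - (p - q) * (p - q)"
  have sw: "star w = p * q + (1 - p) * (1 - q)"
    by (simp add: w_def star_add star_mult star_diff p q)
  have h1: "star w * w = h" and h2: "w * star w = h"
    unfolding sw unfolding w_def h_def by (simp_all add: algebra_simps p q)
  have "norm ((p - q) * (p - q)) \<le> 1/2 * (1/2)"
    by (rule order_trans[OF norm_mult_ineq]) (intro mult_mono close, auto)
  then have hn: "norm (h - 1) \<le> 1/2" by (simp add: h_def)
  have sh: "star h = h" by (simp add: h_def star_diff star_mult p q)
  obtain k l where kl: "star k = k" "star l = l" "k * k = h" "l * k = 1" "k * l = 1"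
    and comm: "\<And>z. z * h = h * z \<Longrightarrow> z * l = l * z"
    using selfadjoint_sqrt_near_one[OF sh hn] by blast
  have lhl: "l * h * l = 1" using kl by (metis mult.assoc mult_1_left)
  have "w * h = h * w" using h1 h2 by (metis mult.assoc)
  then have wl: "w * l = l * w" by (rule comm)
  have "p * h = h * p" by (simp add: h_def algebra_simps p q)
  then have pl: "p * l = l * p" by (rule comm)
  have wp: "w * p = q * w" by (simp add: w_def algebra_simps p q)
  define u where "u = w * l"
  have "star u * u = l * (star w * w) * l" by (simp only: u_def star_mult kl mult.assoc)
  then have uu: "star u * u = 1" by (simp add: h1 lhl)
  have "u * star u = (w * l) * (l * star w)" by (simp only: u_def star_mult kl)
  also have "\<dots> = l * (w * star w) * l"
  proof -
    have "star w * l = l * star w" using wl kl by (metis star_mult)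
    then show ?thesis by (simp add: wl mult.assoc)
  qed
  finally have uu': "u * star u = 1" by (simp add: h2 lhl)
  have up: "u * p = q * u" by (metis mult.assoc pl u_def wp)
  have "star (u * p) * (u * p) = p * (star u * u) * p" by (simp only: star_mult p mult.assoc)
  then have 1: "star (u * p) * (u * p) = p" by (simp add: uu p)
  have "(u * p) * star (u * p) = q * (u * star u) * q"
    unfolding up star_mult q by (simp only: mult.assoc)
  then have 2: "(u * p) * star (u * p) = q" by (simp add: uu' q)
  from 1 2 show ?thesis unfolding mvn_equiv_def by blast
qed

subsection \<open>Spectral decomposition of a normal element with finite spectrum\<close>

definition cpoly :: "complex poly \<Rightarrow> 'a::cstar_algebra \<Rightarrow> 'a" where
  "cpoly p x = fold_coeffs (\<lambda>c y. c *\<^sub>C 1 + x * y) p 0"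

lemma cpoly_0 [simp]: "cpoly 0 x = 0"
  by (simp add: cpoly_def)

lemma cpoly_pCons [simp]: "cpoly (pCons c p) x = c *\<^sub>C 1 + x * cpoly p x"
  by (cases "p = 0 \<and> c = 0") (auto simp: cpoly_def)

lemma cpoly_1 [simp]: "cpoly 1 x = 1"
  by (simp add: one_pCons)

lemma cpoly_add: "cpoly (p + q) x = cpoly p x + cpoly q x"
proof (induction p arbitrary: q)
  case (pCons c p)
  show ?case
    by (cases q) (simp add: pCons.IH scaleC_add_left distrib_left)
qed simp

lemma cpoly_smult: "cpoly (smult c p) x = c *\<^sub>C cpoly p x"
  by (induction p) (simp_all add: scaleC_add_right scaleC_scaleC scaleC_mult_right)

lemma cpoly_mult: "cpoly (p * q) x = cpoly p x * cpoly q x"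
  by (induction p)
    (simp_all add: cpoly_add cpoly_smult distrib_right scaleC_mult_left mult.assoc)

lemma cpoly_diff: "cpoly (p - q) x = cpoly p x - cpoly q x"
  using cpoly_add[of "p - q" q x] by (simp add: algebra_simps)

lemma cpoly_sum: "cpoly (sum f A) x = (\<Sum>i\<in>A. cpoly (f i) x)"
  by (induction A rule: infinite_finite_induct) (simp_all add: cpoly_add)

lemma cpoly_commute:
  assumes "z * x = x * z" shows "z * cpoly p x = cpoly p x * z"
proof (induction p)
  case (pCons c p)
  have "z * (x * cpoly p x) = x * (z * cpoly p x)" using assms by (metis mult.assoc)
  then show ?case by (simp add: pCons.IH distrib_left distrib_right scaleC_mult_left scaleC_mult_right mult.assoc)
qed simp

lemma normal_cpoly:
  assumes "normal_elem x" shows "normal_elem (cpoly p x)"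
proof -
  have "star x * cpoly p x = cpoly p x * star x"
    using assms by (intro cpoly_commute) (simp add: normal_elem_def)
  then have "star (cpoly p x) * x = x * star (cpoly p x)"
    by (metis star_mult star_star)
  then show ?thesis unfolding normal_elem_def by (rule cpoly_commute)
qed

text \<open>Half of the spectral mapping theorem: \<open>p\<close> splits into linear factors, each
  of which is invertible at \<open>x\<close>; induction on the degree removes one root at a
  time.\<close>

lemma cpoly_invertible:
  assumes "p \<noteq> 0" and "\<And>c. poly p c = 0 \<Longrightarrow> c \<notin> spectrum x"
  shows "\<exists>y. y * cpoly p x = 1 \<and> cpoly p x * y = 1"
  using assms
proof (induction "degree p" arbitrary: p)
  case 0
  then obtain c where "p = [:c:]" "c \<noteq> 0" by (metis degree_eq_zeroE pCons_0_0)
  then show ?case by (intro exI[of _ "(1 / c) *\<^sub>C 1"]) (simp add: scaleC_mult_left scaleC_scaleC)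
next
  case (Suc d)
  then have "\<not> constant (poly p)" by (simp add: constant_degree)
  then obtain c where c: "poly p c = 0" using fundamental_theorem_of_algebra by blast
  then obtain q where q: "p = [:- c, 1:] * q" by (metis dvdE poly_eq_0_iff_dvd)
  have "q \<noteq> 0" using q Suc by auto
  then have "degree q = d" using Suc.hyps(2) unfolding q by (subst (asm) degree_mult_eq) auto
  then obtain y where y: "y * cpoly q x = 1" "cpoly q x * y = 1"
    using Suc.hyps(1)[of q] \<open>q \<noteq> 0\<close> Suc.prems(2) q by auto
  have "c \<notin> spectrum x" using Suc c by blast
  then obtain z where "z * (c *\<^sub>C 1 - x) = 1" "(c *\<^sub>C 1 - x) * z = 1"
    unfolding spectrum_def by blast
  then have z: "(- z) * (x - c *\<^sub>C 1) = 1" "(x - c *\<^sub>C 1) * (- z) = 1"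
    using minus_mult_minus[of z "c *\<^sub>C 1 - x"] minus_mult_minus[of "c *\<^sub>C 1 - x" z] by simp_all
  have "cpoly [:- c, 1:] x = x - c *\<^sub>C 1" by simp
  then have p: "cpoly p x = (x - c *\<^sub>C 1) * cpoly q x" by (simp only: q cpoly_mult)
  have "(y * (- z)) * cpoly p x = y * ((- z) * (x - c *\<^sub>C 1)) * cpoly q x"
    unfolding p by (simp only: mult.assoc)
  moreover have "cpoly p x * (y * (- z)) = (x - c *\<^sub>C 1) * (cpoly q x * y) * (- z)"
    unfolding p by (simp only: mult.assoc)
  ultimately have "(y * (- z)) * cpoly p x = 1" "cpoly p x * (y * (- z)) = 1"
    by (simp_all only: z y mult_1_left mult_1_right)
  then show ?case by blast
qed

text \<open>With \<open>q = p - star p * p\<close>, normality and idempotence give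
  \<open>star q * q = 0\<close>, so \<open>p\<close> equals the self-adjoint
  \<open>star p * p\<close>.\<close>

lemma normal_idempotent_projection:
  fixes p :: "'a::cstar_algebra"
  assumes "normal_elem p" "p * p = p" shows "projection_elem p"
proof -
  have n: "star p * p = p * star p" using assms by (simp add: normal_elem_def)
  have s: "star p * star p = star p" using assms by (metis star_mult)
  define q where "q = p - star p * p"
  have pq: "p * q = q"
  proof -
    have "p * (star p * p) = star p * (p * p)" using n by (metis mult.assoc)
    then show ?thesis using assms by (simp add: q_def right_diff_distrib)
  qed
  have "star p * q = 0" by (simp add: q_def right_diff_distrib s flip: mult.assoc)
  moreover have "star q = star p - star p * p" by (simp add: q_def star_diff star_mult star_star)
  ultimately have "star q * q = 0"
    by (simp add: left_diff_distrib mult.assoc pq)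
  then have "norm q = 0" using cstar_identity[of q] by simp
  then have "p = star p * p" by (simp add: q_def)
  then have "star p = p" by (metis star_mult star_star)
  then show ?thesis using assms by (simp add: projection_elem_def)
qed

lemma poly_prod_linear_eq_0:
  "finite J \<Longrightarrow> poly (\<Prod>j\<in>J. [:- \<alpha> j, 1:]) (c::complex) = 0 \<longleftrightarrow> (\<exists>j\<in>J. c = \<alpha> j)"
  by (auto simp: poly_prod prod_zero_iff)

text \<open>\<open>cpoly m N\<close> is normal with spectrum in {0}, hence 0, so polynomials in
  \<open>N\<close> matter only modulo \<open>m\<close>. There the Lagrange interpolation polynomials
  \<open>L k\<close> are orthogonal idempotents.\<close>

theorem normal_finite_spectral_decomposition:
  fixes N :: "'a::cstar_algebra"
  assumes normal: "normal_elem N" and inj: "inj_on \<alpha> {1..n}" and sp: "spectrum N = \<alpha> ` {1..n::nat}"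
  shows "\<exists>P. (\<forall>k\<in>{1..n}. projection_elem (P k) \<and> P k \<noteq> 0) \<and>
    (\<forall>j\<in>{1..n}. \<forall>k\<in>{1..n}. j \<noteq> k \<longrightarrow> P j * P k = 0) \<and>
    (\<Sum>k=1..n. P k) = 1 \<and> N = (\<Sum>k=1..n. \<alpha> k *\<^sub>C P k)"
proof -
  let ?I = "{1..n}"
  have "n \<ge> 1" using spectrum_nonempty[OF normal] sp by (cases n) auto
  define lin where "lin j = [:- \<alpha> j, 1:]" for j
  define m where "m = (\<Prod>j\<in>?I. lin j)"
  have m_root: "poly m c = 0 \<longleftrightarrow> c \<in> \<alpha> ` ?I" for c
    unfolding m_def lin_def by (subst poly_prod_linear_eq_0) auto
  have m0: "cpoly m N = 0"
  proof -
    have "c = 0" if "c \<in> spectrum (cpoly m N)" for c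
    proof (rule ccontr)
      assume c: "c \<noteq> 0"
      have "[:c:] - m \<noteq> 0"
      proof
        assume "[:c:] - m = 0"
        then have "poly ([:c:] - m) (\<alpha> 1) = 0" by simp
        moreover have "poly m (\<alpha> 1) = 0" using m_root \<open>n \<ge> 1\<close> by auto
        ultimately show False using c by simp
      qed
      then have "\<exists>y. y * cpoly ([:c:] - m) N = 1 \<and> cpoly ([:c:] - m) N * y = 1"
        by (rule cpoly_invertible) (use c sp m_root in auto)
      moreover have "cpoly ([:c:] - m) N = c *\<^sub>C 1 - cpoly m N" by (simp add: cpoly_diff)
      ultimately have "c \<notin> spectrum (cpoly m N)" unfolding spectrum_def by simp
      with that show False by simp
    qed
    then have "norm (cpoly m N) \<le> 0"
      by (intro normal_norm_le[of _ 0] normal_cpoly normal) force+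
    then show ?thesis by simp
  qed
  define r where "r k = (\<Prod>j\<in>?I - {k}. lin j)" for k
  have mr: "m = lin k * r k" if "k \<in> ?I" for k
    unfolding m_def r_def using that by (intro prod.remove) auto
  have r_root: "poly (r k) c = 0 \<longleftrightarrow> (\<exists>j\<in>?I - {k}. c = \<alpha> j)" for k c
    unfolding r_def lin_def by (subst poly_prod_linear_eq_0) auto
  have rk: "poly (r k) (\<alpha> k) \<noteq> 0" if "k \<in> ?I" for k
    using inj that unfolding r_root by (auto dest: inj_onD)
  define L where "L k = smult (1 / poly (r k) (\<alpha> k)) (r k)" for k
  have L: "poly (L k) (\<alpha> j) = (if j = k then 1 else 0)" if "k \<in> ?I" "j \<in> ?I" for j k
    using rk[OF that(1)] r_root[of k "\<alpha> j"] that by (auto simp: L_def)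
  have deg: "degree (L k) < n" if "k \<in> ?I" for k
  proof -
    have "degree (r k) \<le> (\<Sum>j\<in>?I - {k}. degree (lin j))" using degree_prod_sum_le[of "?I - {k}" lin] by (simp add: r_def o_def)
    also have "\<dots> = n - 1" using that by (simp add: lin_def)
    finally show ?thesis using \<open>n \<ge> 1\<close> degree_smult_le[of _ "r k"] unfolding L_def by (meson diff_less le_less_trans less_le_trans zero_less_one)
  qed
  \<comment> \<open>Both sides have degree below \<open>n\<close> and agree at the \<open>n\<close>
    distinct points.\<close>
  have sumL: "(\<Sum>k\<in>?I. L k) = 1"
  proof (rule poly_eqI_degree[of "\<alpha> ` ?I"])
    have card: "card (\<alpha> ` ?I) = n" using inj by (simp add: card_image)
    show "degree (\<Sum>k\<in>?I. L k) < card (\<alpha> ` ?I)"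
      unfolding card using deg \<open>n \<ge> 1\<close> by (intro degree_sum_less) auto
    show "degree (1 :: complex poly) < card (\<alpha> ` ?I)" using card \<open>n \<ge> 1\<close> by simp
    fix x assume "x \<in> \<alpha> ` ?I"
    then obtain j where "j \<in> ?I" "x = \<alpha> j" by auto
    then show "poly (\<Sum>k\<in>?I. L k) x = poly 1 x" by (simp add: poly_sum L)
  qed
  define P where "P k = cpoly (L k) N" for k
  have sumP: "(\<Sum>k\<in>?I. P k) = 1"
    unfolding P_def cpoly_sum[symmetric] sumL by simp
  have dvd0: "cpoly p N = 0" if "m dvd p" for p
    using that m0 by (auto simp: cpoly_mult elim!: dvdE)
  have orth: "P j * P k = 0" if "j \<in> ?I" "k \<in> ?I" "j \<noteq> k" for j k
  proof -
    have "r k = lin j * (\<Prod>i\<in>?I - {k} - {j}. lin i)"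
      unfolding r_def using that by (intro prod.remove) auto
    then have "r j * r k = m * (\<Prod>i\<in>?I - {k} - {j}. lin i)"
      using mr[of j] that by (simp add: mult_ac)
    then have "m dvd L j * L k" by (simp add: L_def dvd_smult)
    from dvd0[OF this] show ?thesis by (simp add: P_def cpoly_mult)
  qed
  have idem: "P k * P k = P k" if k: "k \<in> ?I" for k
  proof -
    have "P k = P k * (\<Sum>j\<in>?I. P j)" by (simp add: sumP)
    also have "\<dots> = (\<Sum>j\<in>?I. if j = k then P k * P k else 0)"
      unfolding sum_distrib_left using orth k by (intro sum.cong) auto
    finally show ?thesis using k by simp
  qed
  have NP: "N * P k = \<alpha> k *\<^sub>C P k" if "k \<in> ?I" for k
  proof -
    have "m dvd lin k * L k" using mr[OF that] by (simp add: L_def dvd_smult)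
    from dvd0[OF this] have "cpoly (lin k) N * P k = 0" by (simp add: P_def cpoly_mult)
    moreover have "cpoly (lin k) N = N - \<alpha> k *\<^sub>C 1" by (simp add: lin_def)
    ultimately show ?thesis by (simp add: left_diff_distrib scaleC_mult_left)
  qed
  have N: "N = (\<Sum>k\<in>?I. \<alpha> k *\<^sub>C P k)"
  proof -
    have "N = N * (\<Sum>k\<in>?I. P k)" by (simp add: sumP)
    also have "\<dots> = (\<Sum>k\<in>?I. \<alpha> k *\<^sub>C P k)" by (simp add: sum_distrib_left NP)
    finally show ?thesis .
  qed
  have nz: "P k \<noteq> 0" if k: "k \<in> ?I" for k
  proof
    assume "P k = 0"
    then have r0: "cpoly (r k) N = 0"
      using rk[OF k] by (simp add: P_def L_def cpoly_smult)
    have rknz: "r k \<noteq> 0" unfolding r_def lin_def by (simp add: prod_zero_iff)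
    have "\<alpha> k \<in> spectrum N" using sp k by auto
    moreover have "\<alpha> k \<notin> spectrum N"
    proof -
      \<comment> \<open>If \<open>r k\<close> annihilated \<open>N\<close>, dividing
        \<open>r k\<close> minus its value \<open>c\<close> at \<open>\<alpha> k\<close> by the
        linear factor would exhibit an inverse of \<open>N - \<alpha> k *\<^sub>C 1\<close> up to
        the scalar \<open>- c\<close>.\<close>
      define q where "q = r k - [:poly (r k) (\<alpha> k):]"
      have "poly q (\<alpha> k) = 0" by (simp add: q_def)
      then obtain s where s: "q = [:- \<alpha> k, 1:] * s" by (metis dvdE poly_eq_0_iff_dvd)
      define c where "c = poly (r k) (\<alpha> k)"
      have lk: "cpoly [:- \<alpha> k, 1:] N = N - \<alpha> k *\<^sub>C 1" by simp
      have q: "cpoly q N = - (c *\<^sub>C 1)" unfolding q_def c_def by (simp add: cpoly_diff r0)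
      have 1: "(N - \<alpha> k *\<^sub>C 1) * cpoly s N = - (c *\<^sub>C 1)"
        using q unfolding s cpoly_mult lk .
      have 2: "cpoly s N * (N - \<alpha> k *\<^sub>C 1) = - (c *\<^sub>C 1)"
        using q unfolding s mult.commute[of _ s] cpoly_mult lk .
      have c: "c \<noteq> 0" using rk[OF k] by (simp add: c_def)
      have eq: "\<alpha> k *\<^sub>C 1 - N = - (N - \<alpha> k *\<^sub>C 1)" by simp
      have "((1 / c) *\<^sub>C cpoly s N) * (\<alpha> k *\<^sub>C 1 - N) = 1"
        unfolding eq mult_minus_right scaleC_mult_left 2 using c by (simp add: scaleC_scaleC)
      moreover have "(\<alpha> k *\<^sub>C 1 - N) * ((1 / c) *\<^sub>C cpoly s N) = 1"
        unfolding eq mult_minus_left scaleC_mult_right 1 using c by (simp add: scaleC_scaleC)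
      ultimately show ?thesis unfolding spectrum_def by blast
    qed
    ultimately show False by simp
  qed
  have proj: "projection_elem (P k)" if "k \<in> ?I" for k
    using normal_idempotent_projection[OF _ idem[OF that]] normal_cpoly[OF normal] by (simp add: P_def)
  have "(\<forall>k\<in>?I. projection_elem (P k) \<and> P k \<noteq> 0) \<and>
    (\<forall>j\<in>?I. \<forall>k\<in>?I. j \<noteq> k \<longrightarrow> P j * P k = 0)"
    using proj nz orth by blast
  then show ?thesis using sumP N by blast
qed

subsection \<open>Words in a Cuntz family\<close>

text \<open>The relations alone, without generation: the images of the generators under an
  endomorphism form such a family but may generate a smaller algebra.\<close>

definition cuntz_family :: "(nat \<Rightarrow> 'a::cstar_algebra) \<Rightarrow> bool" where
  "cuntz_family T \<longleftrightarrow> isometry_elem (T 1) \<and> isometry_elem (T 2) \<and>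
     T 1 * star (T 1) + T 2 * star (T 2) = 1"

text \<open>Inserting the relation between \<open>star (T 1)\<close> and \<open>T 2\<close> gives
  \<open>x = x + x\<close> for the mixed product.\<close>

lemma cuntz_family_inner:
  assumes T: "cuntz_family T" and "i \<in> {1, 2}" "j \<in> {1, 2}"
  shows "star (T i) * T j = (if i = j then 1 else 0)"
proof -
  have iso: "star (T 1) * T 1 = 1" "star (T 2) * T 2 = 1" and sum1: "T 1 * star (T 1) + T 2 * star (T 2) = 1"
    using T by (auto simp: cuntz_family_def isometry_elem_def)
  have "star (T 1) * T 2 = star (T 1) * (T 1 * star (T 1) + T 2 * star (T 2)) * T 2"
    by (simp add: sum1)
  also have "\<dots> = (star (T 1) * T 1) * star (T 1) * T 2 + star (T 1) * T 2 * (star (T 2) * T 2)"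
    by (simp only: distrib_left distrib_right mult.assoc)
  finally have 0: "star (T 1) * T 2 = 0" by (simp add: iso)
  then have "star (T 2) * T 1 = 0" by (metis star_mult star_star star_zero)
  with 0 iso assms(2,3) show ?thesis by auto
qed

lemma word_elem_Nil [simp]: "word_elem T [] = 1"
  and word_elem_Cons [simp]: "word_elem T (i # \<mu>) = T i * word_elem T \<mu>"
  by (simp_all add: word_elem_def)

lemma word_elem_append: "word_elem T (\<mu> @ \<nu>) = word_elem T \<mu> * word_elem T \<nu>"
  by (induction \<mu>) (simp_all add: mult.assoc)

lemma word_elem_replicate: "word_elem T (replicate k i) = T i ^ k"
  by (induction k) simp_all

definition words_of :: "nat \<Rightarrow> nat list set" where
  "words_of m = {\<mu> \<in> lists {1, 2}. length \<mu> = m}"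

lemma finite_words_of [simp]: "finite (words_of m)"
  using finite_lists_length_eq[of "{1, 2::nat}" m]
  by (simp add: words_of_def lists_eq_set conj_commute)

lemma words_of_0: "words_of 0 = {[]}"
  by (auto simp: words_of_def)

lemma words_of_Suc: "words_of (Suc m) = (#) 1 ` words_of m \<union> (#) 2 ` words_of m"
  by (auto simp: words_of_def length_Suc_conv image_iff)

lemma sum_words_of_Suc:
  "(\<Sum>\<mu>\<in>words_of (Suc m). f \<mu>) = (\<Sum>\<mu>\<in>words_of m. f (1 # \<mu>)) + (\<Sum>\<mu>\<in>words_of m. f (2 # \<mu>))"
  unfolding words_of_Suc by (subst sum.union_disjoint) (auto simp: sum.reindex)

lemma card_words_of: "card (words_of m) = 2 ^ m"
proof (induction m)
  case (Suc m)
  then show ?case using sum_words_of_Suc[of "\<lambda>_. 1::nat" m] by simp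
qed (simp add: words_of_0)

lemma word_inner:
  assumes T: "cuntz_family T" and "\<mu> \<in> words_of m" "\<nu> \<in> words_of m"
  shows "star (word_elem T \<mu>) * word_elem T \<nu> = (if \<mu> = \<nu> then 1 else 0)"
  using assms(2,3)
proof (induction m arbitrary: \<mu> \<nu>)
  case (Suc m)
  then obtain i j \<mu>' \<nu>' where *: "\<mu> = i # \<mu>'" "\<nu> = j # \<nu>'" "\<mu>' \<in> words_of m" "\<nu>' \<in> words_of m"
    "i \<in> {1, 2}" "j \<in> {1, 2}"
    by (auto simp: words_of_Suc)
  have "star (word_elem T \<mu>) * word_elem T \<nu> = star (word_elem T \<mu>') * (star (T i) * T j) * word_elem T \<nu>'"
    unfolding *(1,2) word_elem_Cons star_mult by (simp only: mult.assoc)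
  also have "\<dots> = (if i = j then star (word_elem T \<mu>') * word_elem T \<nu>' else 0)"
    using cuntz_family_inner[OF T *(5,6)] by simp
  finally show ?case using Suc.IH[OF *(3,4)] *(1,2) by auto
qed (simp add: words_of_0)

lemma isometry_word:
  assumes "cuntz_family T" "\<mu> \<in> lists {1, 2}" shows "isometry_elem (word_elem T \<mu>)"
  using word_inner[of T \<mu> "length \<mu>" \<mu>] assms by (simp add: words_of_def isometry_elem_def)

lemma sum_word_projections:
  assumes T: "cuntz_family T"
  shows "(\<Sum>\<mu>\<in>words_of m. word_elem T \<mu> * star (word_elem T \<mu>)) = 1"
proof (induction m)
  case (Suc m)
  have "(\<Sum>\<mu>\<in>words_of m. word_elem T (i # \<mu>) * star (word_elem T (i # \<mu>))) = T i * star (T i)" for i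
  proof -
    have "(\<Sum>\<mu>\<in>words_of m. word_elem T (i # \<mu>) * star (word_elem T (i # \<mu>)))
        = T i * (\<Sum>\<mu>\<in>words_of m. word_elem T \<mu> * star (word_elem T \<mu>)) * star (T i)"
      by (simp add: sum_distrib_left sum_distrib_right star_mult mult.assoc)
    then show ?thesis by (simp add: Suc)
  qed
  with T show ?case by (simp only: sum_words_of_Suc cuntz_family_def)
qed (simp add: words_of_0)

lemma word_star_mult:
  assumes T: "cuntz_family T" and "\<nu> \<in> lists {1, 2}" "\<alpha> \<in> lists {1, 2}" "length \<nu> \<le> length \<alpha>"
  shows "star (word_elem T \<nu>) * word_elem T \<alpha> =
    (if take (length \<nu>) \<alpha> = \<nu> then word_elem T (drop (length \<nu>) \<alpha>) else 0)"
proof -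
  let ?\<beta> = "take (length \<nu>) \<alpha>"
  have "?\<beta> \<in> words_of (length \<nu>)" "\<nu> \<in> words_of (length \<nu>)"
    using assms set_take_subset[of "length \<nu>" \<alpha>] by (auto simp: words_of_def lists_eq_set)
  note inner = word_inner[OF T this(2,1)]
  have "star (word_elem T \<nu>) * word_elem T \<alpha>
      = star (word_elem T \<nu>) * word_elem T ?\<beta> * word_elem T (drop (length \<nu>) \<alpha>)"
    using word_elem_append[of T ?\<beta> "drop (length \<nu>) \<alpha>"] by (simp add: mult.assoc)
  then show ?thesis by (auto simp: inner)
qed

subsection \<open>Word polynomials\<close>

text \<open>Word polynomials are functions of the Cuntz family, so that substituting one family for
  another is mere evaluation; the rule \<open>cong\<close> builds in the Cuntz relations.\<close>

inductive wspan :: "(nat list \<times> nat list) set \<Rightarrow> ((nat \<Rightarrow> 'a::cstar_algebra) \<Rightarrow> 'a) \<Rightarrow> bool"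
  for X where
  monomial: "(\<mu>, \<nu>) \<in> X \<Longrightarrow> wspan X (\<lambda>T. c *\<^sub>C (word_elem T \<mu> * star (word_elem T \<nu>)))"
| zero: "wspan X (\<lambda>T. 0)"
| add: "wspan X f \<Longrightarrow> wspan X g \<Longrightarrow> wspan X (\<lambda>T. f T + g T)"
| cong: "wspan X f \<Longrightarrow> (\<And>T. cuntz_family T \<Longrightarrow> g T = f T) \<Longrightarrow> wspan X g"

lemma wspan_monomial1: "(\<mu>, \<nu>) \<in> X \<Longrightarrow> wspan X (\<lambda>T. word_elem T \<mu> * star (word_elem T \<nu>))"
  using wspan.monomial[of \<mu> \<nu> X 1] by simp

lemma wspan_mono: "wspan X f \<Longrightarrow> X \<subseteq> Y \<Longrightarrow> wspan Y f"
  by (induction rule: wspan.induct) (auto intro: wspan.intros)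

lemma wspan_scaleC: "wspan X f \<Longrightarrow> wspan X (\<lambda>T. c *\<^sub>C f T)"
proof (induction rule: wspan.induct)
  case (monomial \<mu> \<nu> d)
  then show ?case using wspan.monomial[of \<mu> \<nu> X "c * d"] by (simp add: scaleC_scaleC)
next
  case (add f g)
  then show ?case by (simp add: scaleC_add_right wspan.add)
next
  case (cong f g)
  show ?case by (rule wspan.cong[OF cong.IH]) (simp add: cong.hyps)
qed (simp add: wspan.zero)

lemma wspan_diff:
  assumes "wspan X f" "wspan X g" shows "wspan X (\<lambda>T. f T - g T)"
  using wspan.add[OF assms(1) wspan_scaleC[OF assms(2), of "-1"]] by simp

lemma wspan_sum: "(\<And>i. i \<in> I \<Longrightarrow> wspan X (f i)) \<Longrightarrow> wspan X (\<lambda>T. \<Sum>i\<in>I. f i T)"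
  by (induction I rule: infinite_finite_induct) (auto intro: wspan.intros)

lemma wspan_star:
  assumes "wspan X f" and X: "\<And>\<mu> \<nu>. (\<mu>, \<nu>) \<in> X \<Longrightarrow> (\<nu>, \<mu>) \<in> Y"
  shows "wspan Y (\<lambda>T. star (f T))"
  using assms(1)
proof (induction rule: wspan.induct)
  case (monomial \<mu> \<nu> c)
  then show ?case using wspan.monomial[OF X, of \<mu> \<nu> "cnj c"] by (simp add: star_scaleC star_mult star_star)
next
  case (add f g)
  then show ?case by (simp add: star_add wspan.add)
next
  case (cong f g)
  show ?case by (rule wspan.cong[OF cong.IH]) (simp add: cong.hyps)
qed (simp add: wspan.zero)

lemma wspan_mult:
  fixes f g :: "(nat \<Rightarrow> 'a::cstar_algebra) \<Rightarrow> 'a"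
  assumes f: "wspan X f" and g: "wspan Y g"
    and XY: "\<And>\<mu> \<nu> \<alpha> \<beta>. (\<mu>, \<nu>) \<in> X \<Longrightarrow> (\<alpha>, \<beta>) \<in> Y \<Longrightarrow>
      wspan Z (\<lambda>T :: nat \<Rightarrow> 'a. word_elem T \<mu> * star (word_elem T \<nu>) * (word_elem T \<alpha> * star (word_elem T \<beta>)))"
  shows "wspan Z (\<lambda>T. f T * g T)"
  using f
proof (induction rule: wspan.induct)
  case (monomial \<mu> \<nu> c)
  note \<mu>\<nu> = this
  show ?case using g
  proof (induction rule: wspan.induct)
    case (monomial \<alpha> \<beta> d)
    from wspan_scaleC[OF XY[OF \<mu>\<nu> monomial], of "c * d"] show ?case
      by (simp add: scaleC_mult_left scaleC_mult_right scaleC_scaleC mult.commute)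
  next
    case (add f g)
    then show ?case by (simp add: distrib_left wspan.add)
  next
    case (cong f g)
    show ?case by (rule wspan.cong[OF cong.IH]) (simp add: cong.hyps)
  qed (simp add: wspan.zero)
next
  case (add f g)
  then show ?case by (simp add: distrib_right wspan.add)
next
  case (cong f g)
  show ?case by (rule wspan.cong[OF cong.IH]) (simp add: cong.hyps)
qed (simp add: wspan.zero)

text \<open>In \<open>star (word_elem T \<nu>) * word_elem T \<alpha>\<close> either the shorter
  word is a prefix of the longer and only the remainder \<open>\<gamma>\<close> survives, or the
  product is 0; the last two premises are the two cases of survival.\<close>

lemma wspan_monomial_mult:
  assumes w: "\<mu> \<in> lists {1, 2}" "\<nu> \<in> lists {1, 2}" "\<alpha> \<in> lists {1, 2}" "\<beta> \<in> lists {1, 2}"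
    and 1: "\<And>\<gamma>. \<gamma> \<in> lists {1, 2} \<Longrightarrow> \<alpha> = \<nu> @ \<gamma> \<Longrightarrow> (\<mu> @ \<gamma>, \<beta>) \<in> Z"
    and 2: "\<And>\<gamma>. \<gamma> \<in> lists {1, 2} \<Longrightarrow> \<nu> = \<alpha> @ \<gamma> \<Longrightarrow> (\<mu>, \<beta> @ \<gamma>) \<in> Z"
  shows "wspan Z (\<lambda>T. word_elem T \<mu> * star (word_elem T \<nu>) * (word_elem T \<alpha> * star (word_elem T \<beta>)))"
proof (cases "length \<nu> \<le> length \<alpha>")
  case True
  show ?thesis
  proof (cases "take (length \<nu>) \<alpha> = \<nu>")
    case t: True
    define \<gamma> where "\<gamma> = drop (length \<nu>) \<alpha>"
    have g: "\<gamma> \<in> lists {1, 2}" "\<alpha> = \<nu> @ \<gamma>"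
      using w t append_take_drop_id[of "length \<nu>" \<alpha>] by (auto simp: \<gamma>_def lists_eq_set dest: in_set_dropD)
    show ?thesis
    proof (rule wspan.cong[OF wspan_monomial1[OF 1[OF g]]])
      fix T :: "nat \<Rightarrow> 'a" assume T: "cuntz_family T"
      have "star (word_elem T \<nu>) * word_elem T \<alpha> = word_elem T \<gamma>"
        using word_star_mult[OF T w(2,3) True] t by (simp add: \<gamma>_def)
      then show "word_elem T \<mu> * star (word_elem T \<nu>) * (word_elem T \<alpha> * star (word_elem T \<beta>)) =
          word_elem T (\<mu> @ \<gamma>) * star (word_elem T \<beta>)"
        by (metis mult.assoc word_elem_append)
    qed
  next
    case False
    show ?thesis
    proof (rule wspan.cong[OF wspan.zero])
      fix T :: "nat \<Rightarrow> 'a" assume T: "cuntz_family T"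
      have "star (word_elem T \<nu>) * word_elem T \<alpha> = 0"
        using word_star_mult[OF T w(2,3) True] False by simp
      then show "word_elem T \<mu> * star (word_elem T \<nu>) * (word_elem T \<alpha> * star (word_elem T \<beta>)) = 0"
        by (metis mult.assoc mult_zero_left mult_zero_right)
    qed
  qed
next
  case False
  then have le: "length \<alpha> \<le> length \<nu>" by simp
  have swap: "star (word_elem T \<nu>) * word_elem T \<alpha> = star (star (word_elem T \<alpha>) * word_elem T \<nu>)" for T
    by (simp add: star_mult star_star)
  show ?thesis
  proof (cases "take (length \<alpha>) \<nu> = \<alpha>")
    case t: True
    define \<gamma> where "\<gamma> = drop (length \<alpha>) \<nu>"
    have g: "\<gamma> \<in> lists {1, 2}" "\<nu> = \<alpha> @ \<gamma>"
      using w t append_take_drop_id[of "length \<alpha>" \<nu>] by (auto simp: \<gamma>_def lists_eq_set dest: in_set_dropD)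
    show ?thesis
    proof (rule wspan.cong[OF wspan_monomial1[OF 2[OF g]]])
      fix T :: "nat \<Rightarrow> 'a" assume T: "cuntz_family T"
      have "star (word_elem T \<nu>) * word_elem T \<alpha> = star (word_elem T \<gamma>)"
        unfolding swap using word_star_mult[OF T w(3,2) le] t by (simp add: \<gamma>_def)
      then show "word_elem T \<mu> * star (word_elem T \<nu>) * (word_elem T \<alpha> * star (word_elem T \<beta>)) =
          word_elem T \<mu> * star (word_elem T (\<beta> @ \<gamma>))"
        by (metis mult.assoc word_elem_append star_mult)
    qed
  next
    case False
    show ?thesis
    proof (rule wspan.cong[OF wspan.zero])
      fix T :: "nat \<Rightarrow> 'a" assume T: "cuntz_family T"
      have "star (word_elem T \<nu>) * word_elem T \<alpha> = 0"
        unfolding swap using word_star_mult[OF T w(3,2) le] False by simp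
      then show "word_elem T \<mu> * star (word_elem T \<nu>) * (word_elem T \<alpha> * star (word_elem T \<beta>)) = 0"
        by (metis mult.assoc mult_zero_left mult_zero_right)
    qed
  qed
qed

text \<open>Bounds the difference of the lengths and not the lengths: this degree is additive under
  products, so it grows only linearly with the exponent of a power.\<close>

definition degree_words :: "nat \<Rightarrow> (nat list \<times> nat list) set" where
  "degree_words d = {(\<mu>, \<nu>). \<mu> \<in> lists {1, 2} \<and> \<nu> \<in> lists {1, 2} \<and>
     length \<mu> \<le> length \<nu> + d \<and> length \<nu> \<le> length \<mu> + d}"

text \<open>Pairs of exact length \<open>m\<close> index the matrix units of the full matrix algebra
  of size \<open>2 ^ m\<close>, which is closed under products.\<close>

definition balanced_words :: "nat \<Rightarrow> (nat list \<times> nat list) set" where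
  "balanced_words m = words_of m \<times> words_of m"

text \<open>Bounds the lengths themselves, for the compression, which controls words only up to a
  given length.\<close>

definition bounded_words :: "nat \<Rightarrow> (nat list \<times> nat list) set" where
  "bounded_words m = {(\<mu>, \<nu>). \<mu> \<in> lists {1, 2} \<and> \<nu> \<in> lists {1, 2} \<and> length \<mu> \<le> m \<and> length \<nu> \<le> m}"

abbreviation word_poly :: "((nat \<Rightarrow> 'a::cstar_algebra) \<Rightarrow> 'a) \<Rightarrow> bool" where
  "word_poly f \<equiv> wspan (lists {1, 2} \<times> lists {1, 2}) f"

lemma wspan_degree_mult:
  assumes "wspan (degree_words d) f" "wspan (degree_words e) g"
  shows "wspan (degree_words (d + e)) (\<lambda>T. f T * g T)"
  using assms by (rule wspan_mult) (rule wspan_monomial_mult; auto simp: degree_words_def)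

lemma wspan_balanced_mult:
  assumes "wspan (balanced_words m) f" "wspan (balanced_words m) g"
  shows "wspan (balanced_words m) (\<lambda>T. f T * g T)"
  using assms by (rule wspan_mult) (rule wspan_monomial_mult; auto simp: balanced_words_def words_of_def)

lemma word_poly_mult:
  assumes "word_poly f" "word_poly g" shows "word_poly (\<lambda>T. f T * g T)"
  using assms by (rule wspan_mult) (rule wspan_monomial_mult; auto)

lemma word_poly_star: "word_poly f \<Longrightarrow> word_poly (\<lambda>T. star (f T))"
  by (rule wspan_star) auto

lemma word_poly_bounded: "word_poly f \<Longrightarrow> \<exists>m. wspan (bounded_words m) f"
proof (induction rule: wspan.induct)
  case (monomial \<mu> \<nu> c)
  then show ?case
    by (intro exI[of _ "max (length \<mu>) (length \<nu>)"] wspan.monomial) (auto simp: bounded_words_def)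
next
  case (add f g)
  then obtain m n where "wspan (bounded_words m) f" "wspan (bounded_words n) g" by auto
  then have "wspan (bounded_words (max m n)) f" "wspan (bounded_words (max m n)) g"
    by (auto elim!: wspan_mono simp: bounded_words_def)
  then show ?case by (blast intro: wspan.add)
qed (blast intro: wspan.intros)+

lemma bounded_subset_degree: "bounded_words m \<subseteq> degree_words m"
  by (auto simp: bounded_words_def degree_words_def)

text \<open>Inserting the sum of all word projections of length \<open>j\<close> between the two
  words embeds matrices of size \<open>2 ^ m\<close> into those of size
  \<open>2 ^ (m + j)\<close>.\<close>

lemma wspan_balanced_raise:
  assumes "wspan (balanced_words m) f" shows "wspan (balanced_words (m + j)) f"
  using assms
proof (induction rule: wspan.induct)
  case (monomial \<mu> \<nu> c)
  show ?case
  proof (rule wspan.cong[OF wspan_sum])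
    fix \<kappa> assume "\<kappa> \<in> words_of j"
    then show "wspan (balanced_words (m + j)) (\<lambda>T. c *\<^sub>C (word_elem T (\<mu> @ \<kappa>) * star (word_elem T (\<nu> @ \<kappa>))))"
      using monomial by (intro wspan.monomial) (auto simp: balanced_words_def words_of_def)
  next
    fix T :: "nat \<Rightarrow> 'a" assume T: "cuntz_family T"
    have "word_elem T \<mu> * star (word_elem T \<nu>) =
        word_elem T \<mu> * (\<Sum>\<kappa>\<in>words_of j. word_elem T \<kappa> * star (word_elem T \<kappa>)) * star (word_elem T \<nu>)"
      by (simp add: sum_word_projections[OF T])
    also have "\<dots> = (\<Sum>\<kappa>\<in>words_of j. word_elem T (\<mu> @ \<kappa>) * star (word_elem T (\<nu> @ \<kappa>)))"
      by (simp add: sum_distrib_left sum_distrib_right word_elem_append star_mult mult.assoc)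
    finally show "c *\<^sub>C (word_elem T \<mu> * star (word_elem T \<nu>)) =
        (\<Sum>\<kappa>\<in>words_of j. c *\<^sub>C (word_elem T (\<mu> @ \<kappa>) * star (word_elem T (\<nu> @ \<kappa>))))"
      by (simp add: cvector_space.scale_sum_right)
  qed
qed (blast intro: wspan.intros)+

definition balanced_poly :: "((nat \<Rightarrow> 'a::cstar_algebra) \<Rightarrow> 'a) \<Rightarrow> bool" where
  "balanced_poly f \<longleftrightarrow> (\<exists>m. wspan (balanced_words m) f)"

lemma balanced_poly_zero: "balanced_poly (\<lambda>T. 0)"
  by (auto simp: balanced_poly_def intro: wspan.zero)

lemma balanced_poly_add:
  assumes "balanced_poly f" "balanced_poly g" shows "balanced_poly (\<lambda>T. f T + g T)"
proof -
  obtain m n where "wspan (balanced_words m) f" "wspan (balanced_words n) g"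
    using assms by (auto simp: balanced_poly_def)
  then have "wspan (balanced_words (m + n)) f" "wspan (balanced_words (m + n)) g"
    using wspan_balanced_raise[of m f n] wspan_balanced_raise[of n g m] by (simp_all add: add.commute)
  then show ?thesis by (auto simp: balanced_poly_def intro: wspan.add)
qed

text \<open>The order of quantifiers is the point: one scalar serves every Cuntz family, so matrix
  entries can be carried from \<open>S\<close> to \<open>T\<close>.\<close>

lemma balanced_entry:
  assumes "wspan (balanced_words m) f" "\<mu> \<in> words_of m" "\<nu> \<in> words_of m"
  shows "\<exists>c. \<forall>T. cuntz_family T \<longrightarrow> star (word_elem T \<mu>) * f T * word_elem T \<nu> = c *\<^sub>C 1"
  using assms(1)
proof (induction rule: wspan.induct)
  case (monomial \<alpha> \<beta> c)
  then have ab: "\<alpha> \<in> words_of m" "\<beta> \<in> words_of m" by (auto simp: balanced_words_def)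
  show ?case
  proof (intro exI[of _ "if \<mu> = \<alpha> \<and> \<beta> = \<nu> then c else 0"] allI impI)
    fix T :: "nat \<Rightarrow> 'a" assume T: "cuntz_family T"
    have "star (word_elem T \<mu>) * (c *\<^sub>C (word_elem T \<alpha> * star (word_elem T \<beta>))) * word_elem T \<nu> =
        c *\<^sub>C ((star (word_elem T \<mu>) * word_elem T \<alpha>) * (star (word_elem T \<beta>) * word_elem T \<nu>))"
      by (simp only: scaleC_mult_left scaleC_mult_right mult.assoc)
    then show "star (word_elem T \<mu>) * (c *\<^sub>C (word_elem T \<alpha> * star (word_elem T \<beta>))) * word_elem T \<nu> =
        (if \<mu> = \<alpha> \<and> \<beta> = \<nu> then c else 0) *\<^sub>C 1"
      by (simp add: word_inner[OF T assms(2) ab(1)] word_inner[OF T ab(2) assms(3)])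
  qed
next
  case zero
  show ?case by (intro exI[of _ 0]) simp
next
  case (add f g)
  then obtain c d where
    "\<forall>T. cuntz_family T \<longrightarrow> star (word_elem T \<mu>) * f T * word_elem T \<nu> = c *\<^sub>C 1"
    "\<forall>T. cuntz_family T \<longrightarrow> star (word_elem T \<mu>) * g T * word_elem T \<nu> = d *\<^sub>C 1" by blast
  then show ?case by (intro exI[of _ "c + d"]) (simp add: distrib_left distrib_right scaleC_add_left)
next
  case (cong f g)
  then show ?case by simp
qed

text \<open>Crude on purpose: there are \<open>4 ^ m\<close> matrix entries, each transported
  exactly and bounded by \<open>norm (f S)\<close>.\<close>

lemma balanced_norm_le_dim:
  assumes f: "wspan (balanced_words m) f" and S: "cuntz_family S" and T: "cuntz_family T"
  shows "norm (f T) \<le> 4 ^ m * norm (f S)"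
proof -
  let ?w = "word_elem T"
  have nw: "norm (word_elem U \<mu>) = 1" if "cuntz_family U" "\<mu> \<in> words_of m" for U :: "nat \<Rightarrow> 'a" and \<mu>
    using isometry_word[OF that(1)] that(2) norm_isometry by (auto simp: words_of_def)
  have entry: "norm (?w \<mu> * (star (?w \<mu>) * f T * ?w \<nu>) * star (?w \<nu>)) \<le> norm (f S)"
    if words: "\<mu> \<in> words_of m" "\<nu> \<in> words_of m" for \<mu> \<nu>
  proof -
    obtain c where c: "\<And>T. cuntz_family T \<Longrightarrow> star (word_elem T \<mu>) * f T * word_elem T \<nu> = c *\<^sub>C 1"
      using balanced_entry[OF f words] by blast
    have "norm (?w \<mu> * (star (?w \<mu>) * f T * ?w \<nu>) * star (?w \<nu>)) \<le> norm (?w \<mu>) * cmod c * norm (?w \<nu>)"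
      unfolding c[OF T] using norm_mult_ineq[of "?w \<mu>" "star (?w \<nu>)"]
      by (simp add: scaleC_mult_left scaleC_mult_right norm_scaleC mult_ac mult_left_mono)
    also have "\<dots> = norm (star (word_elem S \<mu>) * f S * word_elem S \<nu>)"
      unfolding c[OF S] using nw[OF T] words by (simp add: norm_scaleC)
    also have "\<dots> \<le> norm (star (word_elem S \<mu>)) * norm (f S) * norm (word_elem S \<nu>)"
      by (intro order_trans[OF norm_mult_ineq] mult_right_mono norm_mult_ineq) auto
    finally show ?thesis using nw[OF S] words by simp
  qed
  have "f T = (\<Sum>\<mu>\<in>words_of m. ?w \<mu> * star (?w \<mu>)) * f T * (\<Sum>\<nu>\<in>words_of m. ?w \<nu> * star (?w \<nu>))"
    by (simp add: sum_word_projections[OF T])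
  also have "\<dots> = (\<Sum>\<mu>\<in>words_of m. \<Sum>\<nu>\<in>words_of m. ?w \<mu> * (star (?w \<mu>) * f T * ?w \<nu>) * star (?w \<nu>))"
    unfolding sum_distrib_left sum_distrib_right by (subst sum.swap) (simp only: mult.assoc)
  also have "norm \<dots> \<le> (\<Sum>\<mu>\<in>words_of m. \<Sum>\<nu>\<in>words_of m. norm (f S))"
    by (intro order_trans[OF norm_sum] sum_mono entry)
  also have "\<dots> = 4 ^ m * norm (f S)"
    by (simp add: card_words_of flip: power_mult_distrib)
  finally show ?thesis .
qed

lemma norm_gram_power: "norm ((star x * x) ^ (2 ^ k)) = ((norm (x :: 'a::cstar_algebra))\<^sup>2) ^ (2 ^ k)"
  using selfadjoint_norm_power_2power[of "star x * x" k] by (simp add: star_mult star_star cstar_identity)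

lemma power_2power_Suc: "x ^ (2 ^ Suc k) = x ^ (2 ^ k) * (x :: 'a::monoid_mult) ^ (2 ^ k)"
  by (simp add: mult_2 power_add)

text \<open>Powers of \<open>star (f T) * f T\<close> remain in the same matrix algebra, so the
  factor \<open>4 ^ m\<close> does not grow with the exponent and disappears in the comparison of
  powers.\<close>

lemma balanced_norm_le:
  assumes "balanced_poly f" and S: "cuntz_family S" and T: "cuntz_family T"
  shows "norm (f T) \<le> norm (f S)"
proof -
  obtain m where f: "wspan (balanced_words m) f" using assms by (auto simp: balanced_poly_def)
  have "wspan (balanced_words m) (\<lambda>T. star (f T))"
    using f by (rule wspan_star) (auto simp: balanced_words_def)
  then have h: "wspan (balanced_words m) (\<lambda>T. star (f T) * f T)"
    using f by (rule wspan_balanced_mult)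
  have hk: "wspan (balanced_words m) (\<lambda>T. (star (f T) * f T) ^ (2 ^ k))" for k
  proof (induction k)
    case (Suc k)
    show ?case unfolding power_2power_Suc by (rule wspan_balanced_mult[OF Suc Suc])
  qed (use h in simp)
  have "(norm (f T))\<^sup>2 \<le> (norm (f S))\<^sup>2"
  proof (rule le_if_powers_le_linear[where C = "4 ^ m"])
    fix k
    have "((norm (f T))\<^sup>2) ^ (2 ^ k) \<le> 4 ^ m * ((norm (f S))\<^sup>2) ^ (2 ^ k)"
      using balanced_norm_le_dim[OF hk[of k] S T] by (simp only: norm_gram_power)
    also have "\<dots> \<le> 4 ^ m * 2 ^ k * ((norm (f S))\<^sup>2) ^ (2 ^ k)"
      by (intro mult_right_mono) auto
    finally show "((norm (f T))\<^sup>2) ^ (2 ^ k) \<le> 4 ^ m * 2 ^ k * ((norm (f S))\<^sup>2) ^ (2 ^ k)" .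
  qed auto
  then show ?thesis by (rule power2_le_imp_le) simp
qed

lemma continuous_on_wspan:
  assumes "wspan X f" and "X \<subseteq> lists {1, 2} \<times> lists {1, 2}"
    and T: "\<And>t. t \<in> I \<Longrightarrow> cuntz_family (T t)"
    and cont: "\<And>i. i \<in> {1, 2} \<Longrightarrow> continuous_on I (\<lambda>t. T t i)"
  shows "continuous_on I (\<lambda>t. f (T t))"
  using assms(1)
proof (induction rule: wspan.induct)
  case (monomial \<mu> \<nu> c)
  have "continuous_on I (\<lambda>t. word_elem (T t) \<mu>)" if "\<mu> \<in> lists {1, 2}" for \<mu>
    using that by (induction \<mu>) (auto intro!: continuous_intros cont)
  then show ?case using monomial assms(2)
    by (auto intro!: continuous_intros continuous_on_scaleC continuous_on_star)
next
  case (add f g)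
  then show ?case by (intro continuous_intros)
next
  case (cong f g)
  then show ?case using T by (simp cong: continuous_on_cong)
qed simp

subsection \<open>Endomorphisms of the Cuntz algebra\<close>

lemma cuntz_O2_family: "cuntz_O2 S \<Longrightarrow> cuntz_family S"
  by (simp add: cuntz_O2_def cuntz_family_def)

lemma cuntz_O2_closure_word_poly:
  assumes "cuntz_O2 S" shows "closure {f S | f. word_poly f} = UNIV"
proof -
  let ?B = "{f S | f. word_poly f}"
  have seq: "\<exists>F. (\<forall>n::nat. word_poly (F n)) \<and> (\<lambda>n. F n S) \<longlonglongrightarrow> x" if x: "x \<in> closure ?B" for x
  proof -
    obtain y where y: "\<And>n::nat. y n \<in> ?B" "y \<longlonglongrightarrow> x"
      using x unfolding closure_sequential by blast
    have "\<forall>n. \<exists>f. word_poly f \<and> y n = f S" using y(1) by blast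
    then obtain F where "\<forall>n. word_poly (F n) \<and> y n = F n S" by metis
    then have "\<forall>n. word_poly (F n)" "y = (\<lambda>n. F n S)" by auto
    with y(2) show ?thesis by blast
  qed
  have I: "x \<in> closure ?B" if "\<And>n::nat. word_poly (F n)" "(\<lambda>n. F n S) \<longlonglongrightarrow> x" for F x
    unfolding closure_sequential by (rule exI[of _ "\<lambda>n. F n S"]) (use that in blast)
  have "unital_cstar_subalgebra (closure ?B)"
    unfolding unital_cstar_subalgebra_def
  proof (intro conjI ballI cvector_space.subspaceI)
    show "0 \<in> closure ?B" by (rule I[of "\<lambda>_ _. 0"]) (auto intro: wspan.zero)
    have "word_poly (\<lambda>T. word_elem T [] * star (word_elem T []))" by (rule wspan_monomial1) auto
    then show "1 \<in> closure ?B" by (intro I[of "\<lambda>_ _. 1"]) auto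
    fix x assume x: "x \<in> closure ?B"
    then obtain F where F: "\<And>n::nat. word_poly (F n)" "(\<lambda>n. F n S) \<longlonglongrightarrow> x" using seq by blast
    show "c *\<^sub>C x \<in> closure ?B" for c
      by (rule I[of "\<lambda>n T. c *\<^sub>C F n T"]) (auto intro!: wspan_scaleC F tendsto_scaleC)
    show "star x \<in> closure ?B"
      by (rule I[of "\<lambda>n T. star (F n T)"]) (auto intro!: word_poly_star F tendsto_star)
    fix y assume "y \<in> closure ?B"
    then obtain G where G: "\<And>n::nat. word_poly (G n)" "(\<lambda>n. G n S) \<longlonglongrightarrow> y" using seq by blast
    show "x + y \<in> closure ?B"
      by (rule I[of "\<lambda>n T. F n T + G n T"]) (auto intro!: wspan.add F G tendsto_add)
    show "x * y \<in> closure ?B"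
      by (rule I[of "\<lambda>n T. F n T * G n T"]) (auto intro!: word_poly_mult F G tendsto_mult)
  qed auto
  moreover have "{S 1, S 2} \<subseteq> closure ?B"
  proof -
    have "S i \<in> ?B" if i: "i \<in> {1, 2}" for i
    proof (intro CollectI exI conjI)
      show "S i = (\<lambda>T. word_elem T [i] * star (word_elem T [])) S" by simp
      show "word_poly (\<lambda>T. word_elem T [i] * star (word_elem T []))"
        by (rule wspan_monomial1) (use i in auto)
    qed
    then show ?thesis using closure_subset[of ?B] by blast
  qed
  ultimately have "cstar_generated {S 1, S 2} \<subseteq> closure ?B"
    unfolding cstar_generated_def by blast
  then show ?thesis using assms by (auto simp: cuntz_O2_def)
qed

lemma closed_cspan_base: "x \<in> X \<Longrightarrow> x \<in> closed_cspan X"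
  unfolding closed_cspan_def by (meson closure_subset cvector_space.span_base subsetD)

section \<open>Norm comparison through the gauge expectation\<close>

locale gauge_expectation =
  fixes S :: "nat \<Rightarrow> 'a::cstar_algebra" and EF :: "'a \<Rightarrow> 'a"
  assumes cuntz: "cuntz_O2 S" and expectation: "canonical_expectation_UHF S EF"
begin

lemma family: "cuntz_family S"
  using cuntz by (rule cuntz_O2_family)

lemma EF_add: "EF (x + y) = EF x + EF y"
  and EF_scaleC: "EF (c *\<^sub>C x) = c *\<^sub>C EF x"
  and EF_norm_le: "norm (EF x) \<le> norm x"
  using expectation by (auto simp: canonical_expectation_UHF_def conditional_expectation_def)

lemma EF_zero: "EF 0 = 0"
  using EF_scaleC[of 0 0] by simp

lemma EF_word:
  assumes "\<mu> \<in> lists {1, 2}" "\<nu> \<in> lists {1, 2}"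
  shows "EF (word_elem S \<mu> * star (word_elem S \<nu>)) =
    (if length \<mu> = length \<nu> then word_elem S \<mu> * star (word_elem S \<nu>) else 0)"
proof (cases "length \<mu> = length \<nu>")
  case True
  have "word_elem S \<mu> * star (word_elem S \<nu>) \<in> UHF_subalgebra S"
    unfolding UHF_subalgebra_def by (rule closed_cspan_base) (use assms True in blast)
  moreover have "\<forall>b\<in>UHF_subalgebra S. EF b = b"
    using expectation unfolding canonical_expectation_UHF_def conditional_expectation_def by blast
  ultimately show ?thesis using True by simp
next
  case False
  then have "EF (word_elem S \<mu> * star (word_elem S \<nu>)) = 0"
    using expectation assms unfolding canonical_expectation_UHF_def by blast
  then show ?thesis using False by simp
qed

text \<open>The Fourier series of the gauge action, finite for a word polynomial: the part of degree
  \<open>k \<ge> 0\<close> is a balanced coefficient times \<open>T 1 ^ k\<close>, the part of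
  degree \<open>- k\<close> is \<open>star (T 1) ^ k\<close> times one. The coefficients are formal,
  so they evaluate at every family, while at \<open>S\<close> they are values of \<open>EF\<close>
  and hence controlled in norm.\<close>

lemma fourier_decomposition:
  assumes "wspan (degree_words d) f"
  shows "\<exists>g h. (\<forall>k. balanced_poly (g k) \<and> balanced_poly (h k)) \<and>
    (\<forall>T. cuntz_family T \<longrightarrow>
      f T = (\<Sum>k\<le>d. g k T * T 1 ^ k) + (\<Sum>k=1..d. star (T 1) ^ k * h k T)) \<and>
    (\<forall>k. EF (f S * star (S 1) ^ k) = g k S) \<and> (\<forall>k\<ge>1. EF (S 1 ^ k * f S) = h k S)"
    (is "\<exists>g h. ?P f g h")
  using assms
proof (induction rule: wspan.induct)
  case (monomial \<mu> \<nu> c)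
  then have w: "\<mu> \<in> lists {1, 2}" "\<nu> \<in> lists {1, 2}" "length \<mu> \<le> length \<nu> + d" "length \<nu> \<le> length \<mu> + d"
    by (auto simp: degree_words_def)
  define one where "one k = replicate k (1::nat)" for k
  have one: "one k \<in> lists {1, 2}" "length (one k) = k" "word_elem T (one k) = T 1 ^ k" for k and T :: "nat \<Rightarrow> 'a"
    by (auto simp: one_def word_elem_replicate)
  define F where "F T = c *\<^sub>C (word_elem T \<mu> * star (word_elem T \<nu>))" for T :: "nat \<Rightarrow> 'a"
  have right: "F T * star (T 1) ^ k = c *\<^sub>C (word_elem T \<mu> * star (word_elem T (one k @ \<nu>)))" for k T
    by (simp add: F_def word_elem_append one star_mult star_power scaleC_mult_left mult.assoc)
  have left: "T 1 ^ k * F T = c *\<^sub>C (word_elem T (one k @ \<mu>) * star (word_elem T \<nu>))" for k T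
    by (simp add: F_def word_elem_append one scaleC_mult_right mult.assoc)
  have EFr: "EF (F S * star (S 1) ^ k) = (if length \<mu> = k + length \<nu> then F S * star (S 1) ^ k else 0)" for k
    unfolding right EF_scaleC using w one by (subst EF_word) auto
  have EFl: "EF (S 1 ^ k * F S) = (if length \<nu> = k + length \<mu> then S 1 ^ k * F S else 0)" for k
    unfolding left EF_scaleC using w one by (subst EF_word) auto
  have cancel: "star (T 1) ^ k * T 1 ^ k = 1" if "cuntz_family T" for T :: "nat \<Rightarrow> 'a" and k
    using isometry_word[OF that one(1)[of k]] by (simp add: isometry_elem_def one star_power)
  show ?case
  proof (cases "length \<nu> \<le> length \<mu>")
    case True
    \<comment> \<open>A monomial has a single degree. Degree 0 is counted in this case, which is why
      the sum over \<open>h\<close> starts at 1.\<close>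
    define k0 where "k0 = length \<mu> - length \<nu>"
    have k0: "length \<mu> = k + length \<nu> \<longleftrightarrow> k = k0" "length \<nu> = k + length \<mu> \<longleftrightarrow> k0 = 0 \<and> k = 0" "k0 \<le> d" for k
      using True w by (auto simp: k0_def)
    define g where "g k = (if k = k0 then (\<lambda>T. F T * star (T 1) ^ k0) else (\<lambda>T. 0))" for k
    have "wspan (balanced_words (length \<mu>)) (\<lambda>T. F T * star (T 1) ^ k0)"
      unfolding right using w one[where k = k0] True
      by (intro wspan.monomial) (auto simp: balanced_words_def words_of_def k0_def)
    then have "balanced_poly (\<lambda>T. F T * star (T 1) ^ k0)" unfolding balanced_poly_def by blast
    then have 1: "balanced_poly (g k)" for k
      using balanced_poly_zero by (cases "k = k0") (simp_all add: g_def)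
    have 2: "F T = (\<Sum>k\<le>d. g k T * T 1 ^ k)" if T: "cuntz_family T" for T
    proof -
      have "(\<Sum>k\<le>d. g k T * T 1 ^ k) = (\<Sum>k\<le>d. if k = k0 then F T * (star (T 1) ^ k0 * T 1 ^ k0) else 0)"
        by (intro sum.cong) (auto simp: g_def mult.assoc)
      then show ?thesis using k0(3) cancel[OF T] by simp
    qed
    have 3: "EF (F S * star (S 1) ^ k) = g k S" for k
      by (simp only: EFr k0 g_def split: if_split) simp
    have 4: "EF (S 1 ^ k * F S) = 0" if "k \<ge> 1" for k
      using that by (simp only: EFl k0 split: if_split) simp
    have "?P F g (\<lambda>_ _. 0)"
      using 1 2 3 4 balanced_poly_zero by simp
    then show ?thesis unfolding F_def by (intro exI[of _ g] exI[of _ "\<lambda>_ _. 0"])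
  next
    case False
    define k0 where "k0 = length \<nu> - length \<mu>"
    have k0: "length \<nu> = k + length \<mu> \<longleftrightarrow> k = k0" "\<not> length \<mu> = k + length \<nu>" "k0 \<le> d" "k0 \<ge> 1" for k
      using False w by (auto simp: k0_def)
    define h where "h k = (if k = k0 then (\<lambda>T. T 1 ^ k0 * F T) else (\<lambda>T. 0))" for k
    have "wspan (balanced_words (length \<nu>)) (\<lambda>T. T 1 ^ k0 * F T)"
      unfolding left using w one[where k = k0] False
      by (intro wspan.monomial) (auto simp: balanced_words_def words_of_def k0_def)
    then have "balanced_poly (\<lambda>T. T 1 ^ k0 * F T)" unfolding balanced_poly_def by blast
    then have 1: "balanced_poly (h k)" for k
      using balanced_poly_zero by (cases "k = k0") (simp_all add: h_def)
    have 2: "F T = (\<Sum>k=1..d. star (T 1) ^ k * h k T)" if T: "cuntz_family T" for T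
    proof -
      have "(\<Sum>k=1..d. star (T 1) ^ k * h k T) = (\<Sum>k=1..d. if k = k0 then (star (T 1) ^ k0 * T 1 ^ k0) * F T else 0)"
        by (intro sum.cong) (auto simp: h_def mult.assoc)
      then show ?thesis using k0(3,4) cancel[OF T] by simp
    qed
    have 3: "EF (F S * star (S 1) ^ k) = 0" for k
      by (simp only: EFr k0 if_False)
    have 4: "EF (S 1 ^ k * F S) = h k S" for k
      by (simp only: EFl k0 h_def split: if_split) simp
    have "?P F (\<lambda>_ _. 0) h"
      using 1 2 3 4 balanced_poly_zero by simp
    then show ?thesis unfolding F_def by (intro exI[of _ "\<lambda>_ _. 0"] exI[of _ h])
  qed
next
  case zero
  have "?P (\<lambda>T. 0) (\<lambda>_ _. 0) (\<lambda>_ _. 0)" by (simp add: EF_zero balanced_poly_zero)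
  then show ?case by (intro exI[of _ "\<lambda>_ _. 0"])
next
  case (add f f')
  then obtain g h g' h' where 1: "?P f g h" and 2: "?P f' g' h'" by blast
  have "?P (\<lambda>T. f T + f' T) (\<lambda>k T. g k T + g' k T) (\<lambda>k T. h k T + h' k T)"
    using 1 2 by (simp add: balanced_poly_add distrib_left distrib_right EF_add sum.distrib)
  then show ?case
    by (intro exI[of _ "\<lambda>k T. g k T + g' k T"] exI[of _ "\<lambda>k T. h k T + h' k T"])
next
  case (cong f f')
  then obtain g h where "?P f g h" by blast
  moreover have "f' S = f S" by (rule cong.hyps(2)[OF family])
  moreover have "(\<forall>T. cuntz_family T \<longrightarrow> f' T = X T) \<longleftrightarrow> (\<forall>T. cuntz_family T \<longrightarrow> f T = X T)" for X
    using cong.hyps(2) by fastforce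
  ultimately have "?P f' g h" by (simp only:) simp
  then show ?case by (intro exI[of _ g] exI[of _ h])
qed

text \<open>There are \<open>d + 1\<close> coefficients \<open>g\<close> and \<open>d\<close>
  coefficients \<open>h\<close>. At \<open>S\<close> each is bounded by \<open>norm (f S)\<close>
  since \<open>EF\<close> is contractive, and passing to \<open>T\<close> costs nothing for balanced
  elements.\<close>

lemma word_poly_norm_le_degree:
  assumes f: "wspan (degree_words d) f" and T: "cuntz_family T"
  shows "norm (f T) \<le> (2 * real d + 1) * norm (f S)"
proof -
  obtain g h where bal: "\<And>k. balanced_poly (g k)" "\<And>k. balanced_poly (h k)"
    and fT: "f T = (\<Sum>k\<le>d. g k T * T 1 ^ k) + (\<Sum>k=1..d. star (T 1) ^ k * h k T)"
    and EFg: "\<And>k. EF (f S * star (S 1) ^ k) = g k S" and EFh: "\<And>k. k \<ge> 1 \<Longrightarrow> EF (S 1 ^ k * f S) = h k S"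
    using fourier_decomposition[OF f] T by blast
  have pow: "norm (U 1 ^ k) \<le> 1" "norm (star (U 1) ^ k) \<le> 1" if "cuntz_family U" for U :: "nat \<Rightarrow> 'a" and k
  proof -
    have "norm (U 1) = 1" using that norm_isometry by (auto simp: cuntz_family_def)
    then show "norm (U 1 ^ k) \<le> 1" "norm (star (U 1) ^ k) \<le> 1"
      using norm_power_ineq[of "U 1" k] norm_power_ineq[of "star (U 1)" k] by simp_all
  qed
  have "norm (g k T * T 1 ^ k) \<le> norm (f S)" for k
  proof -
    have "norm (g k T * T 1 ^ k) \<le> norm (g k T)"
      using mult_left_le[OF pow(1)[OF T] norm_ge_zero] by (rule order_trans[OF norm_mult_ineq])
    also have "\<dots> \<le> norm (g k S)" by (rule balanced_norm_le[OF bal(1) family T])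
    also have "\<dots> \<le> norm (f S * star (S 1) ^ k)" unfolding EFg[symmetric] by (rule EF_norm_le)
    also have "\<dots> \<le> norm (f S)"
      using mult_left_le[OF pow(2)[OF family] norm_ge_zero] by (rule order_trans[OF norm_mult_ineq])
    finally show ?thesis .
  qed
  moreover have "norm (star (T 1) ^ k * h k T) \<le> norm (f S)" if "k \<ge> 1" for k
  proof -
    have "norm (star (T 1) ^ k * h k T) \<le> norm (h k T)"
      using mult_right_mono[OF pow(2)[OF T] norm_ge_zero[of "h k T"]]
      by (intro order_trans[OF norm_mult_ineq]) simp
    also have "\<dots> \<le> norm (h k S)" by (rule balanced_norm_le[OF bal(2) family T])
    also have "\<dots> \<le> norm (S 1 ^ k * f S)" unfolding EFh[OF that, symmetric] by (rule EF_norm_le)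
    also have "\<dots> \<le> norm (f S)"
      using mult_right_mono[OF pow(1)[OF family] norm_ge_zero[of "f S"]]
      by (intro order_trans[OF norm_mult_ineq]) simp
    finally show ?thesis .
  qed
  ultimately have "norm (f T) \<le> (\<Sum>k\<le>d. norm (f S)) + (\<Sum>k=1..d. norm (f S))"
    unfolding fT by (intro order_trans[OF norm_triangle_ineq] add_mono order_trans[OF norm_sum] sum_mono) auto
  then show ?thesis by (simp add: algebra_simps)
qed

text \<open>The norm of a word polynomial does not depend on the Cuntz family. This replaces
  the simplicity of the Cuntz algebra.\<close>

lemma word_poly_norm_le:
  assumes "word_poly f" and T: "cuntz_family T"
  shows "norm (f T) \<le> norm (f S)"
proof -
  obtain d where "wspan (bounded_words d) f" using word_poly_bounded[OF assms(1)] by blast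
  then have f: "wspan (degree_words d) f" by (rule wspan_mono) (rule bounded_subset_degree)
  have "wspan (degree_words d) (\<lambda>T. star (f T))"
    using f by (rule wspan_star) (auto simp: degree_words_def)
  then have h: "wspan (degree_words (d + d)) (\<lambda>T. star (f T) * f T)"
    using f by (rule wspan_degree_mult)
  have hk: "wspan (degree_words (2 ^ k * (d + d))) (\<lambda>T. (star (f T) * f T) ^ (2 ^ k))" for k
  proof (induction k)
    case (Suc k)
    show ?case unfolding power_2power_Suc using wspan_degree_mult[OF Suc Suc]
      by (simp add: mult_2 distrib_right)
  qed (use h in simp)
  have "(norm (f T))\<^sup>2 \<le> (norm (f S))\<^sup>2"
  proof (rule le_if_powers_le_linear[where C = "4 * real d + 1"])
    fix k
    have "((norm (f T))\<^sup>2) ^ (2 ^ k) \<le> (2 * real (2 ^ k * (d + d)) + 1) * ((norm (f S))\<^sup>2) ^ (2 ^ k)"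
      using word_poly_norm_le_degree[OF hk[of k] T] by (simp only: norm_gram_power)
    also have "\<dots> \<le> (4 * real d + 1) * 2 ^ k * ((norm (f S))\<^sup>2) ^ (2 ^ k)"
      by (intro mult_right_mono) (auto simp: algebra_simps)
    finally show "((norm (f T))\<^sup>2) ^ (2 ^ k) \<le> (4 * real d + 1) * 2 ^ k * ((norm (f S))\<^sup>2) ^ (2 ^ k)" .
  qed auto
  then show ?thesis by (rule power2_le_imp_le) simp
qed

lemma word_poly_seq:
  "\<exists>F. (\<forall>n::nat. word_poly (F n)) \<and> (\<lambda>n. F n S) \<longlonglongrightarrow> a"
proof -
  have "a \<in> closure {f S | f. word_poly f}" using cuntz_O2_closure_word_poly[OF cuntz] by simp
  then obtain y where y: "\<And>n::nat. y n \<in> {f S | f. word_poly f}" "y \<longlonglongrightarrow> a"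
    unfolding closure_sequential by blast
  have "\<forall>n. \<exists>f. word_poly f \<and> y n = f S" using y(1) by blast
  then obtain F where "\<forall>n. word_poly (F n) \<and> y n = F n S" by metis
  then have "\<forall>n. word_poly (F n)" "y = (\<lambda>n. F n S)" by auto
  with y(2) show ?thesis by blast
qed

text \<open>The image of \<open>a\<close> is pinned down by its distances to all word polynomials
  instead of by a chosen approximating sequence; density makes such an element unique, and the
  algebraic laws then follow by limits.\<close>

definition endo :: "(nat \<Rightarrow> 'a) \<Rightarrow> 'a \<Rightarrow> 'a" where
  "endo T a = (SOME b. \<forall>f. word_poly f \<longrightarrow> norm (b - f T) \<le> norm (a - f S))"

lemma endo_norm_le:
  assumes T: "cuntz_family T" and "word_poly f"
  shows "norm (endo T a - f T) \<le> norm (a - f S)"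
proof -
  obtain F where F: "\<And>n::nat. word_poly (F n)" "(\<lambda>n. F n S) \<longlonglongrightarrow> a" using word_poly_seq by blast
  have le: "norm (F m T - F n T) \<le> norm (F m S - F n S)" for m n
    using word_poly_norm_le[OF wspan_diff[OF F(1) F(1)] T] .
  have "Cauchy (\<lambda>n. F n T)"
    unfolding Cauchy_def dist_norm
  proof (intro allI impI)
    fix e :: real assume "e > 0"
    then obtain M where "\<forall>m\<ge>M. \<forall>n\<ge>M. norm (F m S - F n S) < e"
      using LIMSEQ_imp_Cauchy[OF F(2)] unfolding Cauchy_def dist_norm by blast
    then have "\<forall>m\<ge>M. \<forall>n\<ge>M. norm (F m T - F n T) < e" using le le_less_trans by blast
    then show "\<exists>M. \<forall>m\<ge>M. \<forall>n\<ge>M. norm (F m T - F n T) < e" ..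
  qed
  then obtain b where b: "(\<lambda>n. F n T) \<longlonglongrightarrow> b"
    using Cauchy_convergent convergent_def by blast
  have "norm (b - g T) \<le> norm (a - g S)" if g: "word_poly g" for g
  proof (rule LIMSEQ_le)
    show "(\<lambda>n. norm (F n T - g T)) \<longlonglongrightarrow> norm (b - g T)" by (intro tendsto_intros b)
    show "(\<lambda>n. norm (F n S - g S)) \<longlonglongrightarrow> norm (a - g S)" by (intro tendsto_intros F)
    show "\<exists>N. \<forall>n\<ge>N. norm (F n T - g T) \<le> norm (F n S - g S)"
      using word_poly_norm_le[OF wspan_diff[OF F(1) g] T] by blast
  qed
  then have "\<exists>b. \<forall>f. word_poly f \<longrightarrow> norm (b - f T) \<le> norm (a - f S)" by blast
  from someI_ex[OF this] show ?thesis using assms unfolding endo_def by blast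
qed

lemma endo_LIMSEQ:
  assumes T: "cuntz_family T" and F: "\<And>n::nat. word_poly (F n)" "(\<lambda>n. F n S) \<longlonglongrightarrow> a"
  shows "(\<lambda>n. F n T) \<longlonglongrightarrow> endo T a"
proof -
  have "(\<lambda>n. norm (F n S - a)) \<longlonglongrightarrow> 0"
    using F(2) by (simp add: LIM_zero_iff tendsto_norm_zero)
  then have "(\<lambda>n. F n T - endo T a) \<longlonglongrightarrow> 0"
    by (rule Lim_null_comparison[rotated])
      (use endo_norm_le[OF T F(1)] in \<open>simp add: norm_minus_commute\<close>)
  then show ?thesis by (simp add: LIM_zero_iff)
qed

lemma endo_unique:
  assumes T: "cuntz_family T" and "\<And>f. word_poly f \<Longrightarrow> norm (b - f T) \<le> norm (a - f S)"
  shows "endo T a = b"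
proof -
  obtain F where F: "\<And>n::nat. word_poly (F n)" "(\<lambda>n. F n S) \<longlonglongrightarrow> a" using word_poly_seq by blast
  have "(\<lambda>n. norm (F n S - a)) \<longlonglongrightarrow> 0"
    using F(2) by (simp add: LIM_zero_iff tendsto_norm_zero)
  then have "(\<lambda>n. F n T - b) \<longlonglongrightarrow> 0"
    by (rule Lim_null_comparison[rotated])
      (use assms(2)[OF F(1)] in \<open>simp add: norm_minus_commute\<close>)
  then have "(\<lambda>n. F n T) \<longlonglongrightarrow> b" by (simp add: LIM_zero_iff)
  with endo_LIMSEQ[OF T F] show ?thesis by (rule LIMSEQ_unique)
qed

lemma endo_self: "endo S a = a"
  by (rule endo_unique[OF family]) simp

lemma endo_star:
  assumes T: "cuntz_family T" shows "endo T (star a) = star (endo T a)"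
proof -
  obtain F where F: "\<And>n::nat. word_poly (F n)" "(\<lambda>n. F n S) \<longlonglongrightarrow> a" using word_poly_seq by blast
  have "(\<lambda>n. star (F n T)) \<longlonglongrightarrow> endo T (star a)"
    by (rule endo_LIMSEQ[OF T]) (intro word_poly_star F tendsto_star)+
  moreover have "(\<lambda>n. star (F n T)) \<longlonglongrightarrow> star (endo T a)"
    by (intro tendsto_star endo_LIMSEQ[OF T] F)
  ultimately show ?thesis by (rule LIMSEQ_unique)
qed

lemma endo_mult:
  assumes T: "cuntz_family T" shows "endo T (a * b) = endo T a * endo T b"
proof -
  obtain F where F: "\<And>n::nat. word_poly (F n)" "(\<lambda>n. F n S) \<longlonglongrightarrow> a" using word_poly_seq by blast
  obtain G where G: "\<And>n::nat. word_poly (G n)" "(\<lambda>n. G n S) \<longlonglongrightarrow> b" using word_poly_seq by blast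
  have "(\<lambda>n. F n T * G n T) \<longlonglongrightarrow> endo T (a * b)"
    by (rule endo_LIMSEQ[OF T]) (intro word_poly_mult F G tendsto_mult)+
  moreover have "(\<lambda>n. F n T * G n T) \<longlonglongrightarrow> endo T a * endo T b"
    by (intro tendsto_mult endo_LIMSEQ[OF T] F G)
  ultimately show ?thesis by (rule LIMSEQ_unique)
qed

lemma endo_projection: "cuntz_family T \<Longrightarrow> projection_elem p \<Longrightarrow> projection_elem (endo T p)"
  unfolding projection_elem_def by (metis endo_star endo_mult)

text \<open>The error of replacing \<open>a\<close> by a word polynomial \<open>f\<close> is at most
  \<open>norm (a - f S)\<close> for every \<open>t\<close>, so the convergence is uniform; word
  polynomials themselves vary continuously.\<close>

lemma endo_continuous_on:
  assumes T: "\<And>t. t \<in> I \<Longrightarrow> cuntz_family (T t)"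
    and cont: "\<And>i. i \<in> {1, 2} \<Longrightarrow> continuous_on I (\<lambda>t. T t i)"
  shows "continuous_on I (\<lambda>t. endo (T t) a)"
proof -
  obtain F where F: "\<And>n::nat. word_poly (F n)" "(\<lambda>n. F n S) \<longlonglongrightarrow> a" using word_poly_seq by blast
  show ?thesis
  proof (rule uniform_limit_theorem)
    show "\<forall>\<^sub>F n in sequentially. continuous_on I (\<lambda>t. F n (T t))"
      using continuous_on_wspan[OF F(1) subset_refl T cont] by simp
    show "uniform_limit I (\<lambda>n t. F n (T t)) (\<lambda>t. endo (T t) a) sequentially"
    proof (rule uniform_limitI)
      fix e :: real assume "e > 0"
      then have "\<forall>\<^sub>F n in sequentially. dist (F n S) a < e" using F(2) by (rule tendstoD[rotated])
      then show "\<forall>\<^sub>F n in sequentially. \<forall>t\<in>I. dist (F n (T t)) (endo (T t) a) < e"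
      proof eventually_elim
        case (elim n)
        then show ?case
          using endo_norm_le[OF T F(1), of _ a n] by (auto simp: dist_norm norm_minus_commute intro: le_less_trans)
      qed
    qed
  qed simp
qed

end

subsection \<open>Murray--von Neumann equivalence\<close>

text \<open>Expanding \<open>star (v * p - v) * (v * p - v)\<close> gives 0, so \<open>v\<close> is
  a partial isometry with support \<open>p\<close>; the other claims follow algebraically.\<close>

lemma mvn_equiv_partial_isometry:
  assumes "projection_elem p" "star v * v = p" "v * star v = (q :: 'a::cstar_algebra)"
  shows "v * p = v" "q * v = v" "projection_elem q"
proof -
  have p: "p * p = p" "star p = p" using assms(1) by (auto simp: projection_elem_def)
  have "star (v * p - v) * (v * p - v) = p * (star v * v) * p - p * (star v * v) - (star v * v) * p + star v * v"
    by (simp add: star_diff star_mult p algebra_simps)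
  also have "\<dots> = 0" unfolding assms(2) by (simp add: p)
  finally have "norm (v * p - v) = 0" using cstar_identity[of "v * p - v"] by simp
  then show vp: "v * p = v" by simp
  then show "q * v = v" using assms by (metis mult.assoc)
  then have "q * q = q" using assms(3) by (metis mult.assoc)
  moreover have "star q = q" using assms(3) by (metis star_mult star_star)
  ultimately show "projection_elem q" by (simp add: projection_elem_def)
qed

lemma mvn_equiv_refl: "projection_elem p \<Longrightarrow> p \<sim> p"
  unfolding mvn_equiv_def projection_elem_def by metis

lemma mvn_equiv_sym: "p \<sim> q \<Longrightarrow> q \<sim> p"
  unfolding mvn_equiv_def by (metis star_star)

lemma mvn_equiv_trans:
  assumes "projection_elem p" "p \<sim> q" "q \<sim> r" shows "p \<sim> r"
proof -
  obtain v where v: "star v * v = p" "v * star v = q" using assms by (auto simp: mvn_equiv_def)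
  obtain w where w: "star w * w = q" "w * star w = r" using assms by (auto simp: mvn_equiv_def)
  note V = mvn_equiv_partial_isometry[OF assms(1) v]
  note W = mvn_equiv_partial_isometry[OF V(3) w]
  have "star (w * v) * (w * v) = star v * (star w * w) * v"
    by (simp only: star_mult mult.assoc)
  then have 1: "star (w * v) * (w * v) = p" unfolding w(1) by (simp add: mult.assoc V(2) v(1))
  have "w * v * star (w * v) = w * (v * star v) * star w"
    by (simp only: star_mult mult.assoc)
  then have 2: "w * v * star (w * v) = r" unfolding v(2) by (simp add: W(1) w(2))
  from 1 2 show ?thesis unfolding mvn_equiv_def by blast
qed

text \<open>The sum of the two partial isometries works: orthogonality of the supports and of the
  ranges makes all mixed products vanish.\<close>

lemma mvn_equiv_add:
  assumes p: "projection_elem p1" "projection_elem p2" and equiv: "p1 \<sim> q1" "p2 \<sim> q2"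
    and orth: "p1 * p2 = 0" "q1 * q2 = 0"
  shows "p1 + p2 \<sim> q1 + q2"
proof -
  obtain v where v: "star v * v = p1" "v * star v = q1" using equiv by (auto simp: mvn_equiv_def)
  obtain w where w: "star w * w = p2" "w * star w = q2" using equiv by (auto simp: mvn_equiv_def)
  note V = mvn_equiv_partial_isometry[OF p(1) v] and W = mvn_equiv_partial_isometry[OF p(2) w]
  have "star v * w = star (q1 * v) * (q2 * w)" by (simp add: V W)
  also have "\<dots> = star v * (q1 * q2) * w"
    using V(3) by (simp add: star_mult mult.assoc projection_elem_def)
  finally have vw: "star v * w = 0" by (simp add: orth)
  then have wv: "star w * v = 0" by (metis star_mult star_star star_zero)
  have "v * star w = (v * p1) * star (w * p2)" by (simp add: V W)
  also have "\<dots> = v * (p1 * p2) * star w"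
    using p(2) by (simp add: star_mult mult.assoc projection_elem_def)
  finally have vw': "v * star w = 0" by (simp add: orth)
  then have wv': "w * star v = 0" by (metis star_mult star_star star_zero)
  have "star (v + w) * (v + w) = p1 + p2" "(v + w) * star (v + w) = q1 + q2"
    by (simp_all add: star_add distrib_left distrib_right v w vw wv vw' wv')
  then show ?thesis unfolding mvn_equiv_def by blast
qed

lemma projection_conj_isometry:
  assumes "isometry_elem s" "projection_elem p"
  shows "projection_elem (s * p * star s)" "p \<sim> s * p * star s"
proof -
  have s: "star s * s = 1" and p: "p * p = p" "star p = p"
    using assms by (auto simp: isometry_elem_def projection_elem_def)
  have "star (s * p) * (s * p) = p * (star s * s) * p" by (simp only: star_mult p mult.assoc)
  then have 1: "star (s * p) * (s * p) = p" by (simp add: s p)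
  have "s * p * star (s * p) = s * (p * p) * star s" by (simp only: star_mult p(2) mult.assoc)
  then have 2: "s * p * star (s * p) = s * p * star s" by (simp only: p)
  show "p \<sim> s * p * star s" using 1 2 unfolding mvn_equiv_def by blast
  show "projection_elem (s * p * star s)" by (rule mvn_equiv_partial_isometry(3)[OF assms(2) 1 2])
qed

subsection \<open>The canonical shift\<close>

text \<open>Cuntz's canonical endomorphism; applied to a projection it is the sum of two orthogonal
  copies of it.\<close>

definition cuntz_shift :: "(nat \<Rightarrow> 'a::cstar_algebra) \<Rightarrow> 'a \<Rightarrow> 'a" where
  "cuntz_shift S x = S 1 * x * star (S 1) + S 2 * x * star (S 2)"

lemma cuntz_family_simps:
  assumes "cuntz_family S"
  shows "star (S 1) * S 1 = 1" "star (S 2) * S 2 = 1" "star (S 1) * S 2 = 0" "star (S 2) * S 1 = 0"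
    "star (S 1) * (S 1 * x) = x" "star (S 2) * (S 2 * x) = x"
    "star (S 1) * (S 2 * x) = 0" "star (S 2) * (S 1 * x) = 0"
    "S 1 * star (S 1) + S 2 * star (S 2) = 1"
proof -
  show *: "star (S 1) * S 1 = 1" "star (S 2) * S 2 = 1" "star (S 1) * S 2 = 0" "star (S 2) * S 1 = 0"
    using cuntz_family_inner[OF assms, of 1 1] cuntz_family_inner[OF assms, of 2 2]
      cuntz_family_inner[OF assms, of 1 2] cuntz_family_inner[OF assms, of 2 1] by simp_all
  show "star (S 1) * (S 1 * x) = x" "star (S 2) * (S 2 * x) = x"
    "star (S 1) * (S 2 * x) = 0" "star (S 2) * (S 1 * x) = 0"
    by (simp_all add: * flip: mult.assoc)
  show "S 1 * star (S 1) + S 2 * star (S 2) = 1" using assms by (simp add: cuntz_family_def)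
qed

lemma cuntz_shift_add: "cuntz_shift S (x + y) = cuntz_shift S x + cuntz_shift S y"
  by (simp add: cuntz_shift_def distrib_left distrib_right)

lemma cuntz_shift_scaleC: "cuntz_shift S (c *\<^sub>C x) = c *\<^sub>C cuntz_shift S x"
  by (simp add: cuntz_shift_def scaleC_mult_left scaleC_mult_right scaleC_add_right)

lemma cuntz_shift_diff: "cuntz_shift S (x - y) = cuntz_shift S x - cuntz_shift S y"
  by (simp add: cuntz_shift_def left_diff_distrib right_diff_distrib)

lemma cuntz_shift_zero [simp]: "cuntz_shift S 0 = 0"
  by (simp add: cuntz_shift_def)

lemma cuntz_shift_star: "cuntz_shift S (star x) = star (cuntz_shift S x)"
  by (simp add: cuntz_shift_def star_add star_mult star_star mult.assoc)

lemma cuntz_shift_mult: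
  "cuntz_family S \<Longrightarrow> cuntz_shift S (x * y) = cuntz_shift S x * cuntz_shift S y"
  by (simp add: cuntz_shift_def distrib_left distrib_right mult.assoc cuntz_family_simps)

lemma cuntz_shift_one: "cuntz_family S \<Longrightarrow> cuntz_shift S 1 = 1"
  by (simp add: cuntz_shift_def cuntz_family_simps)

lemma cuntz_shift_power: "cuntz_family S \<Longrightarrow> cuntz_shift S (x ^ n) = cuntz_shift S x ^ n"
  by (induction n) (simp_all add: cuntz_shift_mult cuntz_shift_one)

lemma star_generator_shift:
  "cuntz_family S \<Longrightarrow> i \<in> {1, 2} \<Longrightarrow> star (S i) * cuntz_shift S x = x * star (S i)"
  by (auto simp: cuntz_shift_def distrib_left mult.assoc cuntz_family_simps)

text \<open>The triangle inequality gives only the factor 2; since the shift is multiplicative and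
  respects \<open>star\<close>, high powers remove it.\<close>

lemma norm_cuntz_shift_le:
  assumes S: "cuntz_family S" shows "norm (cuntz_shift S x) \<le> norm x"
proof -
  have le2: "norm (cuntz_shift S y) \<le> 2 * norm y" for y
  proof -
    have "norm (S i * y * star (S i)) \<le> norm y" if "isometry_elem (S i)" for i
    proof -
      have "norm (S i * y * star (S i)) \<le> norm (S i) * norm y * norm (star (S i))"
        by (intro order_trans[OF norm_mult_ineq] mult_right_mono norm_mult_ineq) auto
      then show ?thesis using norm_isometry[OF that] by simp
    qed
    then have "norm (S 1 * y * star (S 1)) \<le> norm y" "norm (S 2 * y * star (S 2)) \<le> norm y"
      using S by (auto simp: cuntz_family_def)
    then show ?thesis
      unfolding cuntz_shift_def by (intro order_trans[OF norm_triangle_ineq]) simp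
  qed
  have "(norm (cuntz_shift S x))\<^sup>2 \<le> (norm x)\<^sup>2"
  proof (rule le_if_powers_le_linear[where C = 2])
    fix k
    have "((norm (cuntz_shift S x))\<^sup>2) ^ 2 ^ k = norm (cuntz_shift S ((star x * x) ^ 2 ^ k))"
      by (simp only: cuntz_shift_power[OF S] cuntz_shift_mult[OF S] cuntz_shift_star norm_gram_power)
    also have "\<dots> \<le> 2 * ((norm x)\<^sup>2) ^ 2 ^ k"
      using le2[of "(star x * x) ^ 2 ^ k"] by (simp only: norm_gram_power)
    also have "\<dots> \<le> 2 * 2 ^ k * ((norm x)\<^sup>2) ^ 2 ^ k"
      by (intro mult_right_mono) auto
    finally show "((norm (cuntz_shift S x))\<^sup>2) ^ 2 ^ k \<le> 2 * 2 ^ k * ((norm x)\<^sup>2) ^ 2 ^ k" .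
  qed auto
  then show ?thesis by (rule power2_le_imp_le) simp
qed

lemma cuntz_family_unitary_mult:
  assumes "unitary_elem u" "cuntz_family T" shows "cuntz_family (\<lambda>i. u * T i)"
proof -
  have u: "star u * u = 1" "u * star u = 1" using assms by (auto simp: unitary_elem_def)
  have "star (u * T i) * (u * T i) = star (T i) * T i" for i
  proof -
    have "star (u * T i) * (u * T i) = star (T i) * (star u * u) * T i"
      by (simp only: star_mult mult.assoc)
    then show ?thesis by (simp add: u)
  qed
  moreover have "u * T 1 * star (u * T 1) + u * T 2 * star (u * T 2) = 1"
  proof -
    have "u * T 1 * star (u * T 1) + u * T 2 * star (u * T 2) = u * (T 1 * star (T 1) + T 2 * star (T 2)) * star u"
      by (simp only: star_mult mult.assoc distrib_left distrib_right)
    then show ?thesis using assms(2) by (simp add: u cuntz_family_def)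
  qed
  ultimately show ?thesis using assms(2) by (simp add: cuntz_family_def isometry_elem_def)
qed

text \<open>The tensor flip \<open>u\<close>, for which \<open>u S\<^sub>i\<close> is the shift of \<open>S\<^sub>i\<close>.\<close>

definition cuntz_flip :: "(nat \<Rightarrow> 'a::cstar_algebra) \<Rightarrow> 'a" where
  "cuntz_flip S = cuntz_shift S (S 1) * star (S 1) + cuntz_shift S (S 2) * star (S 2)"

lemma cuntz_flip_generator:
  "cuntz_family S \<Longrightarrow> i \<in> {1, 2} \<Longrightarrow> cuntz_flip S * S i = cuntz_shift S (S i)"
  by (auto simp: cuntz_flip_def distrib_right mult.assoc cuntz_family_simps)

lemma star_cuntz_flip: "star (cuntz_flip S) = cuntz_flip S"
  by (simp add: cuntz_flip_def cuntz_shift_def star_add star_mult star_star distrib_left distrib_right mult.assoc add_ac)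

lemma cuntz_flip_square:
  assumes S: "cuntz_family S" shows "cuntz_flip S * cuntz_flip S = 1"
proof -
  have inner: "star (cuntz_shift S x) * cuntz_shift S y = cuntz_shift S (star x * y)" for x y
    by (simp add: cuntz_shift_mult[OF S] cuntz_shift_star)
  have inner': "star (cuntz_shift S x) * (cuntz_shift S y * z) = cuntz_shift S (star x * y) * z" for x y z
    by (simp add: inner flip: mult.assoc)
  have "star (cuntz_flip S) * cuntz_flip S = 1"
    unfolding cuntz_flip_def star_add star_mult star_star
    by (simp add: distrib_left distrib_right mult.assoc inner' cuntz_family_simps[OF S] cuntz_shift_one[OF S])
  then show ?thesis by (simp add: star_cuntz_flip)
qed

text \<open>With \<open>u = cuntz_flip S\<close>, a self-adjoint unitary, this is
  \<open>(1 + u) / 2\<close> plus \<open>cis (pi * t)\<close> times \<open>(1 - u) / 2\<close>: the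
  value on the eigenspace of -1 is rotated from 1 to -1, so the path runs from 1 at
  \<open>t = 0\<close> to \<open>u\<close> at \<open>t = 1\<close>.\<close>

definition flip_path :: "(nat \<Rightarrow> 'a::cstar_algebra) \<Rightarrow> real \<Rightarrow> 'a" where
  "flip_path S t = ((1 + cis (pi * t)) / 2) *\<^sub>C 1 + ((1 - cis (pi * t)) / 2) *\<^sub>C cuntz_flip S"

lemma unitary_flip_path:
  assumes S: "cuntz_family S" shows "unitary_elem (flip_path S t)"
proof -
  let ?u = "cuntz_flip S"
  define c where "c = cis (pi * t)"
  have c: "cnj c * c = 1" "c * cnj c = 1" by (simp_all add: c_def cis_cnj cis_mult)
  define a b where "a = (1 + c) / 2" and "b = (1 - c) / 2"
  have 1: "cnj a * a + cnj b * b = 1" and 2: "cnj a * b + cnj b * a = 0"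
    using c by (simp_all add: a_def b_def field_simps)
  have star: "star (flip_path S t) = cnj a *\<^sub>C 1 + cnj b *\<^sub>C ?u"
    by (simp add: flip_path_def a_def b_def c_def star_add star_scaleC star_cuntz_flip)
  have path: "flip_path S t = a *\<^sub>C 1 + b *\<^sub>C ?u"
    by (simp add: flip_path_def a_def b_def c_def)
  have "(cnj a *\<^sub>C 1 + cnj b *\<^sub>C ?u) * (a *\<^sub>C 1 + b *\<^sub>C ?u) =
      (cnj a * a + cnj b * b) *\<^sub>C 1 + (cnj a * b + cnj b * a) *\<^sub>C ?u"
    by (simp add: distrib_left distrib_right scaleC_mult_left scaleC_mult_right scaleC_scaleC
        cuntz_flip_square[OF S] scaleC_add_left scaleC_add_right add_ac mult.commute)
  moreover have "(a *\<^sub>C 1 + b *\<^sub>C ?u) * (cnj a *\<^sub>C 1 + cnj b *\<^sub>C ?u) =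
      (cnj a * a + cnj b * b) *\<^sub>C 1 + (cnj a * b + cnj b * a) *\<^sub>C ?u"
    by (simp add: distrib_left distrib_right scaleC_mult_left scaleC_mult_right scaleC_scaleC
        cuntz_flip_square[OF S] scaleC_add_left scaleC_add_right add_ac mult.commute)
  ultimately show ?thesis unfolding unitary_elem_def star unfolding path 1 2 by simp
qed

context gauge_expectation
begin

text \<open>The shift meets the estimate characterising \<open>endo\<close>: it maps
  \<open>f S\<close> to \<open>f T\<close> by multiplicativity and is contractive.\<close>

lemma endo_shift:
  assumes T: "cuntz_family T" and "\<And>i. i \<in> {1, 2} \<Longrightarrow> T i = cuntz_shift S (S i)"
  shows "endo T a = cuntz_shift S a"
proof (rule endo_unique[OF T])
  fix f :: "(nat \<Rightarrow> 'a) \<Rightarrow> 'a" assume "word_poly f"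
  then have "f T = cuntz_shift S (f S)"
  proof (induction rule: wspan.induct)
    case (monomial \<mu> \<nu> c)
    have "word_elem T \<mu> = cuntz_shift S (word_elem S \<mu>)" if "\<mu> \<in> lists {1, 2}" for \<mu>
      using that
    proof (induction \<mu>)
      case (Cons i \<mu>)
      then show ?case using assms(2)[of i] by (simp add: cuntz_shift_mult[OF family])
    qed (simp add: cuntz_shift_one[OF family])
    then show ?case
      using monomial by (simp add: cuntz_shift_scaleC cuntz_shift_mult[OF family] cuntz_shift_star)
  next
    case (cong f g)
    then show ?case using T family by simp
  qed (simp_all add: cuntz_shift_add)
  then have "cuntz_shift S a - f T = cuntz_shift S (a - f S)"
    by (simp add: cuntz_shift_diff)
  then show "norm (cuntz_shift S a - f T) \<le> norm (a - f S)"
    using norm_cuntz_shift_le[OF family] by simp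
qed

text \<open>The shift is homotopic to the identity through endomorphisms, which in K-theory
  gives \<open>[p] = [p] + [p]\<close>.\<close>

lemma projection_equiv_shift:
  assumes p: "projection_elem p" shows "p \<sim> cuntz_shift S p"
proof -
  define T where "T t = (\<lambda>i. flip_path S t * S i)" for t
  have T: "cuntz_family (T t)" for t
    unfolding T_def by (intro cuntz_family_unitary_mult unitary_flip_path family)
  define q where "q t = endo (T t) p" for t
  have q: "projection_elem (q t)" for t
    unfolding q_def by (rule endo_projection[OF T p])
  have cont: "continuous_on {0..1} q"
    unfolding q_def
  proof (rule endo_continuous_on)
    show "continuous_on {0..1} (\<lambda>t. T t i)" for i
      unfolding T_def flip_path_def
      by (intro continuous_intros continuous_on_scaleC) auto
  qed (rule T)
  \<comment> \<open>Close projections are equivalent, so the equivalence classes along the path are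
    open in the connected unit interval.\<close>
  have "q 0 \<sim> q 1"
  proof (rule connected_equivalence_relation[of "{0..1::real}" 0 1 "\<lambda>s t. q s \<sim> q t"])
    fix t :: real assume t: "t \<in> {0..1}"
    show "\<exists>U. openin (top_of_set {0..1}) U \<and> t \<in> U \<and> (\<forall>s\<in>U. q t \<sim> q s)"
    proof (intro exI[of _ "{0..1} \<inter> q -` ball (q t) (1/2)"] conjI ballI)
      show "openin (top_of_set {0..1}) ({0..1} \<inter> q -` ball (q t) (1/2))"
        using cont by (rule continuous_openin_preimage_gen) simp
      show "t \<in> {0..1} \<inter> q -` ball (q t) (1/2)" using t by simp
      fix s assume "s \<in> {0..1} \<inter> q -` ball (q t) (1/2)"
      then show "q t \<sim> q s"
        by (intro mvn_equiv_if_close q) (simp add: dist_norm less_imp_le)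
    qed
  qed (auto intro: mvn_equiv_sym mvn_equiv_trans[OF q])
  moreover have "q 0 = p"
    using endo_self by (simp add: q_def T_def flip_path_def)
  moreover have "q 1 = cuntz_shift S p"
    unfolding q_def by (rule endo_shift[OF T]) (simp add: T_def flip_path_def cuntz_flip_generator[OF family])
  ultimately show ?thesis by simp
qed

end

subsection \<open>Vectors and columns of words\<close>

text \<open>The words of length \<open>m\<close> are an orthonormal basis of a Hilbert space inside
  the algebra, where \<open>star x * y\<close> is a scalar. Balanced monomials of length at most
  \<open>m\<close> act on it from the left as matrices.\<close>

definition word_vec :: "(nat \<Rightarrow> 'a::cstar_algebra) \<Rightarrow> nat \<Rightarrow> (nat list \<Rightarrow> complex) \<Rightarrow> 'a" where
  "word_vec S m \<xi> = (\<Sum>\<mu>\<in>words_of m. \<xi> \<mu> *\<^sub>C word_elem S \<mu>)"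

definition word_space :: "(nat \<Rightarrow> 'a::cstar_algebra) \<Rightarrow> nat \<Rightarrow> 'a set" where
  "word_space S m = range (word_vec S m)"

lemma word_vec_inner:
  assumes S: "cuntz_family S"
  shows "star (word_vec S m \<xi>) * word_vec S m \<eta> = (\<Sum>\<mu>\<in>words_of m. cnj (\<xi> \<mu>) * \<eta> \<mu>) *\<^sub>C 1"
proof -
  have "star (word_vec S m \<xi>) * word_vec S m \<eta> =
      (\<Sum>\<mu>\<in>words_of m. \<Sum>\<nu>\<in>words_of m. (cnj (\<xi> \<mu>) * \<eta> \<nu>) *\<^sub>C (star (word_elem S \<mu>) * word_elem S \<nu>))"
    unfolding word_vec_def star_sum sum_product
    by (simp add: star_scaleC scaleC_mult_left scaleC_mult_right scaleC_scaleC) (simp add: mult.commute)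
  also have "\<dots> = (\<Sum>\<mu>\<in>words_of m. \<Sum>\<nu>\<in>words_of m. if \<nu> = \<mu> then (cnj (\<xi> \<mu>) * \<eta> \<mu>) *\<^sub>C 1 else 0)"
    by (intro sum.cong refl) (auto simp: word_inner[OF S, of _ m])
  also have "\<dots> = (\<Sum>\<mu>\<in>words_of m. (cnj (\<xi> \<mu>) * \<eta> \<mu>) *\<^sub>C 1)"
    by (intro sum.cong refl) simp
  finally show ?thesis by (simp add: cvector_space.scale_sum_left)
qed

lemma word_space_inner:
  assumes "cuntz_family S" "x \<in> word_space S m" "y \<in> word_space S m"
  obtains c where "star x * y = c *\<^sub>C 1"
  using assms word_vec_inner[OF assms(1)] unfolding word_space_def by blast

lemma word_space_inner_self:
  assumes S: "cuntz_family S" and "x \<in> word_space S m"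
  shows "star x * x = (norm x)\<^sup>2 *\<^sub>R 1"
proof -
  obtain \<xi> where x: "x = word_vec S m \<xi>" using assms by (auto simp: word_space_def)
  define r where "r = (\<Sum>\<mu>\<in>words_of m. (cmod (\<xi> \<mu>))\<^sup>2)"
  have "(\<Sum>\<mu>\<in>words_of m. cnj (\<xi> \<mu>) * \<xi> \<mu>) = of_real r"
    unfolding r_def of_real_sum by (intro sum.cong refl) (metis complex_norm_square mult.commute of_real_power)
  then have xx: "star x * x = r *\<^sub>R 1"
    unfolding x word_vec_inner[OF S] by (simp add: scaleC_of_real)
  moreover have "r \<ge> 0" unfolding r_def by (intro sum_nonneg) simp
  ultimately have "(norm x)\<^sup>2 = r" using cstar_identity[of x] by simp
  with xx show ?thesis by simp
qed

lemma word_space_zero: "0 \<in> word_space S m"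
  unfolding word_space_def by (rule range_eqI[of _ _ "\<lambda>_. 0"]) (simp add: word_vec_def)

lemma word_space_add: "x \<in> word_space S m \<Longrightarrow> y \<in> word_space S m \<Longrightarrow> x + y \<in> word_space S m"
  unfolding word_space_def
proof (elim imageE)
  fix \<xi> \<eta> assume "x = word_vec S m \<xi>" "y = word_vec S m \<eta>"
  then show "x + y \<in> range (word_vec S m)"
    by (intro range_eqI[of _ _ "\<lambda>\<mu>. \<xi> \<mu> + \<eta> \<mu>"]) (simp add: word_vec_def scaleC_add_left sum.distrib)
qed

lemma word_space_scaleC: "x \<in> word_space S m \<Longrightarrow> c *\<^sub>C x \<in> word_space S m"
  unfolding word_space_def
proof (elim imageE)
  fix \<xi> assume "x = word_vec S m \<xi>"
  then show "c *\<^sub>C x \<in> range (word_vec S m)"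
    by (intro range_eqI[of _ _ "\<lambda>\<mu>. c * \<xi> \<mu>"])
      (simp add: word_vec_def cvector_space.scale_sum_right scaleC_scaleC)
qed

lemma word_space_sum: "(\<And>i. i \<in> I \<Longrightarrow> f i \<in> word_space S m) \<Longrightarrow> (\<Sum>i\<in>I. f i) \<in> word_space S m"
  by (induction I rule: infinite_finite_induct) (auto intro: word_space_zero word_space_add)

lemma word_elem_in_word_space: "\<mu> \<in> words_of m \<Longrightarrow> word_elem S \<mu> \<in> word_space S m"
  unfolding word_space_def
proof (rule range_eqI)
  assume \<mu>: "\<mu> \<in> words_of m"
  have "word_vec S m (\<lambda>\<nu>. if \<nu> = \<mu> then 1 else 0) = (\<Sum>\<nu>\<in>words_of m. if \<nu> = \<mu> then word_elem S \<mu> else 0)"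
    unfolding word_vec_def by (intro sum.cong) auto
  then show "word_elem S \<mu> = word_vec S m (\<lambda>\<nu>. if \<nu> = \<mu> then 1 else 0)" using \<mu> by simp
qed

lemma balanced_maps_word_space:
  assumes S: "cuntz_family S" and w: "\<mu> \<in> words_of i" "\<nu> \<in> words_of i" "i \<le> m" and x: "x \<in> word_space S m"
  shows "word_elem S \<mu> * star (word_elem S \<nu>) * x \<in> word_space S m"
proof -
  obtain \<xi> where x: "x = word_vec S m \<xi>" using x by (auto simp: word_space_def)
  have "word_elem S \<mu> * star (word_elem S \<nu>) * word_elem S \<rho> \<in> word_space S m" if \<rho>: "\<rho> \<in> words_of m" for \<rho>
  proof -
    have "star (word_elem S \<nu>) * word_elem S \<rho> =
        (if take (length \<nu>) \<rho> = \<nu> then word_elem S (drop (length \<nu>) \<rho>) else 0)"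
      using w \<rho> by (intro word_star_mult[OF S]) (auto simp: words_of_def)
    then have "word_elem S \<mu> * star (word_elem S \<nu>) * word_elem S \<rho> =
        (if take (length \<nu>) \<rho> = \<nu> then word_elem S (\<mu> @ drop (length \<nu>) \<rho>) else 0)"
      by (simp add: mult.assoc word_elem_append)
    moreover have "\<mu> @ drop (length \<nu>) \<rho> \<in> words_of m"
      using w \<rho> by (auto simp: words_of_def lists_eq_set dest: in_set_dropD)
    ultimately show ?thesis by (simp add: word_elem_in_word_space word_space_zero)
  qed
  then show ?thesis
    unfolding x word_vec_def sum_distrib_left scaleC_mult_right
    by (intro word_space_sum word_space_scaleC)
qed

text \<open>The word projections cut \<open>g ^ 2 ^ k\<close> into \<open>2 ^ m\<close> pieces of
  norm at most \<open>K ^ 2 ^ k\<close> each; their number disappears along high powers. Thus the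
  operator norm on the finite-dimensional word space dominates the norm in the algebra.\<close>

lemma norm_le_on_word_space:
  assumes S: "cuntz_family S" and g: "star g = g" and "K \<ge> 0"
    and inv: "\<And>x. x \<in> word_space S m \<Longrightarrow> g * x \<in> word_space S m"
    and le: "\<And>x. x \<in> word_space S m \<Longrightarrow> norm (g * x) \<le> K * norm x"
  shows "norm g \<le> K"
proof (rule le_if_powers_le_linear[where C = "2 ^ m"])
  fix k
  have pow: "g ^ n * x \<in> word_space S m \<and> norm (g ^ n * x) \<le> K ^ n * norm x"
    if "x \<in> word_space S m" for n x
  proof (induction n)
    case (Suc n)
    have "norm (g * (g ^ n * x)) \<le> K * (K ^ n * norm x)"
      using le[of "g ^ n * x"] Suc \<open>K \<ge> 0\<close> by (meson mult_left_mono order_trans)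
    then show ?case using inv[of "g ^ n * x"] Suc by (simp add: mult.assoc)
  qed (use that in simp)
  have "norm (g ^ 2 ^ k * word_elem S \<mu> * star (word_elem S \<mu>)) \<le> K ^ 2 ^ k" if "\<mu> \<in> words_of m" for \<mu>
  proof -
    have n: "norm (word_elem S \<mu>) = 1"
      using that isometry_word[OF S, of \<mu>] by (auto simp: words_of_def intro: norm_isometry)
    have "norm (g ^ 2 ^ k * word_elem S \<mu> * star (word_elem S \<mu>)) \<le> norm (g ^ 2 ^ k * word_elem S \<mu>)"
      using norm_mult_ineq[of "g ^ 2 ^ k * word_elem S \<mu>" "star (word_elem S \<mu>)"] n by simp
    also have "\<dots> \<le> K ^ 2 ^ k" using pow[OF word_elem_in_word_space[OF that], of "2 ^ k"] n by simp
    finally show ?thesis .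
  qed
  then have "norm (\<Sum>\<mu>\<in>words_of m. g ^ 2 ^ k * word_elem S \<mu> * star (word_elem S \<mu>)) \<le> 2 ^ m * K ^ 2 ^ k"
    using sum_norm_bound[of "words_of m" "\<lambda>\<mu>. g ^ 2 ^ k * word_elem S \<mu> * star (word_elem S \<mu>)"]
    by (simp add: card_words_of)
  moreover have "(\<Sum>\<mu>\<in>words_of m. g ^ 2 ^ k * word_elem S \<mu> * star (word_elem S \<mu>)) = g ^ 2 ^ k"
    using sum_word_projections[OF S, of m] by (simp add: mult.assoc flip: sum_distrib_left)
  ultimately have "norm (g ^ 2 ^ k) \<le> 2 ^ m * K ^ 2 ^ k" by simp
  also have "\<dots> \<le> 2 ^ m * 2 ^ k * K ^ 2 ^ k"
    using \<open>K \<ge> 0\<close> by (intro mult_right_mono) auto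
  finally show "norm g ^ 2 ^ k \<le> 2 ^ m * 2 ^ k * K ^ 2 ^ k"
    by (simp only: selfadjoint_norm_power_2power[OF g])
qed (use \<open>K \<ge> 0\<close> in auto)

text \<open>Isometries with pairwise orthogonal ranges in any number, so that a column of arbitrary
  finite length is stored in a single element.\<close>

definition ladder :: "(nat \<Rightarrow> 'a::cstar_algebra) \<Rightarrow> nat \<Rightarrow> 'a" where
  "ladder S j = S 2 ^ j * S 1"

lemma ladder_inner:
  assumes S: "cuntz_family S"
  shows "star (ladder S i) * ladder S j = (if i = j then 1 else 0)"
proof (induction i arbitrary: j)
  case 0
  then show ?case
    by (cases j) (simp_all add: ladder_def mult.assoc cuntz_family_simps[OF S])
next
  case (Suc i)
  have *: "ladder S (Suc i) = S 2 * ladder S i" for i by (simp add: ladder_def mult.assoc)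
  show ?case
  proof (cases j)
    case 0
    then show ?thesis unfolding * star_mult
      by (simp add: ladder_def mult.assoc cuntz_family_simps[OF S])
  next
    case j: (Suc j')
    show ?thesis unfolding j * star_mult using Suc[of j']
      by (simp add: mult.assoc cuntz_family_simps[OF S])
  qed
qed

lemma column_inner:
  assumes S: "cuntz_family S" and "finite I"
  shows "star (\<Sum>i\<in>I. ladder S i * a i) * (\<Sum>i\<in>I. ladder S i * b i) = (\<Sum>i\<in>I. star (a i) * b i)"
proof -
  have "star (\<Sum>i\<in>I. ladder S i * a i) * (\<Sum>i\<in>I. ladder S i * b i) =
      (\<Sum>i\<in>I. \<Sum>j\<in>I. star (a i) * (star (ladder S i) * ladder S j) * b j)"
    unfolding star_sum sum_product star_mult by (simp only: mult.assoc)
  also have "\<dots> = (\<Sum>i\<in>I. \<Sum>j\<in>I. if j = i then star (a i) * b i else 0)"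
    by (intro sum.cong refl) (simp add: ladder_inner[OF S])
  finally show ?thesis using \<open>finite I\<close> by simp
qed

text \<open>A sum of projections is bounded below by the part of it close to a fixed projection.
  Placing the summands in a column avoids any order theory.\<close>

lemma norm_sum_projections_ge:
  fixes S :: "nat \<Rightarrow> 'a::cstar_algebra" and P :: 'a
  assumes S: "cuntz_family S" and P: "projection_elem P" "P \<noteq> 0" and p: "\<And>j. projection_elem (p j)"
    and close: "\<And>j. j < L \<Longrightarrow> norm (p j - P) \<le> 1/2" and "L \<le> M"
  shows "real L / 4 \<le> norm (\<Sum>j<M. p j)"
proof (cases "L = 0")
  case False
  have P2: "star P = P" "P * P = P" and p2: "\<And>j. star (p j) = p j" "\<And>j. p j * p j = p j"
    using P p by (auto simp: projection_elem_def)
  have nP: "norm P = 1"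
    using cstar_identity[of P] P P2 by (simp add: power2_eq_square)
  define x y X Q where "x = (\<Sum>j<L. ladder S j * p j)" and "y = (\<Sum>j<L. ladder S j * P)"
    and "X = (\<Sum>j<M. ladder S j * p j)" and "Q = (\<Sum>j<L. ladder S j * star (ladder S j))"
  have eq: "(\<Sum>j<L. P * p j) = real L *\<^sub>R P + (\<Sum>j<L. P * (p j - P))"
    by (simp add: right_diff_distrib sum_subtractf P2 sum_constant_scaleR del: sum_constant)
  have "norm (\<Sum>j<L. P * (p j - P)) \<le> real L * (1/2)"
  proof -
    have "norm (P * (p j - P)) \<le> 1/2" if "j < L" for j
      using norm_mult_ineq[of P "p j - P"] close[OF that] nP by simp
    then show ?thesis using sum_norm_bound[of "{..<L}" "\<lambda>j. P * (p j - P)" "1/2"] by simp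
  qed
  moreover have "norm (real L *\<^sub>R P) = real L" using nP by simp
  ultimately have "norm (\<Sum>j<L. P * p j) \<ge> real L / 2"
    unfolding eq using norm_diff_ineq[of "real L *\<^sub>R P" "\<Sum>j<L. P * (p j - P)"] by linarith
  moreover have yx: "star y * x = (\<Sum>j<L. P * p j)"
    unfolding y_def x_def by (subst column_inner[OF S]) (simp_all add: P2)
  moreover have "(norm y)\<^sup>2 = real L"
  proof -
    have "star y * y = real L *\<^sub>R P"
      unfolding y_def by (subst column_inner[OF S]) (simp_all add: P2 sum_constant_scaleR del: sum_constant)
    then show ?thesis using cstar_identity[of y] nP by simp
  qed
  \<comment> \<open>Cauchy--Schwarz for columns: the constant column \<open>y\<close> has norm
    \<open>sqrt L\<close>, so \<open>L / 2 \<le> sqrt L * norm x\<close>, which is the origin of the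
    quarter in the claim.\<close>
  ultimately have "real L / 2 \<le> norm y * norm x" and y2: "(norm y)\<^sup>2 = real L"
    using norm_mult_ineq[of "star y" x] by auto
  then have "(real L / 2)\<^sup>2 \<le> (norm y * norm x)\<^sup>2" by (intro power_mono) auto
  then have "(real L)\<^sup>2 / 4 \<le> real L * (norm x)\<^sup>2" by (simp add: power_mult_distrib y2 power_divide)
  then have x: "real L / 4 \<le> (norm x)\<^sup>2" using False by (simp add: power2_eq_square field_simps)
  \<comment> \<open>\<open>Q\<close> cuts the long column \<open>X\<close> down to its first
    \<open>L\<close> entries, and a projection does not increase norms.\<close>
  have "x = Q * X"
  proof -
    have "ladder S i * star (ladder S i) * X = ladder S i * p i" if "i < L" for i
    proof -
      have "ladder S i * star (ladder S i) * X = (\<Sum>j<M. ladder S i * (star (ladder S i) * ladder S j) * p j)"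
        unfolding X_def sum_distrib_left by (simp only: mult.assoc)
      also have "\<dots> = (\<Sum>j<M. if j = i then ladder S i * p i else 0)"
        by (intro sum.cong refl) (simp add: ladder_inner[OF S])
      finally show ?thesis using that \<open>L \<le> M\<close> by simp
    qed
    then show ?thesis by (simp add: Q_def x_def sum_distrib_right)
  qed
  moreover have "norm Q \<le> 1"
  proof (rule projection_norm_le_one)
    have sQ: "star Q = Q" by (simp add: Q_def star_sum star_mult star_star)
    have "Q * Q = star Q * Q" by (simp add: sQ)
    also have "\<dots> = Q"
      unfolding Q_def by (subst column_inner[OF S]) (simp_all add: star_star)
    finally show "projection_elem Q" using sQ by (simp add: projection_elem_def)
  qed
  ultimately have "norm x \<le> norm X"
    using norm_mult_ineq[of Q X] mult_right_mono[of "norm Q" 1 "norm X"] by simp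
  then have "(norm x)\<^sup>2 \<le> (norm X)\<^sup>2" by (intro power_mono) auto
  also have "(norm X)\<^sup>2 = norm (\<Sum>j<M. p j)"
  proof -
    have "star X * X = (\<Sum>j<M. p j)"
      unfolding X_def by (subst column_inner[OF S]) (simp_all add: p2)
    then show ?thesis using cstar_identity[of X] by simp
  qed
  finally show ?thesis using x by simp
qed simp

subsection \<open>Compression onto the gauge-invariant part\<close>

lemma funpow_shift_mult:
  "cuntz_family S \<Longrightarrow> (cuntz_shift S ^^ n) (x * y) = (cuntz_shift S ^^ n) x * (cuntz_shift S ^^ n) y"
  by (induction n) (simp_all add: cuntz_shift_mult)

lemma funpow_shift_star: "(cuntz_shift S ^^ n) (star x) = star ((cuntz_shift S ^^ n) x)"
  by (induction n) (simp_all add: cuntz_shift_star)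

lemma funpow_shift_one: "cuntz_family S \<Longrightarrow> (cuntz_shift S ^^ n) 1 = 1"
  by (induction n) (simp_all add: cuntz_shift_one)

lemma funpow_shift_zero: "(cuntz_shift S ^^ n) 0 = 0"
  by (induction n) simp_all

text \<open>Each letter moved across uses up one application of the shift.\<close>

lemma star_word_funpow_shift:
  assumes S: "cuntz_family S"
  shows "\<nu> \<in> words_of k \<Longrightarrow> star (word_elem S \<nu>) * (cuntz_shift S ^^ (k + n)) x = (cuntz_shift S ^^ n) x * star (word_elem S \<nu>)"
proof (induction k arbitrary: \<nu>)
  case (Suc k)
  then obtain i \<nu>' where \<nu>: "\<nu> = i # \<nu>'" "\<nu>' \<in> words_of k" "i \<in> {1, 2}" by (auto simp: words_of_Suc)
  have "star (word_elem S \<nu>) * (cuntz_shift S ^^ (Suc k + n)) x =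
      star (word_elem S \<nu>') * (star (S i) * cuntz_shift S ((cuntz_shift S ^^ (k + n)) x))"
    by (simp add: \<nu>(1) star_mult mult.assoc)
  also have "\<dots> = star (word_elem S \<nu>') * (cuntz_shift S ^^ (k + n)) x * star (S i)"
    unfolding star_generator_shift[OF S \<nu>(3)] by (simp only: mult.assoc)
  also have "\<dots> = (cuntz_shift S ^^ n) x * star (word_elem S \<nu>)"
    unfolding Suc.IH[OF \<nu>(2)] by (simp add: \<nu>(1) star_mult mult.assoc)
  finally show ?case .
qed (simp add: words_of_0)

text \<open>The seed \<open>S 1 ^ m * S 2\<close> is orthogonal to its own shifts by 1 up to
  \<open>m\<close>, because the closing 2 of one copy meets a 1 of the other. Shifting it
  \<open>m\<close> times lets words of length at most \<open>m\<close> pass through.\<close>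

definition compressor :: "(nat \<Rightarrow> 'a::cstar_algebra) \<Rightarrow> nat \<Rightarrow> 'a" where
  "compressor S m = (cuntz_shift S ^^ m) (S 1 ^ m * S 2)"

text \<open>After \<open>star (S 1) ^ r\<close> has moved through the shifted seed, the other
  \<open>m - r\<close> ones cancel and the factor \<open>star (S 2) * (S 1 ^ r * S 2)\<close>
  remains, which vanishes for \<open>r \<ge> 1\<close>.\<close>

lemma compressor_seed_orthogonal:
  assumes S: "cuntz_family S" and r: "1 \<le> r" "r \<le> m"
  shows "star (S 1 ^ m * S 2) * (cuntz_shift S ^^ r) (S 1 ^ m * S 2) = 0"
proof -
  obtain d where m: "m = d + r" using r by (metis le_Suc_ex add.commute)
  have cancel: "star (S 1) ^ k * (S 1 ^ k * x) = x" for k x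
    by (induction k arbitrary: x) (simp_all add: power_commutes mult.assoc cuntz_family_simps[OF S],
      metis cuntz_family_simps(5)[OF S] mult.assoc power_commutes)
  let ?v = "S 1 ^ m * S 2"
  have rep: "replicate r 1 \<in> words_of r" by (auto simp: words_of_def)
  have 1: "star (S 1) ^ r * (cuntz_shift S ^^ r) ?v = ?v * star (S 1) ^ r"
    using star_word_funpow_shift[OF S rep, of 0 ?v] by (simp add: word_elem_replicate star_power)
  have "star ?v * (cuntz_shift S ^^ r) ?v = star (S 2) * star (S 1) ^ d * (star (S 1) ^ r * (cuntz_shift S ^^ r) ?v)"
  proof -
    have "star ?v = star (S 2) * star (S 1) ^ m" by (simp only: star_mult star_power)
    then have sv: "star ?v = star (S 2) * (star (S 1) ^ d * star (S 1) ^ r)" by (simp only: m power_add)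
    show ?thesis unfolding sv by (simp only: mult.assoc)
  qed
  also have "\<dots> = star (S 2) * (star (S 1) ^ d * (S 1 ^ d * (S 1 ^ r * S 2))) * star (S 1) ^ r"
    unfolding 1 by (simp only: m power_add mult.assoc)
  also have "\<dots> = star (S 2) * (S 1 ^ r * S 2) * star (S 1) ^ r" by (simp only: cancel)
  also have "star (S 2) * (S 1 ^ r * S 2) = 0"
    using r by (cases r) (simp_all add: mult.assoc cuntz_family_simps[OF S])
  finally show ?thesis by simp
qed

lemma isometry_compressor:
  assumes S: "cuntz_family S" shows "isometry_elem (compressor S m)"
proof -
  have "word_elem S (replicate m 1 @ [2]) = S 1 ^ m * S 2"
    by (simp add: word_elem_append word_elem_replicate)
  moreover have "replicate m 1 @ [2] \<in> lists {1, 2::nat}" by auto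
  ultimately have "isometry_elem (S 1 ^ m * S 2)" using isometry_word[OF S] by metis
  then show ?thesis
    unfolding isometry_elem_def compressor_def
    by (simp add: funpow_shift_one[OF S] flip: funpow_shift_mult[OF S] funpow_shift_star)
qed

text \<open>Pulling both words out leaves the product of two shifted seeds: 1 if the shifts agree
  and 0 otherwise. So the compression reproduces the gauge expectation exactly on words of length at
  most \<open>m\<close>.\<close>

lemma compressor_word:
  assumes S: "cuntz_family S" and w: "\<mu> \<in> words_of i" "\<nu> \<in> words_of j" "i \<le> m" "j \<le> m"
  shows "star (compressor S m) * (word_elem S \<mu> * star (word_elem S \<nu>)) * compressor S m =
    (if i = j then word_elem S \<mu> * star (word_elem S \<nu>) else 0)"
proof -
  let ?v = "S 1 ^ m * S 2" and ?\<Lambda> = "\<lambda>n. cuntz_shift S ^^ n"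
  have pass: "star (word_elem S \<nu>) * compressor S m = ?\<Lambda> (m - k) ?v * star (word_elem S \<nu>)"
    if "\<nu> \<in> words_of k" "k \<le> m" for \<nu> k
    using star_word_funpow_shift[OF S that(1), of "m - k" ?v] that(2) by (simp add: compressor_def)
  have pass': "star (compressor S m) * word_elem S \<mu> = word_elem S \<mu> * star (?\<Lambda> (m - i) ?v)"
    using arg_cong[OF pass[OF w(1,3)], of star] by (simp add: star_mult star_star)
  have "star (compressor S m) * (word_elem S \<mu> * star (word_elem S \<nu>)) * compressor S m =
      (star (compressor S m) * word_elem S \<mu>) * (star (word_elem S \<nu>) * compressor S m)"
    by (simp only: mult.assoc)
  also have "\<dots> = word_elem S \<mu> * (star (?\<Lambda> (m - i) ?v) * ?\<Lambda> (m - j) ?v) * star (word_elem S \<nu>)"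
    unfolding pass' pass[OF w(2,4)] by (simp only: mult.assoc)
  also have "star (?\<Lambda> (m - i) ?v) * ?\<Lambda> (m - j) ?v = (if i = j then 1 else 0)"
  proof -
    have orth: "star (?\<Lambda> (m - i) ?v) * ?\<Lambda> (m - j) ?v = 0" if "i < j" "j \<le> m" for i j
    proof -
      have "m - i = (m - j) + (j - i)" using that by simp
      then have "star (?\<Lambda> (m - i) ?v) * ?\<Lambda> (m - j) ?v = ?\<Lambda> (m - j) (star (?\<Lambda> (j - i) ?v) * ?v)"
        by (simp only: funpow_add o_apply funpow_shift_mult[OF S] funpow_shift_star)
      also have "star (?\<Lambda> (j - i) ?v) * ?v = star (star ?v * ?\<Lambda> (j - i) ?v)"
        by (simp add: star_mult star_star mult.assoc)
      also have "\<dots> = 0"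
        using that by (subst compressor_seed_orthogonal[OF S]) auto
      finally show ?thesis by (simp add: funpow_shift_zero)
    qed
    consider "i = j" | "i < j" | "j < i" by linarith
    then show ?thesis
    proof cases
      case 1
      have "replicate m 1 @ [2] \<in> lists {1, 2::nat}" by auto
      from isometry_word[OF S this] have "star ?v * ?v = 1"
        by (simp add: isometry_elem_def word_elem_append word_elem_replicate)
      then show ?thesis
        using 1 by (simp add: funpow_shift_one[OF S] flip: funpow_shift_mult[OF S] funpow_shift_star)
    next
      case 2
      then show ?thesis using orth[of i j] w by simp
    next
      case 3
      have "star (?\<Lambda> (m - i) ?v) * ?\<Lambda> (m - j) ?v = star (star (?\<Lambda> (m - j) ?v) * ?\<Lambda> (m - i) ?v)"
        by (simp only: star_mult star_star)
      then show ?thesis using 3 orth[of j i] w by simp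
    qed
  qed
  finally show ?thesis by simp
qed

section \<open>Gauge automorphisms and their finite averages\<close>

lemma gauge_family:
  assumes S: "cuntz_family S" and z: "cmod z = 1" shows "cuntz_family (\<lambda>i. z *\<^sub>C S i)"
proof -
  have "cnj z * z = 1" "z * cnj z = 1"
    using complex_norm_square[of z] z by (simp_all add: mult.commute)
  then have "unitary_elem (z *\<^sub>C (1::'a))"
    by (simp add: unitary_elem_def star_scaleC scaleC_mult_left scaleC_scaleC)
  from cuntz_family_unitary_mult[OF this S] show ?thesis by (simp add: scaleC_mult_left)
qed

lemma word_elem_gauge: "word_elem (\<lambda>i. z *\<^sub>C S i) \<mu> = z ^ length \<mu> *\<^sub>C word_elem S \<mu>"
  by (induction \<mu>) (simp_all add: scaleC_mult_left scaleC_mult_right scaleC_scaleC mult.commute)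

lemma sum_unity_root_balanced:
  assumes "i \<le> m" "k \<le> m" "m < M"
  shows "(\<Sum>j<M. unity_root M j ^ i * cnj (unity_root M j) ^ k) = (if i = k then of_nat M else 0)"
proof -
  have one: "unity_root M j ^ i * cnj (unity_root M j) ^ i = 1" for i j
    using cnj_unity_root[of M j] by (metis mult.commute power_mult_distrib power_one)
  consider "i = k" | d where "i = k + d" "d > 0" | d where "k = i + d" "d > 0"
    by (metis less_imp_add_positive linorder_neqE_nat)
  then show ?thesis
  proof cases
    case 1
    then show ?thesis by (simp add: one)
  next
    case 2
    have "unity_root M j ^ i * cnj (unity_root M j) ^ k = unity_root M j ^ d" for j
      using one[of j k] by (simp add: 2 power_add mult_ac)
    then show ?thesis using sum_unity_root[of d M] 2 assms by simp
  next
    case 3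
    have "unity_root M j ^ i * cnj (unity_root M j) ^ k = cnj (unity_root M j) ^ d" for j
      using one[of j i] by (simp add: 3 power_add mult_ac)
    then show ?thesis using sum_cnj_unity_root[of d M] 3 assms by simp
  qed
qed

text \<open>Both sides keep the balanced words and delete the others; \<open>m < M\<close> excludes
  nonzero length differences divisible by \<open>M\<close>. The compression is what yields an
  isometry later, the average is what can be bounded from below.\<close>

lemma compression_eq_gauge_average:
  assumes S: "cuntz_family S" and f: "wspan (bounded_words m) f" and "m < M"
  shows "star (compressor S m) * f S * compressor S m =
    (1 / real M) *\<^sub>R (\<Sum>j<M. f (\<lambda>i. unity_root M j *\<^sub>C S i))"
  using f
proof (induction rule: wspan.induct)
  case (monomial \<mu> \<nu> c)
  then have w: "\<mu> \<in> words_of (length \<mu>)" "\<nu> \<in> words_of (length \<nu>)" "length \<mu> \<le> m" "length \<nu> \<le> m"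
    by (auto simp: bounded_words_def words_of_def)
  let ?w = "word_elem S \<mu> * star (word_elem S \<nu>)"
  have "(\<Sum>j<M. c *\<^sub>C (word_elem (\<lambda>i. unity_root M j *\<^sub>C S i) \<mu> * star (word_elem (\<lambda>i. unity_root M j *\<^sub>C S i) \<nu>)))
      = c *\<^sub>C ((\<Sum>j<M. unity_root M j ^ length \<mu> * cnj (unity_root M j) ^ length \<nu>) *\<^sub>C ?w)"
    unfolding cvector_space.scale_sum_left cvector_space.scale_sum_right
    by (intro sum.cong refl)
      (simp add: word_elem_gauge star_scaleC scaleC_mult_left scaleC_mult_right scaleC_scaleC)
  also have "\<dots> = c *\<^sub>C ((if length \<mu> = length \<nu> then of_nat M else 0) *\<^sub>C ?w)"
    unfolding sum_unity_root_balanced[OF w(3,4) assms(3)] ..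
  also have "\<dots> = (if length \<mu> = length \<nu> then real M *\<^sub>R c *\<^sub>C ?w else 0)"
  proof -
    have "c *\<^sub>C (of_nat M *\<^sub>C ?w) = of_nat M *\<^sub>C (c *\<^sub>C ?w)"
      by (rule cvector_space.scale_left_commute)
    also have "\<dots> = real M *\<^sub>R c *\<^sub>C ?w" by (metis of_real_of_nat_eq scaleC_of_real)
    finally show ?thesis by simp
  qed
  finally have R: "(1 / real M) *\<^sub>R (\<Sum>j<M. c *\<^sub>C (word_elem (\<lambda>i. unity_root M j *\<^sub>C S i) \<mu> *
      star (word_elem (\<lambda>i. unity_root M j *\<^sub>C S i) \<nu>))) = (if length \<mu> = length \<nu> then c *\<^sub>C ?w else 0)"
    using assms(3) by simp
  have "star (compressor S m) * (c *\<^sub>C ?w) * compressor S m = c *\<^sub>C (star (compressor S m) * ?w * compressor S m)"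
    by (simp only: scaleC_mult_left scaleC_mult_right)
  then show ?case unfolding R compressor_word[OF S w] by simp
next
  case (add f g)
  then show ?case by (simp add: distrib_left distrib_right sum.distrib scaleR_add_right)
next
  case (cong f g)
  have "g S = f S" "\<And>j. g (\<lambda>i. unity_root M j *\<^sub>C S i) = f (\<lambda>i. unity_root M j *\<^sub>C S i)"
    by (rule cong.hyps(2)[OF S], rule cong.hyps(2)[OF gauge_family[OF S]]) simp
  then show ?case using cong.IH by simp
qed simp

lemma compression_maps_word_space:
  assumes S: "cuntz_family S" and f: "wspan (bounded_words m) f" and x: "x \<in> word_space S m"
  shows "star (compressor S m) * f S * compressor S m * x \<in> word_space S m"
  using f
proof (induction rule: wspan.induct)
  case (monomial \<mu> \<nu> c)
  then have w: "\<mu> \<in> words_of (length \<mu>)" "\<nu> \<in> words_of (length \<nu>)" "length \<mu> \<le> m" "length \<nu> \<le> m"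
    by (auto simp: bounded_words_def words_of_def)
  have "star (compressor S m) * (c *\<^sub>C (word_elem S \<mu> * star (word_elem S \<nu>))) * compressor S m * x =
      c *\<^sub>C (star (compressor S m) * (word_elem S \<mu> * star (word_elem S \<nu>)) * compressor S m * x)"
    by (simp only: scaleC_mult_left scaleC_mult_right)
  moreover have "star (compressor S m) * (word_elem S \<mu> * star (word_elem S \<nu>)) * compressor S m * x \<in> word_space S m"
    unfolding compressor_word[OF S w]
    using balanced_maps_word_space[OF S w(1) _ w(3) x, of \<nu>] w(2) word_space_zero by auto
  ultimately show ?case by (simp add: word_space_scaleC)
next
  case (add f g)
  then show ?case by (simp add: distrib_left distrib_right word_space_add)
next
  case (cong f g)
  then show ?case using S by simp
qed (simp add: word_space_zero)

subsection \<open>Pure infiniteness\<close>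

lemma compression_selfadjoint: "star a = a \<Longrightarrow> star (star v * a * v) = star v * a * (v :: 'a::cstar_algebra)"
  by (simp add: star_mult star_star mult.assoc)

lemma norm_compression_le:
  assumes "norm (v :: 'a::cstar_algebra) \<le> 1" shows "norm (star v * a * v) \<le> norm a"
proof -
  have "norm (star v * a * v) \<le> norm (star v) * norm a * norm v"
    by (intro order_trans[OF norm_mult_ineq] mult_right_mono norm_mult_ineq) auto
  also have "\<dots> \<le> 1 * norm a * 1"
    using assms by (intro mult_mono) auto
  finally show ?thesis by simp
qed

lemma compression_diff: "star v * (a - b) * v = star v * a * v - star v * b * (v :: 'a::cstar_algebra)"
  by (simp add: left_diff_distrib right_diff_distrib)

context gauge_expectation
begin

text \<open>A quantitative form of faithfulness of the gauge expectation. \<open>K\<close> depends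
  only on how fast the gauge orbit leaves a neighbourhood of \<open>P\<close>: of
  \<open>K * L\<close> equally spaced angles the first \<open>L\<close> lie below
  \<open>2 * pi / K\<close>, where the images stay within 1/2 of \<open>P\<close>. Hence the average
  has norm at least \<open>1 / (4 * K)\<close>, uniformly in \<open>L > 0\<close>.\<close>

lemma gauge_average_norm_ge:
  fixes P :: 'a
  assumes P: "projection_elem P" "P \<noteq> 0"
  obtains K :: nat where "K > 0"
    "\<And>L. real L / 4 \<le> norm (\<Sum>j<K * L. endo (\<lambda>i. unity_root (K * L) j *\<^sub>C S i) P)"
proof -
  define q where "q t = endo (\<lambda>i. cis t *\<^sub>C S i) P" for t
  have q: "projection_elem (q t)" for t
    unfolding q_def by (intro endo_projection gauge_family family P) simp
  have "continuous_on UNIV q"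
    unfolding q_def
  proof (rule endo_continuous_on)
    show "cuntz_family (\<lambda>i. cis t *\<^sub>C S i)" for t by (intro gauge_family family) simp
    show "continuous_on UNIV (\<lambda>t. cis t *\<^sub>C S i)" for i
      by (intro continuous_on_scaleC continuous_intros)
  qed
  then have "isCont q 0" by (simp add: continuous_on_eq_continuous_at)
  then have "\<exists>\<delta>>0. \<forall>t. dist t 0 < \<delta> \<longrightarrow> dist (q t) (q 0) < 1/2"
    unfolding continuous_at_eps_delta by (metis half_gt_zero_iff zero_less_one)
  moreover have "q 0 = P" by (simp add: q_def endo_self)
  ultimately obtain \<delta> where \<delta>: "\<delta> > 0" "\<And>t. \<bar>t\<bar> < \<delta> \<Longrightarrow> norm (q t - P) \<le> 1/2"
    by (auto simp: dist_norm less_imp_le)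
  obtain K :: nat where K: "2 * pi / \<delta> < real K" using reals_Archimedean2 by blast
  moreover have "0 < 2 * pi / \<delta>" using \<delta> by simp
  ultimately have "real K > 0" by linarith
  then have "K > 0" by simp
  have K': "2 * pi / real K < \<delta>" using K \<delta>(1) \<open>real K > 0\<close> by (simp add: field_simps)
  have "real L / 4 \<le> norm (\<Sum>j<K * L. endo (\<lambda>i. unity_root (K * L) j *\<^sub>C S i) P)" for L
    unfolding unity_root_def q_def[symmetric]
  proof (rule norm_sum_projections_ge[OF family P q])
    show "L \<le> K * L" using \<open>K > 0\<close> by simp
    fix j assume j: "j < L"
    have "2 * pi * real j / real (K * L) = (2 * pi / real K) * (real j / real L)" by simp
    also have "\<dots> \<le> (2 * pi / real K) * 1" using j by (intro mult_left_mono) auto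
    finally have "2 * pi * real j / real (K * L) < \<delta>" using K' by linarith
    then show "norm (q (2 * pi * real j / real (K * L)) - P) \<le> 1/2"
      by (intro \<delta>(2)) simp
  qed
  with \<open>K > 0\<close> show ?thesis by (rule that)
qed

text \<open>A word polynomial near \<open>P\<close> is compressed to a matrix on the word space; a
  unit vector \<open>x\<close> on which the matrix is large gives an isometry
  \<open>v = W * x\<close> for which \<open>star v * P * v\<close> is nearly a positive scalar.
  Rescaling \<open>P * v\<close> and correcting it by an inverse square root gives an exact
  isometry.\<close>

lemma purely_infinite:
  fixes P :: 'a
  assumes P: "projection_elem P" "P \<noteq> 0"
  shows "\<exists>V. isometry_elem V \<and> P * V = V"
proof -
  have PP: "star P = P" "P * P = P" using P by (auto simp: projection_elem_def)
  obtain K :: nat where K: "K > 0"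
    "\<And>L. real L / 4 \<le> norm (\<Sum>j<K * L. endo (\<lambda>i. unity_root (K * L) j *\<^sub>C S i) P)"
    using gauge_average_norm_ge[OF P] by blast
  define c where "c = 1 / (4 * real K)"
  have c: "c > 0" "c \<le> 1/4" using K(1) by (auto simp: c_def field_simps)
  \<comment> \<open>The scalar \<open>l\<close> below is bounded from below only through the square
    of a norm of order \<open>c\<close>, and the error must be small against that.\<close>
  define \<epsilon> where "\<epsilon> = c\<^sup>2 / 100"
  have \<epsilon>: "\<epsilon> > 0" using c by (simp add: \<epsilon>_def)
  have \<epsilon>c: "\<epsilon> \<le> c / 400"
    using mult_right_mono[OF c(2), of c] c by (simp add: \<epsilon>_def power2_eq_square)
  obtain F where F: "\<And>n::nat. word_poly (F n)" "(\<lambda>n. F n S) \<longlonglongrightarrow> P" using word_poly_seq by blast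
  obtain f0 where f0: "word_poly f0" "norm (P - f0 S) < \<epsilon>"
    using LIMSEQ_D[OF F(2) \<epsilon>] F(1) by (metis norm_minus_commute order_refl)
  define f where "f T = (1/2) *\<^sub>C (f0 T + star (f0 T))" for T
  have wf: "word_poly f" unfolding f_def
    by (intro wspan_scaleC wspan.add word_poly_star f0)
  have sf: "star (f S) = f S" by (simp add: f_def star_scaleC star_add star_star add.commute)
  have fP: "norm (P - f S) \<le> \<epsilon>"
  proof -
    have "P = (1/2) *\<^sub>C (P + P)" using scaleC_add_left[of "1/2" "1/2" P] by (simp add: scaleC_add_right)
    then have "P - f S = (1/2) *\<^sub>C ((P - f0 S) + star (P - f0 S))"
      by (metis (no_types, opaque_lifting) PP(1) add_diff_add cvector_space.scale_right_diff_distrib f_def star_diff)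
    then have "norm (P - f S) = 1/2 * norm ((P - f0 S) + star (P - f0 S))" by (simp add: norm_scaleC)
    also have "\<dots> \<le> 1/2 * (norm (P - f0 S) + norm (star (P - f0 S)))"
      by (intro mult_left_mono norm_triangle_ineq) simp
    finally show ?thesis using f0(2) by simp
  qed
  obtain m where m: "wspan (bounded_words m) f" using word_poly_bounded[OF wf] by blast
  \<comment> \<open>A multiple of \<open>K\<close>, for the lower bound on the average, and larger
    than \<open>m\<close>, for its exactness.\<close>
  define M where "M = K * Suc m"
  have "m < Suc m * 1" by simp
  also have "\<dots> \<le> Suc m * K" using K(1) by (intro mult_le_mono) auto
  finally have "m < M" by (simp only: M_def mult.commute)
  define W where "W = compressor S m"
  have nW: "norm W = 1" unfolding W_def by (intro norm_isometry isometry_compressor family)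
  have WW: "star W * W = 1" using isometry_compressor[OF family] by (simp add: W_def isometry_elem_def)
  define g where "g = star W * f S * W"
  have g_avg: "g = (1 / real M) *\<^sub>R (\<Sum>j<M. f (\<lambda>i. unity_root M j *\<^sub>C S i))"
    unfolding g_def W_def by (rule compression_eq_gauge_average[OF family m \<open>m < M\<close>])
  have sg: "star g = g" unfolding g_def by (rule compression_selfadjoint[OF sf])
  have g_inv: "g * x \<in> word_space S m" if "x \<in> word_space S m" for x
    unfolding g_def W_def by (rule compression_maps_word_space[OF family m that])
  have norm_g: "c - \<epsilon> \<le> norm g"
  proof -
    define A where "A = (\<Sum>j<M. endo (\<lambda>i. unity_root M j *\<^sub>C S i) P)"
    have A: "real (Suc m) / 4 \<le> norm A" using K(2)[of "Suc m"] by (simp add: A_def M_def)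
    have "norm (A - (\<Sum>j<M. f (\<lambda>i. unity_root M j *\<^sub>C S i))) \<le> real M * \<epsilon>"
      unfolding A_def sum_subtractf[symmetric]
    proof (rule order_trans[OF sum_norm_bound])
      fix j
      show "norm (endo (\<lambda>i. unity_root M j *\<^sub>C S i) P - f (\<lambda>i. unity_root M j *\<^sub>C S i)) \<le> \<epsilon>"
        using endo_norm_le[OF gauge_family[OF family] wf] fP by (rule order_trans) simp
    qed simp
    moreover have "(1 / real M) *\<^sub>R A - g = (1 / real M) *\<^sub>R (A - (\<Sum>j<M. f (\<lambda>i. unity_root M j *\<^sub>C S i)))"
      unfolding g_avg by (simp only: scaleR_diff_right)
    ultimately have "norm ((1 / real M) *\<^sub>R A - g) \<le> \<epsilon>"
      using \<open>m < M\<close> by (simp add: divide_le_eq mult.commute)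
    moreover have "c \<le> norm ((1 / real M) *\<^sub>R A)"
    proof -
      have "c = (real (Suc m) / 4) / real M" using K(1) unfolding c_def M_def of_nat_mult by (simp add: field_simps del: of_nat_Suc)
      also have "\<dots> \<le> norm A / real M" using A by (intro divide_right_mono) auto
      finally show ?thesis by simp
    qed
    ultimately show ?thesis using norm_triangle_ineq2[of "(1 / real M) *\<^sub>R A" g] by linarith
  qed
  obtain x where x: "x \<in> word_space S m" "norm x = 1" "norm (g * x) \<ge> c - 2 * \<epsilon>"
  proof -
    have "c - 2 * \<epsilon> \<ge> 0" using \<epsilon>c c by linarith
    have "\<not> norm g \<le> c - 2 * \<epsilon>" using norm_g \<epsilon> by linarith
    then obtain y where y: "y \<in> word_space S m" "norm (g * y) > (c - 2 * \<epsilon>) * norm y"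
      using norm_le_on_word_space[OF family sg \<open>c - 2 * \<epsilon> \<ge> 0\<close> g_inv] by (meson not_le)
    have y0: "norm y > 0" using y(2) by auto
    define x where "x = of_real (1 / norm y) *\<^sub>C y"
    have "x \<in> word_space S m" unfolding x_def by (rule word_space_scaleC[OF y(1)])
    moreover have "norm x = 1" using y0 by (simp add: x_def norm_scaleC norm_divide)
    moreover have "norm (g * x) = norm (g * y) / norm y"
      by (simp add: x_def scaleC_mult_right norm_scaleC norm_divide)
    moreover have "c - 2 * \<epsilon> \<le> norm (g * y) / norm y"
      using y(2) y0 by (simp add: pos_le_divide_eq less_imp_le)
    ultimately show ?thesis using that by simp
  qed
  have xx: "star x * x = 1" using word_space_inner_self[OF family x(1)] x(2) by simp
  define v where "v = W * x"
  have nv: "norm v \<le> 1" using norm_mult_ineq[of W x] nW x(2) by (simp add: v_def)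
  have vv: "star v * v = 1"
  proof -
    have "star v * v = star x * (star W * W) * x" by (simp only: v_def star_mult mult.assoc)
    then show ?thesis by (simp add: WW xx)
  qed
  define Z where "Z = P * v"
  have ZZ: "star Z * Z = star v * P * v"
  proof -
    have "star Z * Z = star v * (P * P) * v" unfolding Z_def star_mult PP(1) by (simp only: mult.assoc)
    then show ?thesis by (simp add: PP)
  qed
  obtain \<zeta> where \<zeta>: "star x * (g * x) = \<zeta> *\<^sub>C 1"
    using word_space_inner[OF family x(1) g_inv[OF x(1)]] by blast
  have fv: "star v * f S * v = \<zeta> *\<^sub>C 1"
    unfolding \<zeta>[symmetric] by (simp only: v_def g_def star_mult mult.assoc)
  define l where "l = Re \<zeta>"
  have "star (\<zeta> *\<^sub>C (1::'a)) = \<zeta> *\<^sub>C 1"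
    unfolding fv[symmetric] by (rule compression_selfadjoint[OF sf])
  then have "cnj \<zeta> = \<zeta>" by (simp add: star_scaleC)
  then have l: "\<zeta> = of_real l" by (simp add: l_def complex_eq_iff)
  have fv': "star v * f S * v = l *\<^sub>R 1" unfolding fv l scaleC_of_real ..
  have ZZl: "norm (star Z * Z - l *\<^sub>R 1) \<le> \<epsilon>"
    unfolding ZZ fv'[symmetric] compression_diff[symmetric]
    using norm_compression_le[OF nv] fP by (rule order_trans)
  \<comment> \<open>The choice of \<open>x\<close> controls \<open>norm (g * x)\<close>, not the
    quadratic form \<open>star x * (g * x)\<close>; passing through \<open>Z\<close> recovers the
    latter because \<open>star Z * Z\<close> is close to \<open>l\<close>.\<close>
  have "norm Z \<ge> c - 3 * \<epsilon>"
  proof -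
    have "g * x = star W * Z - star W * (P - f S) * W * x"
      by (simp add: g_def Z_def v_def right_diff_distrib left_diff_distrib mult.assoc)
    then have "norm (g * x) \<le> norm (star W * Z) + norm (star W * (P - f S) * W * x)"
      by (metis norm_triangle_ineq4)
    also have "norm (star W * Z) \<le> norm Z" using norm_mult_ineq[of "star W" Z] nW by simp
    also have "norm (star W * (P - f S) * W * x) \<le> \<epsilon>"
    proof -
      have "norm (star W * (P - f S) * W * x) \<le> norm (star W * (P - f S) * W) * norm x"
        by (rule norm_mult_ineq)
      also have "\<dots> \<le> norm (P - f S)" using norm_compression_le[of W "P - f S"] nW x(2) by simp
      finally show ?thesis using fP by linarith
    qed
    finally show ?thesis using x(3) by linarith
  qed
  then have "(c - 3 * \<epsilon>)\<^sup>2 \<le> (norm Z)\<^sup>2" using \<epsilon>c c by (intro power_mono) auto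
  moreover have "(norm Z)\<^sup>2 \<le> \<bar>l\<bar> + \<epsilon>"
    using norm_triangle_sub[of "star Z * Z" "l *\<^sub>R 1"] ZZl cstar_identity[of Z] by simp
  \<comment> \<open>Excludes that \<open>l\<close> is substantially negative:
    \<open>1 - star Z * Z\<close> is a compression of the projection \<open>1 - P\<close>, so its
    norm is at most 1.\<close>
  moreover have "1 - l \<le> 1 + \<epsilon>"
  proof -
    have "norm (star v * (1 - P) * v) \<le> 1"
      using norm_compression_le[OF nv] projection_norm_le_one[OF projection_diff_one[OF P(1)]]
      by (rule order_trans)
    moreover have "star v * (1 - P) * v = 1 - star Z * Z" by (simp add: compression_diff vv ZZ)
    ultimately have "norm (1 - star Z * Z) \<le> 1" by simp
    moreover have "norm (1 - l *\<^sub>R (1::'a)) \<le> norm (1 - star Z * Z) + norm (star Z * Z - l *\<^sub>R 1)"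
      using norm_triangle_ineq[of "1 - star Z * Z" "star Z * Z - l *\<^sub>R 1"] by simp
    ultimately have "norm (1 - l *\<^sub>R (1::'a)) \<le> 1 + \<epsilon>" using ZZl by linarith
    moreover have "1 - l *\<^sub>R (1::'a) = (1 - l) *\<^sub>R 1" by (simp add: scaleR_diff_left)
    ultimately show ?thesis by simp
  qed
  moreover have "(c - 3 * \<epsilon>)\<^sup>2 \<ge> 90 * \<epsilon>"
  proof -
    have "(c - 3 * \<epsilon>)\<^sup>2 \<ge> (c * 0.95)\<^sup>2" using \<epsilon>c c by (intro power_mono) auto
    moreover have "90 * \<epsilon> \<le> (c * 0.95)\<^sup>2"
      by (simp add: \<epsilon>_def power_mult_distrib power2_eq_square)
    ultimately show ?thesis by linarith
  qed
  ultimately have l80: "l \<ge> 80 * \<epsilon>" using \<epsilon> by (cases "l \<ge> 0") auto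
  then have l0: "l > 0" using \<epsilon> by linarith
  define h where "h = (1 / l) *\<^sub>R (star Z * Z)"
  have "h - 1 = (1 / l) *\<^sub>R (star Z * Z - l *\<^sub>R 1)" using l0 by (simp add: h_def scaleR_diff_right)
  then have "norm (h - 1) = norm (star Z * Z - l *\<^sub>R 1) / l" using l0 by simp
  also have "\<dots> \<le> \<epsilon> / l" using ZZl l0 by (intro divide_right_mono) auto
  also have "\<dots> \<le> 1/2" using l80 l0 \<epsilon> by (simp add: field_simps)
  finally have hn: "norm (h - 1) \<le> 1/2" .
  have sh: "star h = h" by (simp add: h_def star_scaleR star_mult star_star)
  obtain k b where kb: "star b = b" "k * k = h" "b * k = 1" "k * b = 1"
    using selfadjoint_sqrt_near_one[OF sh hn] by blast
  \<comment> \<open>\<open>h\<close> is the normalised \<open>star Z * Z\<close> and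
    \<open>b\<close> its inverse root, so this is the isometric part of the polar decomposition of
    \<open>Z\<close>.\<close>
  define V where "V = (1 / sqrt l) *\<^sub>R (Z * b)"
  have "star V * V = (1 / sqrt l * (1 / sqrt l)) *\<^sub>R (b * (star Z * Z) * b)"
    by (simp add: V_def star_scaleR star_mult kb mult.assoc)
  also have "1 / sqrt l * (1 / sqrt l) = 1 / l" using l0 by simp
  also have "(1 / l) *\<^sub>R (b * (star Z * Z) * b) = b * h * b" by (simp add: h_def)
  also have "\<dots> = (b * k) * (k * b)" unfolding kb(2)[symmetric] by (simp only: mult.assoc)
  finally have "star V * V = 1" by (simp add: kb)
  moreover have "P * V = V"
    by (simp add: V_def Z_def projection_mult_left[OF P(1)] mult.assoc)
  ultimately show ?thesis unfolding isometry_elem_def by blast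
qed

subsection \<open>All nonzero projections are equivalent\<close>

lemma isometry_generators: "isometry_elem (S 1)" "isometry_elem (S 2)"
  using family by (auto simp: cuntz_family_def)

text \<open>\<open>P\<close> contains a copy \<open>Q'\<close> of \<open>Q\<close>, and
  \<open>P = R + Q'\<close>. In classes \<open>[Q'] + [Q] = [Q] + [Q] = [Q] = [Q']\<close> by the
  shift homotopy, and adding \<open>[R]\<close> gives \<open>[P] + [Q] = [P]\<close>. Conjugation by
  \<open>S 1\<close> and \<open>S 2\<close> makes the summands orthogonal.\<close>

lemma orthogonal_sum_absorb:
  fixes P Q :: 'a
  assumes P: "projection_elem P" "P \<noteq> 0" and Q: "projection_elem Q"
  shows "S 1 * P * star (S 1) + S 2 * Q * star (S 2) \<sim> P"
proof -
  note s = cuntz_family_simps[OF family]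
  have PP: "star P = P" "P * P = P" using P by (auto simp: projection_elem_def)
  obtain V where V: "isometry_elem V" "P * V = V" using purely_infinite[OF P] by blast
  define Q' where "Q' = V * Q * star V"
  have Q': "projection_elem Q'" "Q \<sim> Q'"
    unfolding Q'_def using projection_conj_isometry[OF V(1) Q] by auto
  have PQ': "P * Q' = Q'" using V(2) by (simp add: Q'_def flip: mult.assoc)
  then have Q'P: "Q' * P = Q'" using Q'(1) PP by (metis projection_elem_def star_mult)
  have Q'Q': "star Q' = Q'" "Q' * Q' = Q'" using Q'(1) by (auto simp: projection_elem_def)
  define R where "R = P - Q'"
  have R: "projection_elem R"
    by (simp add: R_def projection_elem_def star_diff PP Q'Q' PQ' Q'P algebra_simps)
  have RQ': "R * Q' = 0" by (simp add: R_def left_diff_distrib PQ' Q'Q')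
  define c where "c i x = S i * x * star (S i)" for i x
  have orth12: "c 1 x * c 2 y = 0" for x y by (simp add: c_def mult.assoc s)
  have c_proj: "projection_elem (c i x)" "x \<sim> c i x" if "projection_elem x" "i \<in> {1, 2}" for i x
    using projection_conj_isometry[OF _ that(1), of "S i"] isometry_generators that(2) by (auto simp: c_def)
  have c1_mult: "c 1 x * c 1 y = c 1 (x * y)" for x y by (simp add: c_def mult.assoc s)
  have c_add: "c i (x + y) = c i x + c i y" for i x y by (simp add: c_def distrib_left distrib_right)
  have proj: "projection_elem (c 1 x + c 2 y)" if "projection_elem x" "projection_elem y" for x y
  proof -
    have "c 2 y * c 1 x = 0" by (simp add: c_def mult.assoc s)
    moreover have "projection_elem (c 1 x)" "projection_elem (c 2 y)" using c_proj that by auto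
    ultimately show ?thesis
      by (simp add: projection_elem_def star_add distrib_left distrib_right orth12)
  qed
  have mid: "c 1 Q' + c 2 Q \<sim> c 1 Q'"
  proof (rule mvn_equiv_trans)
    have "c 1 Q' \<sim> c 1 Q"
      using c_proj Q Q' by (meson insertI1 mvn_equiv_sym mvn_equiv_trans)
    then show "c 1 Q' + c 2 Q \<sim> c 1 Q + c 2 Q"
      using c_proj Q Q' orth12 by (intro mvn_equiv_add mvn_equiv_refl) auto
    show "projection_elem (c 1 Q' + c 2 Q)" by (rule proj[OF Q'(1) Q])
    have "c 1 Q + c 2 Q \<sim> Q"
      using projection_equiv_shift[OF Q] by (simp add: c_def cuntz_shift_def mvn_equiv_sym)
    moreover have "projection_elem (c 1 Q + c 2 Q)" by (rule proj[OF Q Q])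
    moreover have "Q \<sim> c 1 Q'"
      using c_proj Q Q' by (meson insertI1 mvn_equiv_trans)
    ultimately show "c 1 Q + c 2 Q \<sim> c 1 Q'" by (meson mvn_equiv_trans)
  qed
  have "c 1 P + c 2 Q = c 1 R + (c 1 Q' + c 2 Q)" by (simp add: R_def flip: c_add add.assoc)
  also have "\<dots> \<sim> c 1 R + c 1 Q'"
  proof (rule mvn_equiv_add)
    show "projection_elem (c 1 R)" using c_proj R by auto
    show "projection_elem (c 1 Q' + c 2 Q)" by (rule proj[OF Q'(1) Q])
    show "c 1 R \<sim> c 1 R" using c_proj R by (intro mvn_equiv_refl) auto
    have "c 1 0 = 0" by (simp add: c_def)
    then show "c 1 R * (c 1 Q' + c 2 Q) = 0" "c 1 R * c 1 Q' = 0"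
      by (simp_all add: distrib_left c1_mult RQ' orth12)
  qed (rule mid)
  finally have "c 1 P + c 2 Q \<sim> c 1 P" by (simp add: R_def flip: c_add)
  moreover have "projection_elem (c 1 P + c 2 Q)" by (rule proj[OF P(1) Q])
  ultimately show ?thesis
    using c_proj[OF P(1), of 1] mvn_equiv_trans mvn_equiv_sym unfolding c_def by blast
qed

text \<open>Nonzero projections absorb each other, \<open>[p] + [q] = [p]\<close>, hence all classes coincide.\<close>

theorem nonzero_projections_equiv:
  fixes P Q :: 'a
  assumes P: "projection_elem P" "P \<noteq> 0" and Q: "projection_elem Q" "Q \<noteq> 0"
  shows "P \<sim> Q"
proof -
  note s = cuntz_family_simps[OF family]
  define c where "c i x = S i * x * star (S i)" for i x
  have c_proj: "projection_elem (c i x)" "x \<sim> c i x" if "projection_elem x" "i \<in> {1, 2}" for i x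
    using projection_conj_isometry[OF _ that(1), of "S i"] isometry_generators that(2) by (auto simp: c_def)
  have orth: "c 1 x * c 2 y = 0" "c 2 x * c 1 y = 0" for x y by (simp_all add: c_def mult.assoc s)
  have proj: "projection_elem (c 1 x + c 2 y)" if "projection_elem x" "projection_elem y" for x y
  proof -
    have "projection_elem (c 1 x)" "projection_elem (c 2 y)" using c_proj that by auto
    then show ?thesis by (simp add: projection_elem_def star_add distrib_left distrib_right orth)
  qed
  have switch: "c i x \<sim> c j x" if "projection_elem x" "i \<in> {1, 2}" "j \<in> {1, 2}" for x i j
    using c_proj that by (meson mvn_equiv_sym mvn_equiv_trans)
  have "P \<sim> c 1 P + c 2 Q"
    using orthogonal_sum_absorb[OF P Q(1)] unfolding c_def by (rule mvn_equiv_sym)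
  moreover have "c 1 P + c 2 Q \<sim> c 2 P + c 1 Q"
    using P Q by (intro mvn_equiv_add switch c_proj orth) auto
  moreover have "c 2 P + c 1 Q \<sim> Q"
    using orthogonal_sum_absorb[OF Q P(1)] unfolding c_def by (simp add: add.commute)
  ultimately show ?thesis using P Q proj by (meson mvn_equiv_trans)
qed

end

subsection \<open>The diagonal\<close>

lemma sum_words_of_append:
  "(\<Sum>\<rho>\<in>words_of (m + j). f \<rho>) = (\<Sum>\<mu>\<in>words_of m. \<Sum>\<kappa>\<in>words_of j. f (\<mu> @ \<kappa>))"
proof (induction m arbitrary: f)
  case (Suc m)
  have "(\<Sum>\<rho>\<in>words_of (Suc m + j). f \<rho>) =
      (\<Sum>\<mu>\<in>words_of (m + j). f (1 # \<mu>)) + (\<Sum>\<mu>\<in>words_of (m + j). f (2 # \<mu>))"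
    by (simp add: sum_words_of_Suc)
  also have "\<dots> = (\<Sum>\<mu>\<in>words_of m. \<Sum>\<kappa>\<in>words_of j. f (1 # \<mu> @ \<kappa>)) +
      (\<Sum>\<mu>\<in>words_of m. \<Sum>\<kappa>\<in>words_of j. f (2 # \<mu> @ \<kappa>))"
    by (simp only: Suc.IH)
  finally show ?case by (simp add: sum_words_of_Suc)
qed (simp add: words_of_0)

definition diag :: "(nat \<Rightarrow> 'a::cstar_algebra) \<Rightarrow> nat \<Rightarrow> (nat list \<Rightarrow> complex) \<Rightarrow> 'a" where
  "diag S m b = (\<Sum>\<mu>\<in>words_of m. b \<mu> *\<^sub>C (word_elem S \<mu> * star (word_elem S \<mu>)))"

lemma diag_add: "diag S m (\<lambda>\<mu>. a \<mu> + b \<mu>) = diag S m a + diag S m b"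
  by (simp add: diag_def scaleC_add_left sum.distrib)

lemma diag_diff: "diag S m (\<lambda>\<mu>. a \<mu> - b \<mu>) = diag S m a - diag S m b"
  by (simp add: diag_def cvector_space.scale_left_diff_distrib sum_subtractf)

lemma diag_scaleC: "diag S m (\<lambda>\<mu>. c * b \<mu>) = c *\<^sub>C diag S m b"
  by (simp add: diag_def cvector_space.scale_sum_right scaleC_scaleC)

lemma diag_sum: "diag S m (\<lambda>\<mu>. \<Sum>i\<in>I. b i \<mu>) = (\<Sum>i\<in>I. diag S m (b i))"
  unfolding diag_def cvector_space.scale_sum_left by (rule sum.swap)

lemma star_diag: "star (diag S m b) = diag S m (\<lambda>\<mu>. cnj (b \<mu>))"
  by (simp add: diag_def star_sum star_scaleC star_mult star_star)

lemma diag_raise: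
  assumes S: "cuntz_family S" shows "diag S m b = diag S (m + j) (\<lambda>\<rho>. b (take m \<rho>))"
proof -
  have e: "word_elem S \<mu> * star (word_elem S \<mu>) =
      (\<Sum>\<kappa>\<in>words_of j. word_elem S (\<mu> @ \<kappa>) * star (word_elem S (\<mu> @ \<kappa>)))" for \<mu>
  proof -
    have "(\<Sum>\<kappa>\<in>words_of j. word_elem S (\<mu> @ \<kappa>) * star (word_elem S (\<mu> @ \<kappa>))) =
        word_elem S \<mu> * (\<Sum>\<kappa>\<in>words_of j. word_elem S \<kappa> * star (word_elem S \<kappa>)) * star (word_elem S \<mu>)"
      by (simp add: sum_distrib_left sum_distrib_right word_elem_append star_mult mult.assoc)
    then show ?thesis by (simp add: sum_word_projections[OF S])
  qed
  have "diag S (m + j) (\<lambda>\<rho>. b (take m \<rho>)) =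
      (\<Sum>\<mu>\<in>words_of m. \<Sum>\<kappa>\<in>words_of j. b \<mu> *\<^sub>C (word_elem S (\<mu> @ \<kappa>) * star (word_elem S (\<mu> @ \<kappa>))))"
    unfolding diag_def sum_words_of_append by (intro sum.cong refl) (auto simp: words_of_def)
  also have "\<dots> = diag S m b"
    unfolding diag_def cvector_space.scale_sum_right[symmetric] e[symmetric] ..
  finally show ?thesis by simp
qed

text \<open>Since the level can always be raised, every large level works; this form lets sums, and
  later several elements at once, share one level.\<close>

lemma diagonal_span_diag:
  assumes S: "cuntz_family S"
    and x: "x \<in> cvector_space.span {word_elem S \<mu> * star (word_elem S \<mu>) | \<mu>. \<mu> \<in> lists {1, 2}}"
  shows "\<exists>m0. \<forall>m\<ge>m0. \<exists>b. x = diag S m b"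
proof -
  have "cvector_space.subspace {x. \<exists>m0. \<forall>m\<ge>m0. \<exists>b. x = diag S m b}"
  proof (rule cvector_space.subspaceI)
    have "0 = diag S m (\<lambda>_. 0)" for m by (simp add: diag_def)
    then show "0 \<in> {x. \<exists>m0. \<forall>m\<ge>m0. \<exists>b. x = diag S m b}" by blast
  next
    fix x y assume "x \<in> {x. \<exists>m0. \<forall>m\<ge>m0. \<exists>b. x = diag S m b}" "y \<in> {x. \<exists>m0. \<forall>m\<ge>m0. \<exists>b. x = diag S m b}"
    then obtain m1 m2 where "\<forall>m\<ge>m1. \<exists>b. x = diag S m b" "\<forall>m\<ge>m2. \<exists>b. y = diag S m b" by blast
    then have "\<forall>m\<ge>max m1 m2. \<exists>b. x + y = diag S m b"
      by (metis diag_add max.bounded_iff)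
    then show "x + y \<in> {x. \<exists>m0. \<forall>m\<ge>m0. \<exists>b. x = diag S m b}" by blast
  next
    fix c x assume "x \<in> {x. \<exists>m0. \<forall>m\<ge>m0. \<exists>b. x = diag S m b}"
    then obtain m1 where "\<forall>m\<ge>m1. \<exists>b. x = diag S m b" by blast
    then have "\<forall>m\<ge>m1. \<exists>b. c *\<^sub>C x = diag S m b" by (metis diag_scaleC)
    then show "c *\<^sub>C x \<in> {x. \<exists>m0. \<forall>m\<ge>m0. \<exists>b. x = diag S m b}" by blast
  qed
  moreover have "{word_elem S \<mu> * star (word_elem S \<mu>) | \<mu>. \<mu> \<in> lists {1, 2}} \<subseteq>
      {x. \<exists>m0. \<forall>m\<ge>m0. \<exists>b. x = diag S m b}"
  proof
    fix x assume "x \<in> {word_elem S \<mu> * star (word_elem S \<mu>) | \<mu>. \<mu> \<in> lists {1, 2}}"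
    then obtain \<mu> where \<mu>: "\<mu> \<in> lists {1, 2}" "x = word_elem S \<mu> * star (word_elem S \<mu>)" by blast
    have "diag S (length \<mu>) (\<lambda>\<nu>. if \<nu> = \<mu> then 1 else 0) = (\<Sum>\<nu>\<in>words_of (length \<mu>). if \<nu> = \<mu> then x else 0)"
      unfolding diag_def by (intro sum.cong) (auto simp: \<mu>)
    moreover have "\<mu> \<in> words_of (length \<mu>)" using \<mu> by (simp add: words_of_def)
    ultimately have x: "x = diag S (length \<mu>) (\<lambda>\<nu>. if \<nu> = \<mu> then 1 else 0)" by simp
    have "\<exists>b. x = diag S m b" if "m \<ge> length \<mu>" for m
      using diag_raise[OF S, of "length \<mu>" _ "m - length \<mu>"] that x by (metis le_add_diff_inverse)
    then show "x \<in> {x. \<exists>m0. \<forall>m\<ge>m0. \<exists>b. x = diag S m b}" by blast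
  qed
  ultimately show ?thesis using cvector_space.span_minimal x by blast
qed

text \<open>One level \<open>m\<close> serves all indices because approximation persists at higher
  levels. Real coefficients cost nothing: taking real parts is averaging with the adjoint, and the
  \<open>A k\<close> are self-adjoint.\<close>

lemma diagonal_approximation:
  assumes S: "cuntz_family S" and "finite I" and A: "\<And>k. k \<in> I \<Longrightarrow> A k \<in> diagonal_subalgebra S"
    and sa: "\<And>k. k \<in> I \<Longrightarrow> star (A k) = A k" and "\<epsilon> > 0"
  shows "\<exists>m b. \<forall>k\<in>I. norm (A k - diag S m (\<lambda>\<mu>. of_real (b k \<mu>))) \<le> \<epsilon>"
proof -
  have "\<exists>m0. \<forall>m\<ge>m0. \<exists>b. norm (A k - diag S m b) \<le> \<epsilon>" if k: "k \<in> I" for k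
  proof -
    obtain x where x: "x \<in> cvector_space.span {word_elem S \<mu> * star (word_elem S \<mu>) | \<mu>. \<mu> \<in> lists {1, 2}}"
      "dist x (A k) < \<epsilon>"
      using A[OF k] \<open>\<epsilon> > 0\<close> unfolding diagonal_subalgebra_def closed_cspan_def closure_approachable by blast
    obtain m0 where "\<forall>m\<ge>m0. \<exists>b. x = diag S m b" using diagonal_span_diag[OF S x(1)] by blast
    moreover have "norm (A k - x) \<le> \<epsilon>" using x(2) by (simp add: dist_norm norm_minus_commute)
    ultimately show ?thesis by metis
  qed
  then obtain m0 where m0: "\<And>k m. k \<in> I \<Longrightarrow> m \<ge> m0 k \<Longrightarrow> \<exists>b. norm (A k - diag S m b) \<le> \<epsilon>" by metis
  define m where "m = (\<Sum>k\<in>I. m0 k)"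
  have "m0 k \<le> m" if "k \<in> I" for k
    unfolding m_def using that \<open>finite I\<close> by (intro member_le_sum) auto
  then have "\<exists>b. norm (A k - diag S m b) \<le> \<epsilon>" if "k \<in> I" for k using m0 that by blast
  then obtain b where b: "\<And>k. k \<in> I \<Longrightarrow> norm (A k - diag S m (b k)) \<le> \<epsilon>" by metis
  have "norm (A k - diag S m (\<lambda>\<mu>. of_real (Re (b k \<mu>)))) \<le> \<epsilon>" if k: "k \<in> I" for k
  proof -
    define x where "x = A k - diag S m (b k)"
    have "of_real (Re z) = (1/2) * (z + cnj z)" for z by (simp add: complex_add_cnj)
    then have "diag S m (\<lambda>\<mu>. of_real (Re (b k \<mu>))) = (1/2) *\<^sub>C (diag S m (b k) + star (diag S m (b k)))"
      by (simp only: star_diag diag_scaleC diag_add)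
    moreover have "A k = (1/2) *\<^sub>C (A k + A k)"
      using scaleC_add_left[of "1/2" "1/2" "A k"] by (simp add: scaleC_add_right)
    moreover have "x + star x = (A k + A k) - (diag S m (b k) + star (diag S m (b k)))"
      using sa[OF k] by (simp add: x_def star_diff)
    ultimately have "A k - diag S m (\<lambda>\<mu>. of_real (Re (b k \<mu>))) = (1/2) *\<^sub>C (x + star x)"
      by (metis cvector_space.scale_right_diff_distrib)
    then have "norm (A k - diag S m (\<lambda>\<mu>. of_real (Re (b k \<mu>)))) = 1/2 * norm (x + star x)"
      by (simp add: norm_scaleC)
    also have "\<dots> \<le> 1/2 * (norm x + norm (star x))" by (intro mult_left_mono norm_triangle_ineq) simp
    finally show ?thesis using b[OF k] by (simp add: x_def)
  qed
  then show ?thesis by (intro exI[of _ m] exI[of _ "\<lambda>k \<mu>. Re (b k \<mu>)"]) blast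
qed

section \<open>Entries and norms of diagonal elements\<close>

lemma diag_entry:
  assumes S: "cuntz_family S" and \<mu>: "\<mu> \<in> words_of m"
  shows "star (word_elem S \<mu>) * diag S m b * word_elem S \<mu> = b \<mu> *\<^sub>C 1"
proof -
  have "star (word_elem S \<mu>) * diag S m b * word_elem S \<mu> =
      (\<Sum>\<nu>\<in>words_of m. b \<nu> *\<^sub>C ((star (word_elem S \<mu>) * word_elem S \<nu>) * (star (word_elem S \<nu>) * word_elem S \<mu>)))"
    by (simp add: diag_def sum_distrib_left sum_distrib_right scaleC_mult_left scaleC_mult_right mult.assoc)
  also have "\<dots> = (\<Sum>\<nu>\<in>words_of m. if \<nu> = \<mu> then b \<mu> *\<^sub>C 1 else 0)"
    by (intro sum.cong refl) (auto simp: word_inner[OF S \<mu>] word_inner[OF S _ \<mu>])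
  finally show ?thesis using \<mu> by simp
qed

lemma diag_mult_word_vec:
  assumes S: "cuntz_family S"
  shows "diag S m b * word_vec S m \<xi> = word_vec S m (\<lambda>\<mu>. b \<mu> * \<xi> \<mu>)"
proof -
  have "diag S m b * word_vec S m \<xi> = (\<Sum>\<mu>\<in>words_of m. \<Sum>\<nu>\<in>words_of m.
      (b \<mu> * \<xi> \<nu>) *\<^sub>C (word_elem S \<mu> * (star (word_elem S \<mu>) * word_elem S \<nu>)))"
    unfolding diag_def word_vec_def sum_product
    by (simp add: scaleC_mult_left scaleC_mult_right scaleC_scaleC mult.assoc) (simp add: mult.commute)
  also have "\<dots> = (\<Sum>\<mu>\<in>words_of m. \<Sum>\<nu>\<in>words_of m. if \<nu> = \<mu> then (b \<mu> * \<xi> \<mu>) *\<^sub>C word_elem S \<mu> else 0)"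
    by (intro sum.cong refl) (auto simp: word_inner[OF S, of _ m])
  finally show ?thesis by (simp add: word_vec_def)
qed

text \<open>On the word space a diagonal element multiplies coordinates, so the bound is the one for
  a diagonal matrix.\<close>

lemma norm_diag_le:
  assumes S: "cuntz_family S" and b: "\<And>\<mu>. \<mu> \<in> words_of m \<Longrightarrow> \<bar>b \<mu>\<bar> \<le> C" and "C \<ge> 0"
  shows "norm (diag S m (\<lambda>\<mu>. complex_of_real (b \<mu>))) \<le> C"
proof (rule norm_le_on_word_space[OF S _ \<open>C \<ge> 0\<close>])
  let ?d = "diag S m (\<lambda>\<mu>. complex_of_real (b \<mu>))"
  show "star ?d = ?d" by (simp add: star_diag)
  fix x assume "x \<in> word_space S m"
  then obtain \<xi> where x: "x = word_vec S m \<xi>" by (auto simp: word_space_def)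
  show "?d * x \<in> word_space S m" unfolding x diag_mult_word_vec[OF S] by (simp add: word_space_def)
  have nsq: "(norm (word_vec S m \<eta>))\<^sup>2 = (\<Sum>\<mu>\<in>words_of m. (cmod (\<eta> \<mu>))\<^sup>2)" for \<eta>
  proof -
    have "(\<Sum>\<mu>\<in>words_of m. cnj (\<eta> \<mu>) * \<eta> \<mu>) = of_real (\<Sum>\<mu>\<in>words_of m. (cmod (\<eta> \<mu>))\<^sup>2)"
      unfolding of_real_sum by (intro sum.cong refl) (metis complex_norm_square mult.commute of_real_power)
    then have "(norm (word_vec S m \<eta>))\<^sup>2 = cmod (of_real (\<Sum>\<mu>\<in>words_of m. (cmod (\<eta> \<mu>))\<^sup>2))"
      using cstar_identity[of "word_vec S m \<eta>"] by (simp add: word_vec_inner[OF S] norm_scaleC)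
    then show ?thesis by (simp add: sum_nonneg del: of_real_sum)
  qed
  have "(norm (?d * x))\<^sup>2 \<le> (C * norm x)\<^sup>2"
    unfolding x diag_mult_word_vec[OF S] nsq power_mult_distrib sum_distrib_left
  proof (rule sum_mono)
    fix \<mu> assume "\<mu> \<in> words_of m"
    then have "(b \<mu>)\<^sup>2 \<le> C\<^sup>2" using b power_mono[of "\<bar>b \<mu>\<bar>" C 2] by simp
    then show "(cmod (complex_of_real (b \<mu>) * \<xi> \<mu>))\<^sup>2 \<le> C\<^sup>2 * (cmod (\<xi> \<mu>))\<^sup>2"
      by (simp add: norm_mult power_mult_distrib mult_right_mono)
  qed
  then show "norm (?d * x) \<le> C * norm x"
    by (rule power2_le_imp_le) (use \<open>C \<ge> 0\<close> in simp)
qed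

lemma diag_entry_bound:
  assumes S: "cuntz_family S" and \<mu>: "\<mu> \<in> words_of m"
  shows "\<bar>b \<mu>\<bar> \<le> norm (diag S m (\<lambda>\<mu>. complex_of_real (b \<mu>)))"
proof -
  have "isometry_elem (word_elem S \<mu>)" using \<mu> by (intro isometry_word[OF S]) (simp add: words_of_def)
  then have "norm (word_elem S \<mu>) \<le> 1" using norm_isometry by fastforce
  from norm_compression_le[OF this, of "diag S m (\<lambda>\<mu>. complex_of_real (b \<mu>))"]
  show ?thesis by (simp add: diag_entry[OF S \<mu>] norm_scaleC)
qed

lemma diag_one: "cuntz_family S \<Longrightarrow> diag S m (\<lambda>_. c) = c *\<^sub>C 1"
  by (simp add: diag_def sum_word_projections flip: cvector_space.scale_sum_right)

text \<open>\<open>norm A - b \<mu>\<close> is an entry of a diagonal element within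
  \<open>\<epsilon>\<close> of \<open>norm A *\<^sub>R 1 - A\<close>, whose norm is at most
  \<open>norm A\<close> by positivity.\<close>

lemma diag_entry_ge:
  assumes S: "cuntz_family S" and A: "positive_elem A" and \<mu>: "\<mu> \<in> words_of m"
    and close: "norm (A - diag S m (\<lambda>\<mu>. complex_of_real (b \<mu>))) \<le> \<epsilon>"
  shows "b \<mu> \<ge> - \<epsilon>"
proof -
  have eq: "diag S m (\<lambda>\<mu>. complex_of_real (norm A - b \<mu>)) =
      (norm A *\<^sub>R 1 - A) + (A - diag S m (\<lambda>\<mu>. complex_of_real (b \<mu>)))"
    using diag_one[OF S, of m "complex_of_real (norm A)"]
    by (simp add: diag_diff scaleC_of_real)
  have "\<bar>norm A - b \<mu>\<bar> \<le> norm (diag S m (\<lambda>\<mu>. complex_of_real (norm A - b \<mu>)))"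
    using diag_entry_bound[OF S \<mu>, of "\<lambda>\<mu>. norm A - b \<mu>"] .
  also have "\<dots> \<le> norm A + \<epsilon>"
    unfolding eq by (intro order_trans[OF norm_triangle_ineq] add_mono positive_norm_diff_le A close)
  finally show ?thesis by linarith
qed

subsection \<open>Rounding probability vectors\<close>

text \<open>One unit is reserved for each index, which secures \<open>r k \<ge> 1\<close>; the
  remaining \<open>M - n\<close> are distributed by rounding down, and the deficit of at most
  \<open>n\<close> goes to index 1.\<close>

lemma round_probability_vector:
  fixes a :: "nat \<Rightarrow> real"
  assumes a: "\<And>k. k \<in> {1..n} \<Longrightarrow> a k \<ge> 0" "(\<Sum>k=1..n. a k) = 1" and "n \<ge> 1" "M \<ge> n"
  shows "\<exists>r :: nat \<Rightarrow> nat. (\<forall>k\<in>{1..n}. r k \<ge> 1 \<and> \<bar>real (r k) - real M * a k\<bar> \<le> 2 * real n) \<and> (\<Sum>k=1..n. r k) = M"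
proof -
  define c where "c k = real (M - n) * a k" for k
  define q where "q k = nat \<lfloor>c k\<rfloor>" for k
  have c0: "c k \<ge> 0" if "k \<in> {1..n}" for k using a(1)[OF that] by (simp add: c_def)
  have q: "real (q k) \<le> c k" "c k < real (q k) + 1" if "k \<in> {1..n}" for k
    using c0[OF that] by (simp_all add: q_def)
  have sumc: "(\<Sum>k=1..n. c k) = real (M - n)" unfolding c_def sum_distrib_left[symmetric] a(2) by simp
  have "real (\<Sum>k=1..n. q k) \<le> real (M - n)"
    unfolding sumc[symmetric] of_nat_sum by (intro sum_mono q)
  then have qle: "(\<Sum>k=1..n. q k) \<le> M - n" by (simp only: of_nat_le_iff)
  define d where "d = (M - n) - (\<Sum>k=1..n. q k)"
  have "real d = (\<Sum>k=1..n. c k - real (q k))"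
    unfolding d_def sum_subtractf sumc by (simp only: of_nat_diff[OF qle] of_nat_sum)
  also have "\<dots> \<le> (\<Sum>k=1..n. 1)" by (intro sum_mono) (use q in \<open>simp add: less_imp_le diff_le_eq add.commute\<close>)
  finally have d: "real d \<le> real n" by simp
  define r where "r k = 1 + q k + (if k = 1 then d else 0)" for k
  have "(\<Sum>k=1..n. r k) = n + (\<Sum>k=1..n. q k) + d"
    using \<open>n \<ge> 1\<close> by (simp add: r_def sum.distrib)
  also have "\<dots> = M" using qle \<open>M \<ge> n\<close> by (simp add: d_def)
  finally have sumr: "(\<Sum>k=1..n. r k) = M" .
  have "\<bar>real (r k) - real M * a k\<bar> \<le> 2 * real n" if k: "k \<in> {1..n}" for k
  proof -
    have ak: "0 \<le> real n * a k" "real n * a k \<le> real n"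
    proof -
      have "a k \<le> (\<Sum>k=1..n. a k)" using k a(1) by (intro member_le_sum) auto
      then show "real n * a k \<le> real n" using a(2) by (simp add: mult_left_le)
      show "0 \<le> real n * a k" using a(1)[OF k] by simp
    qed
    have "real M * a k = c k + real n * a k"
      using \<open>M \<ge> n\<close> by (simp add: c_def of_nat_diff algebra_simps)
    moreover have "real (q k) + 1 \<le> real (r k)" "real (r k) \<le> real (q k) + 1 + real d" by (simp_all add: r_def)
    moreover have "real n \<ge> 1" using \<open>n \<ge> 1\<close> by simp
    ultimately show ?thesis using q[OF k] ak d by linarith
  qed
  then show ?thesis using sumr by (intro exI[of _ r]) (auto simp: r_def)
qed

text \<open>Clipping negative entries and dividing by the total \<open>X\<close>, which is within
  \<open>2 * n * \<epsilon>\<close> of 1, gives a true probability vector. Clipping, normalising and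
  rounding cost \<open>\<epsilon>\<close>, \<open>2 * n * \<epsilon>\<close> and
  \<open>\<epsilon>\<close>, together at most \<open>4 * n * \<epsilon>\<close>.\<close>

lemma round_almost_probability_vector:
  fixes b :: "nat \<Rightarrow> real"
  assumes b: "\<And>k. k \<in> {1..n} \<Longrightarrow> b k \<ge> - \<epsilon>" "\<bar>(\<Sum>k=1..n. b k) - 1\<bar> \<le> real n * \<epsilon>" and "n \<ge> 1"
    and \<epsilon>: "\<epsilon> > 0" "4 * real n * \<epsilon> \<le> 1" and M: "M \<ge> n" "2 * real n \<le> real M * \<epsilon>"
  shows "\<exists>r :: nat \<Rightarrow> nat. (\<forall>k\<in>{1..n}. r k \<ge> 1 \<and> \<bar>real (r k) / real M - b k\<bar> \<le> 4 * real n * \<epsilon>) \<and> (\<Sum>k=1..n. r k) = M"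
proof -
  define x where "x k = max (b k) 0" for k
  define X where "X = (\<Sum>k=1..n. x k)"
  have xb: "\<bar>x k - b k\<bar> \<le> \<epsilon>" if "k \<in> {1..n}" for k using b(1)[OF that] \<epsilon> by (simp add: x_def)
  have "\<bar>X - (\<Sum>k=1..n. b k)\<bar> \<le> (\<Sum>k=1..n. \<bar>x k - b k\<bar>)"
    unfolding X_def sum_subtractf[symmetric] by (rule sum_abs)
  also have "\<dots> \<le> (\<Sum>k=1..n. \<epsilon>)" by (intro sum_mono xb)
  finally have X: "\<bar>X - 1\<bar> \<le> 2 * (real n * \<epsilon>)" using b(2) by simp
  then have X0: "X > 0" using \<epsilon> by simp
  define a where "a k = x k / X" for k
  have a0: "a k \<ge> 0" for k using X0 by (simp add: a_def x_def)
  have suma: "(\<Sum>k=1..n. a k) = 1" using X0 by (simp add: a_def X_def flip: sum_divide_distrib)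
  have ab: "\<bar>a k - b k\<bar> \<le> 2 * (real n * \<epsilon>) + \<epsilon>" if k: "k \<in> {1..n}" for k
  proof -
    have "a k \<le> 1" using member_le_sum[of k "{1..n}" a] k a0 suma by simp
    have "x k = a k * X" using X0 by (simp add: a_def)
    then have "a k - x k = a k * (1 - X)" by (simp add: algebra_simps)
    then have "\<bar>a k - x k\<bar> = a k * \<bar>X - 1\<bar>" using a0[of k] by (simp add: abs_mult abs_minus_commute)
    also have "\<dots> \<le> 1 * (2 * (real n * \<epsilon>))" using \<open>a k \<le> 1\<close> a0 X by (intro mult_mono) auto
    finally show ?thesis using xb[OF k] by linarith
  qed
  obtain r :: "nat \<Rightarrow> nat" where r: "\<And>k. k \<in> {1..n} \<Longrightarrow> r k \<ge> 1 \<and> \<bar>real (r k) - real M * a k\<bar> \<le> 2 * real n"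
    "(\<Sum>k=1..n. r k) = M"
    using round_probability_vector[OF a0 suma \<open>n \<ge> 1\<close> M(1)] by blast
  have M0: "real M > 0" using M(1) \<open>n \<ge> 1\<close> by simp
  have "\<bar>real (r k) / real M - b k\<bar> \<le> 4 * real n * \<epsilon>" if k: "k \<in> {1..n}" for k
  proof -
    have "real (r k) / real M - a k = (real (r k) - real M * a k) / real M"
      using M0 by (simp add: diff_divide_distrib)
    then have "\<bar>real (r k) / real M - a k\<bar> = \<bar>real (r k) - real M * a k\<bar> / real M"
      using M0 by (simp add: abs_divide)
    also have "\<dots> \<le> (real M * \<epsilon>) / real M" using r(1)[OF k] M(2) by (intro divide_right_mono) auto
    also have "\<dots> = \<epsilon>" using M0 by simp
    finally have "\<bar>real (r k) / real M - b k\<bar> \<le> 2 * (real n * \<epsilon>) + 2 * \<epsilon>" using ab[OF k] by linarith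
    moreover have "\<epsilon> \<le> real n * \<epsilon>" using \<open>n \<ge> 1\<close> \<epsilon> by simp
    ultimately show ?thesis by linarith
  qed
  then show ?thesis using r by blast
qed

lemma colouring_with_fibre_sizes:
  "\<exists>\<kappa> :: nat \<Rightarrow> nat. (\<forall>i<(\<Sum>k=1..n. r k). \<kappa> i \<in> {1..n}) \<and>
    (\<forall>k\<in>{1..n}. card {i. i < (\<Sum>k=1..n. r k) \<and> \<kappa> i = k} = r k)"
proof (induction n)
  case (Suc n)
  define s where "s = (\<Sum>k=1..n. r k)"
  obtain \<kappa> where \<kappa>: "\<And>i. i < s \<Longrightarrow> \<kappa> i \<in> {1..n}" "\<And>k. k \<in> {1..n} \<Longrightarrow> card {i. i < s \<and> \<kappa> i = k} = r k"
    using Suc unfolding s_def by blast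
  define \<kappa>' where "\<kappa>' i = (if i < s then \<kappa> i else Suc n)" for i
  have eq: "(\<Sum>k=1..Suc n. r k) = s + r (Suc n)" by (simp add: s_def)
  have last: "\<kappa>' i = Suc n \<longleftrightarrow> s \<le> i" for i
    using \<kappa>(1)[of i] by (cases "i < s") (auto simp: \<kappa>'_def)
  have "card {i. i < s + r (Suc n) \<and> \<kappa>' i = k} = r k" if "k \<in> {1..Suc n}" for k
  proof (cases "k = Suc n")
    case True
    have "{i. i < s + r (Suc n) \<and> \<kappa>' i = k} = {s..<s + r (Suc n)}"
      unfolding True last by auto
    then show ?thesis using True by simp
  next
    case False
    have "{i. i < s + r (Suc n) \<and> \<kappa>' i = k} = {i. i < s \<and> \<kappa> i = k}"
      using False by (auto simp: \<kappa>'_def split: if_splits)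
    moreover have "k \<in> {1..n}" using False that by auto
    ultimately show ?thesis using \<kappa>(2) by simp
  qed
  moreover have "\<kappa>' i \<in> {1..Suc n}" for i
    using \<kappa>(1)[of i] by (cases "i < s") (auto simp: \<kappa>'_def)
  ultimately show ?case unfolding eq by blast
qed simp

subsection \<open>Projections with prescribed diagonal\<close>

lemma orthonormal_projections_mult:
  fixes z :: "'i \<Rightarrow> 'a::cstar_algebra"
  assumes "finite B" "finite C"
    and z: "\<And>i j. i \<in> B \<union> C \<Longrightarrow> j \<in> B \<union> C \<Longrightarrow> star (z i) * z j = (if i = j then 1 else 0)"
  shows "(\<Sum>i\<in>B. z i * star (z i)) * (\<Sum>i\<in>C. z i * star (z i)) = (\<Sum>i\<in>B \<inter> C. z i * star (z i))"
proof -
  have "(\<Sum>i\<in>B. z i * star (z i)) * (\<Sum>i\<in>C. z i * star (z i)) =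
      (\<Sum>i\<in>B. \<Sum>j\<in>C. z i * (star (z i) * z j) * star (z j))"
    unfolding sum_product by (simp only: mult.assoc)
  also have "\<dots> = (\<Sum>i\<in>B. \<Sum>j\<in>C. if j = i then z i * star (z i) else 0)"
    by (intro sum.cong refl) (simp add: z)
  also have "\<dots> = (\<Sum>i\<in>B. if i \<in> C then z i * star (z i) else 0)"
    using \<open>finite C\<close> by simp
  finally show ?thesis using \<open>finite B\<close> by (simp add: sum.inter_restrict)
qed

text \<open>The complete prefix code \<open>1, 21, 221, \<dots>, 2\<^sup>m1, 2\<^sup>m\<^sup>+\<^sup>1\<close> splits the unit into
  any given number of pieces.\<close>

definition comb_word :: "nat \<Rightarrow> nat \<Rightarrow> nat list" where
  "comb_word m i = (if i = m then replicate m 2 else replicate i 2 @ [1])"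

lemma comb_word_0: "comb_word 0 0 = []" "comb_word (Suc m) 0 = [1]"
  and comb_word_Suc: "comb_word (Suc m) (Suc i) = 2 # comb_word m i"
  by (auto simp: comb_word_def)

lemma comb_word_in_lists: "comb_word m i \<in> lists {1, 2}"
  by (auto simp: comb_word_def)

lemma comb_word_inner:
  assumes S: "cuntz_family S"
  shows "i \<le> m \<Longrightarrow> j \<le> m \<Longrightarrow>
    star (word_elem S (comb_word m i)) * word_elem S (comb_word m j) = (if i = j then 1 else 0)"
proof (induction m arbitrary: i j)
  case (Suc m)
  show ?case
  proof (cases i; cases j)
    fix i' j' assume ij: "i = Suc i'" "j = Suc j'"
    show ?thesis using Suc unfolding ij comb_word_Suc word_elem_Cons star_mult
      by (simp add: mult.assoc cuntz_family_simps[OF S])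
  qed (simp_all add: comb_word_0 comb_word_Suc star_mult mult.assoc cuntz_family_simps[OF S])
qed (simp add: comb_word_0)

lemma comb_word_inj:
  assumes "i \<le> m" "j \<le> m" "comb_word m i = comb_word m j" shows "i = j"
  using assms
proof (induction m arbitrary: i j)
  case (Suc m)
  then show ?case
    by (cases i; cases j) (auto simp: comb_word_0 comb_word_Suc)
qed simp

lemma sum_comb_projections:
  assumes S: "cuntz_family S"
  shows "(\<Sum>i\<le>m. word_elem S (comb_word m i) * star (word_elem S (comb_word m i))) = 1"
proof (induction m)
  case (Suc m)
  have "(\<Sum>i\<le>Suc m. word_elem S (comb_word (Suc m) i) * star (word_elem S (comb_word (Suc m) i))) =
      S 1 * star (S 1) + S 2 * (\<Sum>i\<le>m. word_elem S (comb_word m i) * star (word_elem S (comb_word m i))) * star (S 2)"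
    by (simp add: sum.atMost_Suc_shift comb_word_0 comb_word_Suc star_mult sum_distrib_left sum_distrib_right
        mult.assoc del: sum.atMost_Suc)
  then show ?case by (simp add: Suc cuntz_family_simps[OF S])
qed (simp add: comb_word_0)

text \<open>The discrete Fourier transform of the code: isometries with orthogonal ranges
  whose range projections have constant diagonal.\<close>

definition fourier_isometry :: "(nat \<Rightarrow> 'a::cstar_algebra) \<Rightarrow> nat \<Rightarrow> nat \<Rightarrow> 'a" where
  "fourier_isometry S m r = of_real (1 / sqrt (real (Suc m))) *\<^sub>C
     (\<Sum>i\<le>m. cnj (unity_root (Suc m) r) ^ i *\<^sub>C word_elem S (comb_word m i))"

lemma unity_root_swap: "unity_root n i ^ j = unity_root n j ^ i"
  by (simp add: unity_root_power mult.commute)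

lemma inverse_sqrt_square: "of_real (1 / sqrt (real (Suc m))) * of_real (1 / sqrt (real (Suc m))) = (1 / of_nat (Suc m) :: complex)"
proof -
  have "1 / sqrt (real (Suc m)) * (1 / sqrt (real (Suc m))) = 1 / real (Suc m)"
    by (simp del: of_nat_Suc)
  then show ?thesis by (metis of_real_1 of_real_divide of_real_mult of_real_of_nat_eq)
qed

lemma fourier_isometry_inner:
  assumes S: "cuntz_family S" and "r \<le> m" "s \<le> m"
  shows "star (fourier_isometry S m r) * fourier_isometry S m s = (if r = s then 1 else 0)"
proof -
  let ?t = "\<lambda>i. word_elem S (comb_word m i)" and ?u = "unity_root (Suc m)"
  have "star (\<Sum>i\<le>m. cnj (?u r) ^ i *\<^sub>C ?t i) * (\<Sum>i\<le>m. cnj (?u s) ^ i *\<^sub>C ?t i) =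
      (\<Sum>i\<le>m. \<Sum>j\<le>m. (?u r ^ i * cnj (?u s) ^ j) *\<^sub>C (star (?t i) * ?t j))"
    unfolding star_sum sum_product
    by (simp add: star_scaleC scaleC_mult_left scaleC_mult_right scaleC_scaleC) (simp add: mult.commute)
  also have "\<dots> = (\<Sum>i\<le>m. \<Sum>j\<le>m. if j = i then (?u r ^ i * cnj (?u s) ^ i) *\<^sub>C 1 else 0)"
    by (intro sum.cong refl) (auto simp: comb_word_inner[OF S])
  \<comment> \<open>Exchanging index and exponent turns the sum over exponents into one over the
    roots of unity.\<close>
  also have "\<dots> = (\<Sum>i\<le>m. ?u i ^ r * cnj (?u i) ^ s) *\<^sub>C 1"
  proof -
    have "?u r ^ i * cnj (?u s) ^ i = ?u i ^ r * cnj (?u i) ^ s" for i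
      using unity_root_swap[of "Suc m" r i] unity_root_swap[of "Suc m" s i]
      by (simp flip: complex_cnj_power)
    then show ?thesis by (simp add: cvector_space.scale_sum_left)
  qed
  also have "(\<Sum>i\<le>m. ?u i ^ r * cnj (?u i) ^ s) = (if r = s then of_nat (Suc m) else 0)"
    using sum_unity_root_balanced[of r m s "Suc m"] assms by (simp only: lessThan_Suc_atMost lessI)
  finally have *: "star (\<Sum>i\<le>m. cnj (?u r) ^ i *\<^sub>C ?t i) * (\<Sum>i\<le>m. cnj (?u s) ^ i *\<^sub>C ?t i) =
      (if r = s then of_nat (Suc m) else 0) *\<^sub>C 1" .
  have "star (fourier_isometry S m r) * fourier_isometry S m s = (1 / of_nat (Suc m)) *\<^sub>C
      (star (\<Sum>i\<le>m. cnj (?u r) ^ i *\<^sub>C ?t i) * (\<Sum>i\<le>m. cnj (?u s) ^ i *\<^sub>C ?t i))"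
    unfolding fourier_isometry_def star_scaleC complex_cnj_complex_of_real scaleC_mult_left scaleC_mult_right
      scaleC_scaleC inverse_sqrt_square ..
  then show ?thesis unfolding * by (simp add: scaleC_scaleC del: of_nat_Suc)
qed

lemma fourier_range_projection:
  "fourier_isometry S m r * star (fourier_isometry S m r) = (1 / of_nat (Suc m)) *\<^sub>C
    (\<Sum>i\<le>m. \<Sum>j\<le>m. (cnj (unity_root (Suc m) r) ^ i * unity_root (Suc m) r ^ j) *\<^sub>C
      (word_elem S (comb_word m i) * star (word_elem S (comb_word m j))))"
proof -
  let ?t = "\<lambda>i. word_elem S (comb_word m i)" and ?u = "unity_root (Suc m)"
  have "(\<Sum>i\<le>m. cnj (?u r) ^ i *\<^sub>C ?t i) * star (\<Sum>i\<le>m. cnj (?u r) ^ i *\<^sub>C ?t i) =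
      (\<Sum>i\<le>m. \<Sum>j\<le>m. (cnj (?u r) ^ i * ?u r ^ j) *\<^sub>C (?t i * star (?t j)))"
    unfolding star_sum sum_product
    by (simp add: star_scaleC scaleC_mult_left scaleC_mult_right scaleC_scaleC) (simp add: mult.commute)
  then show ?thesis
    unfolding fourier_isometry_def star_scaleC complex_cnj_complex_of_real scaleC_mult_left scaleC_mult_right
      scaleC_scaleC inverse_sqrt_square by simp
qed

lemma sum_fourier_range_projections:
  assumes S: "cuntz_family S"
  shows "(\<Sum>r\<le>m. fourier_isometry S m r * star (fourier_isometry S m r)) = 1"
proof -
  let ?t = "\<lambda>i. word_elem S (comb_word m i)" and ?u = "unity_root (Suc m)"
  have "(\<Sum>r\<le>m. \<Sum>i\<le>m. \<Sum>j\<le>m. (cnj (?u r) ^ i * ?u r ^ j) *\<^sub>C (?t i * star (?t j))) =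
      (\<Sum>i\<le>m. \<Sum>j\<le>m. (\<Sum>r\<le>m. ?u r ^ j * cnj (?u r) ^ i) *\<^sub>C (?t i * star (?t j)))"
  proof -
    have swap: "(\<Sum>r\<le>m. \<Sum>i\<le>m. \<Sum>j\<le>m. g r i j) = (\<Sum>i\<le>m. \<Sum>j\<le>m. \<Sum>r\<le>m. g r i j)"
      for g :: "nat \<Rightarrow> nat \<Rightarrow> nat \<Rightarrow> 'a"
      by (rule trans[OF sum.swap]) (intro sum.cong refl sum.swap)
    show ?thesis unfolding cvector_space.scale_sum_left by (rule trans[OF swap]) (simp only: mult.commute)
  qed
  also have "\<dots> = (\<Sum>i\<le>m. \<Sum>j\<le>m. if j = i then of_nat (Suc m) *\<^sub>C (?t i * star (?t i)) else 0)"
  proof (intro sum.cong refl)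
    fix i j assume "i \<in> {..m}" "j \<in> {..m}"
    then have "(\<Sum>r\<le>m. ?u r ^ j * cnj (?u r) ^ i) = (if j = i then of_nat (Suc m) else 0)"
      using sum_unity_root_balanced[of j m i "Suc m"] by (simp only: lessThan_Suc_atMost atMost_iff lessI)
    then show "(\<Sum>r\<le>m. ?u r ^ j * cnj (?u r) ^ i) *\<^sub>C (?t i * star (?t j)) =
        (if j = i then of_nat (Suc m) *\<^sub>C (?t i * star (?t i)) else 0)" by (simp del: of_nat_Suc)
  qed
  also have "\<dots> = of_nat (Suc m) *\<^sub>C 1"
    using sum_comb_projections[OF S, of m] by (simp del: of_nat_Suc flip: cvector_space.scale_sum_right)
  finally show ?thesis
    unfolding fourier_range_projection cvector_space.scale_sum_right[symmetric]
    by (simp add: scaleC_scaleC del: of_nat_Suc)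
qed

section \<open>The expectation onto the diagonal\<close>

locale diagonal_expectation = gauge_expectation S EF
  for S :: "nat \<Rightarrow> 'a::cstar_algebra" and EF +
  fixes E :: "'a \<Rightarrow> 'a"
  assumes diagonal_expectation: "canonical_expectation_UHF_diagonal S E"
begin

lemma EF_in_UHF: "EF x \<in> UHF_subalgebra S"
  using expectation by (simp add: canonical_expectation_UHF_def conditional_expectation_def)

lemma E_conditional: "conditional_expectation (UHF_subalgebra S) (diagonal_subalgebra S) E"
  using diagonal_expectation unfolding canonical_expectation_UHF_diagonal_def by blast

lemma E_in: "x \<in> UHF_subalgebra S \<Longrightarrow> E x \<in> diagonal_subalgebra S"
  using E_conditional unfolding conditional_expectation_def by blast

lemma E_id: "b \<in> diagonal_subalgebra S \<Longrightarrow> E b = b"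
  using E_conditional unfolding conditional_expectation_def by blast

lemma E_add: "x \<in> UHF_subalgebra S \<Longrightarrow> y \<in> UHF_subalgebra S \<Longrightarrow> E (x + y) = E x + E y"
  using E_conditional unfolding conditional_expectation_def by blast

lemma E_scaleC: "x \<in> UHF_subalgebra S \<Longrightarrow> E (c *\<^sub>C x) = c *\<^sub>C E x"
  using E_conditional unfolding conditional_expectation_def by blast

lemma E_pos: "x \<in> UHF_subalgebra S \<Longrightarrow> 0 \<preceq> x \<Longrightarrow> 0 \<preceq> E x"
  using E_conditional unfolding conditional_expectation_def by blast

lemma diagonal_subset_UHF: "diagonal_subalgebra S \<subseteq> UHF_subalgebra S"
  using E_conditional unfolding conditional_expectation_def by blast

lemma one_in_diagonal: "1 \<in> diagonal_subalgebra S"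
  using E_conditional unfolding conditional_expectation_def unital_cstar_subalgebra_def by blast

lemma E_off_diagonal:
  "\<mu> \<in> lists {1, 2} \<Longrightarrow> \<nu> \<in> lists {1, 2} \<Longrightarrow> length \<mu> = length \<nu> \<Longrightarrow> \<mu> \<noteq> \<nu> \<Longrightarrow>
    E (word_elem S \<mu> * star (word_elem S \<nu>)) = 0"
  using diagonal_expectation unfolding canonical_expectation_UHF_diagonal_def by blast

lemma EF_id: "b \<in> UHF_subalgebra S \<Longrightarrow> EF b = b"
  using expectation unfolding canonical_expectation_UHF_def conditional_expectation_def by blast

lemma EF_pos: "0 \<preceq> x \<Longrightarrow> 0 \<preceq> EF x"
  using expectation unfolding canonical_expectation_UHF_def conditional_expectation_def by blast

definition ED :: "'a \<Rightarrow> 'a" where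
  "ED x = E (EF x)"

lemma ED_add: "ED (x + y) = ED x + ED y"
  by (simp add: ED_def EF_add E_add EF_in_UHF)

lemma ED_scaleC: "ED (c *\<^sub>C x) = c *\<^sub>C ED x"
  by (simp add: ED_def EF_scaleC E_scaleC EF_in_UHF)

lemma ED_zero: "ED 0 = 0"
  using ED_scaleC[of 0 0] by simp

lemma ED_diff: "ED (x - y) = ED x - ED y"
  using ED_add[of "x - y" y] by (simp add: algebra_simps)

lemma ED_sum: "ED (sum f I) = (\<Sum>i\<in>I. ED (f i))"
  by (induction I rule: infinite_finite_induct) (simp_all add: ED_zero ED_add)

lemma ED_in_diagonal: "ED x \<in> diagonal_subalgebra S"
  by (simp add: ED_def E_in EF_in_UHF)

lemma ED_one: "ED 1 = 1"
  using one_in_diagonal diagonal_subset_UHF by (auto simp: ED_def EF_id E_id)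

lemma ED_positive: "positive_elem x \<Longrightarrow> positive_elem (ED x)"
  using EF_pos[of x] E_pos[OF EF_in_UHF, of x] by (simp add: ED_def cstar_le_def)

lemma ED_word:
  assumes "\<mu> \<in> lists {1, 2}" "\<nu> \<in> lists {1, 2}"
  shows "ED (word_elem S \<mu> * star (word_elem S \<nu>)) = (if \<mu> = \<nu> then word_elem S \<mu> * star (word_elem S \<mu>) else 0)"
proof -
  have "E 0 = 0" using ED_zero by (simp add: ED_def EF_zero)
  moreover have "word_elem S \<mu> * star (word_elem S \<mu>) \<in> diagonal_subalgebra S"
    unfolding diagonal_subalgebra_def by (rule closed_cspan_base) (use assms in blast)
  ultimately show ?thesis
    using assms E_off_diagonal[OF assms] by (auto simp: ED_def EF_word E_id)
qed

text \<open>Pairs of distinct code words contribute nothing: those of different lengths are killed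
  by \<open>EF\<close>, those of equal length by \<open>E\<close>. On the diagonal the phases
  cancel, leaving \<open>1 / (m + 1)\<close>, and the code projections add up to 1.\<close>

lemma ED_fourier_projection:
  assumes \<mu>: "\<mu> \<in> lists {1, 2}"
  shows "ED (word_elem S \<mu> * fourier_isometry S m r * star (word_elem S \<mu> * fourier_isometry S m r)) =
    (1 / of_nat (Suc m)) *\<^sub>C (word_elem S \<mu> * star (word_elem S \<mu>))"
proof -
  let ?u = "unity_root (Suc m) r" and ?c = "\<lambda>i. word_elem S (\<mu> @ comb_word m i)"
  have u: "cnj ?u ^ i * ?u ^ i = 1" for i
    using cnj_unity_root[of "Suc m" r] by (metis power_mult_distrib power_one)
  have w: "\<mu> @ comb_word m i \<in> lists {1, 2}" for i using \<mu> comb_word_in_lists by auto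
  have "word_elem S \<mu> * fourier_isometry S m r * star (word_elem S \<mu> * fourier_isometry S m r) =
      word_elem S \<mu> * (fourier_isometry S m r * star (fourier_isometry S m r)) * star (word_elem S \<mu>)"
    by (simp only: star_mult mult.assoc)
  also have "\<dots> = (1 / of_nat (Suc m)) *\<^sub>C (\<Sum>i\<le>m. \<Sum>j\<le>m. (cnj ?u ^ i * ?u ^ j) *\<^sub>C (?c i * star (?c j)))"
    unfolding fourier_range_projection
    by (simp add: sum_distrib_left sum_distrib_right scaleC_mult_left scaleC_mult_right word_elem_append
        star_mult mult.assoc del: of_nat_Suc)
  finally have "ED (word_elem S \<mu> * fourier_isometry S m r * star (word_elem S \<mu> * fourier_isometry S m r)) =
      (1 / of_nat (Suc m)) *\<^sub>C (\<Sum>i\<le>m. \<Sum>j\<le>m. (cnj ?u ^ i * ?u ^ j) *\<^sub>C ED (?c i * star (?c j)))"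
    by (simp only: ED_scaleC ED_sum)
  also have "(\<Sum>i\<le>m. \<Sum>j\<le>m. (cnj ?u ^ i * ?u ^ j) *\<^sub>C ED (?c i * star (?c j))) =
      (\<Sum>i\<le>m. \<Sum>j\<le>m. if j = i then ?c i * star (?c i) else 0)"
  proof (intro sum.cong refl)
    fix i j assume ij: "i \<in> {..m}" "j \<in> {..m}"
    show "(cnj ?u ^ i * ?u ^ j) *\<^sub>C ED (?c i * star (?c j)) = (if j = i then ?c i * star (?c i) else 0)"
    proof (cases "j = i")
      case True
      then show ?thesis by (simp only: ED_word[OF w w] u simp_thms if_True) simp
    next
      case False
      then have "\<mu> @ comb_word m i \<noteq> \<mu> @ comb_word m j" using comb_word_inj ij by auto
      then show ?thesis using False by (simp add: ED_word[OF w w])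
    qed
  qed
  also have "\<dots> = word_elem S \<mu> * (\<Sum>i\<le>m. word_elem S (comb_word m i) * star (word_elem S (comb_word m i))) * star (word_elem S \<mu>)"
    by (simp add: sum_distrib_left sum_distrib_right word_elem_append star_mult mult.assoc)
  finally show ?thesis by (simp only: sum_comb_projections[OF family] mult_1_right)
qed

text \<open>Below each word \<open>\<mu>\<close> there are \<open>M + 1\<close> orthogonal Fourier
  range projections of equal diagonal. Distributing them among \<open>n\<close> colours,
  \<open>r \<mu> k\<close> of them to colour \<open>k\<close>, and adding up each colour gives
  \<open>Q k\<close>; orthogonality and completeness are those of the Fourier system.\<close>

lemma projections_with_diagonal:
  fixes r :: "nat list \<Rightarrow> nat \<Rightarrow> nat"
  assumes sum_r: "\<And>\<mu>. \<mu> \<in> words_of m \<Longrightarrow> (\<Sum>k=1..n. r \<mu> k) = Suc M"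
    and r1: "\<And>\<mu> k. \<mu> \<in> words_of m \<Longrightarrow> k \<in> {1..n} \<Longrightarrow> r \<mu> k \<ge> 1"
  shows "\<exists>Q. (\<forall>k\<in>{1..n}. projection_elem (Q k) \<and> Q k \<noteq> 0 \<and>
      ED (Q k) = diag S m (\<lambda>\<mu>. complex_of_real (real (r \<mu> k) / real (Suc M)))) \<and>
    (\<forall>j\<in>{1..n}. \<forall>k\<in>{1..n}. j \<noteq> k \<longrightarrow> Q j * Q k = 0) \<and> (\<Sum>k=1..n. Q k) = 1"
proof -
  have "\<exists>\<kappa> :: nat \<Rightarrow> nat. (\<forall>i\<le>M. \<kappa> i \<in> {1..n}) \<and> (\<forall>k\<in>{1..n}. card {i. i \<le> M \<and> \<kappa> i = k} = r \<mu> k)"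
    if "\<mu> \<in> words_of m" for \<mu>
    using colouring_with_fibre_sizes[of "r \<mu>" n] unfolding sum_r[OF that] less_Suc_eq_le .
  then obtain \<kappa> :: "nat list \<Rightarrow> nat \<Rightarrow> nat" where \<kappa>: "\<And>\<mu> i. \<mu> \<in> words_of m \<Longrightarrow> i \<le> M \<Longrightarrow> \<kappa> \<mu> i \<in> {1..n}"
    "\<And>\<mu> k. \<mu> \<in> words_of m \<Longrightarrow> k \<in> {1..n} \<Longrightarrow> card {i. i \<le> M \<and> \<kappa> \<mu> i = k} = r \<mu> k"
    by metis
  define z where "z = (\<lambda>(\<mu>, i). word_elem S \<mu> * fourier_isometry S M i)"
  define F where "F \<mu> k = {i. i \<le> M \<and> \<kappa> \<mu> i = k}" for \<mu> k
  define J where "J k = (SIGMA \<mu>:words_of m. F \<mu> k)" for k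
  define Q where "Q k = (\<Sum>p\<in>J k. z p * star (z p))" for k
  have finF: "finite (F \<mu> k)" for \<mu> k by (simp add: F_def)
  then have finJ: "finite (J k)" for k unfolding J_def by (intro finite_SigmaI) auto
  have z: "star (z p) * z q = (if p = q then 1 else 0)"
    if "p \<in> words_of m \<times> {..M}" "q \<in> words_of m \<times> {..M}" for p q
  proof -
    obtain \<mu> i \<nu> j where pq: "p = (\<mu>, i)" "q = (\<nu>, j)" "\<mu> \<in> words_of m" "\<nu> \<in> words_of m" "i \<le> M" "j \<le> M"
      using \<open>p \<in> _\<close> \<open>q \<in> _\<close> by auto
    have "star (z p) * z q =
        star (fourier_isometry S M i) * (star (word_elem S \<mu>) * word_elem S \<nu>) * fourier_isometry S M j"
      unfolding pq(1,2) z_def prod.case star_mult by (simp only: mult.assoc)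
    also have "\<dots> = (if \<mu> = \<nu> then star (fourier_isometry S M i) * fourier_isometry S M j else 0)"
      unfolding word_inner[OF family pq(3,4)] by simp
    finally show ?thesis
      unfolding fourier_isometry_inner[OF family pq(5,6)] by (simp add: pq(1,2))
  qed
  have J_sub: "J k \<subseteq> words_of m \<times> {..M}" for k by (auto simp: J_def F_def)
  have QQ: "(\<Sum>p\<in>B. z p * star (z p)) * (\<Sum>p\<in>C. z p * star (z p)) = (\<Sum>p\<in>B \<inter> C. z p * star (z p))"
    if "finite B" "finite C" "B \<subseteq> words_of m \<times> {..M}" "C \<subseteq> words_of m \<times> {..M}" for B C
    by (rule orthonormal_projections_mult[OF that(1,2)]) (use z that in blast)
  have "projection_elem (Q k)" for k
    unfolding projection_elem_def Q_def QQ[OF finJ finJ J_sub J_sub]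
    by (simp add: star_sum star_mult star_star)
  moreover have "Q k \<noteq> 0" if k: "k \<in> {1..n}" for k
  proof
    assume Q0: "Q k = 0"
    \<comment> \<open>Any word of length \<open>m\<close> would do: a single range projection of
      colour \<open>k\<close> below it makes \<open>Q k\<close> nonzero.\<close>
    define \<mu> where "\<mu> = replicate m (1::nat)"
    have \<mu>: "\<mu> \<in> words_of m" by (auto simp: \<mu>_def words_of_def)
    have "card (F \<mu> k) \<ge> 1" using \<kappa>(2)[OF \<mu> k] r1[OF \<mu> k] by (simp add: F_def)
    then obtain i where i: "i \<in> F \<mu> k" by (metis card.empty ex_in_conv not_one_le_zero)
    then have p: "(\<mu>, i) \<in> J k" using \<mu> by (simp add: J_def)
    have "z (\<mu>, i) * star (z (\<mu>, i)) * Q k = z (\<mu>, i) * star (z (\<mu>, i))"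
      using QQ[of "{(\<mu>, i)}" "J k"] finJ J_sub p by (auto simp: Q_def)
    then have "z (\<mu>, i) = 0" using Q0 norm_mult_star[of "z (\<mu>, i)"] by simp
    moreover have "star (z (\<mu>, i)) * z (\<mu>, i) = 1" using z p J_sub by (metis subsetD)
    ultimately show False by simp
  qed
  moreover have "ED (Q k) = diag S m (\<lambda>\<mu>. complex_of_real (real (r \<mu> k) / real (Suc M)))"
    if k: "k \<in> {1..n}" for k
  proof -
    have "ED (Q k) = (\<Sum>\<mu>\<in>words_of m. \<Sum>i\<in>F \<mu> k. ED (z (\<mu>, i) * star (z (\<mu>, i))))"
      unfolding Q_def J_def ED_sum by (subst sum.Sigma) (auto simp: finF split_def)
    also have "\<dots> = (\<Sum>\<mu>\<in>words_of m. \<Sum>i\<in>F \<mu> k. (1 / of_nat (Suc M)) *\<^sub>C (word_elem S \<mu> * star (word_elem S \<mu>)))"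
      unfolding z_def prod.case
      by (intro sum.cong refl ED_fourier_projection) (simp add: words_of_def)
    also have "\<dots> = (\<Sum>\<mu>\<in>words_of m. complex_of_real (real (r \<mu> k) / real (Suc M)) *\<^sub>C (word_elem S \<mu> * star (word_elem S \<mu>)))"
    proof (intro sum.cong refl)
      fix \<mu> assume \<mu>: "\<mu> \<in> words_of m"
      have "(\<Sum>i\<in>F \<mu> k. (1 / of_nat (Suc M)) *\<^sub>C x) = complex_of_real (real (r \<mu> k) / real (Suc M)) *\<^sub>C x" for x :: 'a
      proof -
        have "(\<Sum>i\<in>F \<mu> k. (1 / of_nat (Suc M)) *\<^sub>C x) = (\<Sum>i\<in>F \<mu> k. 1 / of_nat (Suc M)) *\<^sub>C x"
          by (simp only: cvector_space.scale_sum_left)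
        also have "(\<Sum>i\<in>F \<mu> k. 1 / of_nat (Suc M)) = complex_of_real (real (r \<mu> k) / real (Suc M))"
          using \<kappa>(2)[OF \<mu> k] by (simp add: F_def del: of_nat_Suc)
        finally show ?thesis .
      qed
      then show "(\<Sum>i\<in>F \<mu> k. (1 / of_nat (Suc M)) *\<^sub>C (word_elem S \<mu> * star (word_elem S \<mu>))) =
        complex_of_real (real (r \<mu> k) / real (Suc M)) *\<^sub>C (word_elem S \<mu> * star (word_elem S \<mu>))" .
    qed
    finally show ?thesis by (simp add: diag_def)
  qed
  moreover have "Q j * Q k = 0" if "j \<noteq> k" for j k
  proof -
    have "J j \<inter> J k = {}" using that by (auto simp: J_def F_def)
    then show ?thesis unfolding Q_def QQ[OF finJ finJ J_sub J_sub] by simp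
  qed
  moreover have "(\<Sum>k=1..n. Q k) = 1"
  proof -
    have "Q k = (\<Sum>\<mu>\<in>words_of m. \<Sum>i\<le>M. if k = \<kappa> \<mu> i then z (\<mu>, i) * star (z (\<mu>, i)) else 0)" for k
    proof -
      have "Q k = (\<Sum>\<mu>\<in>words_of m. \<Sum>i\<in>F \<mu> k. z (\<mu>, i) * star (z (\<mu>, i)))"
        unfolding Q_def J_def by (subst sum.Sigma) (auto simp: finF split_def)
      also have "\<dots> = (\<Sum>\<mu>\<in>words_of m. \<Sum>i\<le>M. if k = \<kappa> \<mu> i then z (\<mu>, i) * star (z (\<mu>, i)) else 0)"
        by (intro sum.cong refl sum.mono_neutral_cong_left) (auto simp: F_def)
      finally show ?thesis .
    qed
    then have "(\<Sum>k=1..n. Q k) = (\<Sum>k=1..n. \<Sum>\<mu>\<in>words_of m. \<Sum>i\<le>M. if k = \<kappa> \<mu> i then z (\<mu>, i) * star (z (\<mu>, i)) else 0)"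
      by (simp only:)
    also have "\<dots> = (\<Sum>\<mu>\<in>words_of m. \<Sum>i\<le>M. \<Sum>k=1..n. if k = \<kappa> \<mu> i then z (\<mu>, i) * star (z (\<mu>, i)) else 0)"
      by (rule trans[OF sum.swap]) (intro sum.cong refl sum.swap)
    also have "\<dots> = (\<Sum>\<mu>\<in>words_of m. \<Sum>i\<le>M. z (\<mu>, i) * star (z (\<mu>, i)))"
    proof (intro sum.cong refl)
      fix \<mu> i assume "\<mu> \<in> words_of m" "i \<in> {..M}"
      then have "\<kappa> \<mu> i \<in> {1..n}" using \<kappa>(1) by simp
      then show "(\<Sum>k=1..n. if k = \<kappa> \<mu> i then z (\<mu>, i) * star (z (\<mu>, i)) else 0) = z (\<mu>, i) * star (z (\<mu>, i))"
        by (subst sum.delta) auto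
    qed
    also have "\<dots> = (\<Sum>\<mu>\<in>words_of m. word_elem S \<mu> * (\<Sum>i\<le>M. fourier_isometry S M i * star (fourier_isometry S M i)) * star (word_elem S \<mu>))"
      by (simp add: z_def sum_distrib_left sum_distrib_right star_mult mult.assoc)
    also have "\<dots> = 1"
      by (simp add: sum_fourier_range_projections[OF family] sum_word_projections[OF family])
    finally show ?thesis .
  qed
  ultimately show ?thesis by (intro exI[of _ Q]) blast
qed

end

text \<open>The partial isometries of the separate equivalences add up to a unitary, since both
  families of projections are orthogonal with sum 1.\<close>

lemma unitary_between_decompositions:
  fixes P Q :: "nat \<Rightarrow> 'a::cstar_algebra"
  assumes P: "\<And>k. k \<in> I \<Longrightarrow> projection_elem (P k)" "(\<Sum>k\<in>I. P k) = 1"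
      "\<And>j k. j \<in> I \<Longrightarrow> k \<in> I \<Longrightarrow> j \<noteq> k \<Longrightarrow> P j * P k = 0"
    and Q: "\<And>k. k \<in> I \<Longrightarrow> projection_elem (Q k)" "(\<Sum>k\<in>I. Q k) = 1"
      "\<And>j k. j \<in> I \<Longrightarrow> k \<in> I \<Longrightarrow> j \<noteq> k \<Longrightarrow> Q j * Q k = 0"
    and equiv: "\<And>k. k \<in> I \<Longrightarrow> Q k \<sim> P k" and "finite I"
  shows "\<exists>U. unitary_elem U \<and> star U * (\<Sum>k\<in>I. \<alpha> k *\<^sub>C P k) * U = (\<Sum>k\<in>I. \<alpha> k *\<^sub>C Q k)"
proof -
  obtain v where v: "\<And>k. k \<in> I \<Longrightarrow> star (v k) * v k = Q k" "\<And>k. k \<in> I \<Longrightarrow> v k * star (v k) = P k"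
    using equiv unfolding mvn_equiv_def by metis
  have vQ: "v k * Q k = v k" and Pv: "P k * v k = v k" if "k \<in> I" for k
    using mvn_equiv_partial_isometry[OF Q(1)[OF that] v(1)[OF that] v(2)[OF that]] by auto
  have star_v: "star (v j) * v k = (if j = k then Q k else 0)" if "j \<in> I" "k \<in> I" for j k
  proof (cases "j = k")
    case False
    have "star (v j) * v k = star (P j * v j) * (P k * v k)" by (simp add: Pv that)
    also have "\<dots> = star (v j) * (P j * P k) * v k"
      using P(1)[OF that(1)] by (simp add: star_mult projection_elem_def mult.assoc)
    finally show ?thesis using P(3)[OF that False] False by simp
  qed (simp add: v that)
  have v_star: "v j * star (v k) = (if j = k then P k else 0)" if "j \<in> I" "k \<in> I" for j k
  proof (cases "j = k")
    case False
    have "v j * star (v k) = (v j * Q j) * star (v k * Q k)" by (simp add: vQ that)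
    also have "\<dots> = v j * (Q j * Q k) * star (v k)"
      using Q(1)[OF that(2)] by (simp add: star_mult projection_elem_def mult.assoc)
    finally show ?thesis using Q(3)[OF that False] False by simp
  qed (simp add: v that)
  have NP: "(\<Sum>j\<in>I. \<alpha> j *\<^sub>C P j) * v k = \<alpha> k *\<^sub>C v k" if k: "k \<in> I" for k
  proof -
    have "P j * v k = (if j = k then v k else 0)" if "j \<in> I" for j
    proof (cases "j = k")
      case False
      have "P j * v k = (P j * P k) * v k" using Pv[OF k] by (simp add: mult.assoc)
      then show ?thesis using P(3)[OF that k False] False by simp
    qed (simp add: Pv k)
    then have "(\<Sum>j\<in>I. \<alpha> j *\<^sub>C P j) * v k = (\<Sum>j\<in>I. if j = k then \<alpha> k *\<^sub>C v k else 0)"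
      unfolding sum_distrib_right scaleC_mult_left by (intro sum.cong) auto
    then show ?thesis using k \<open>finite I\<close> by simp
  qed
  define U where "U = (\<Sum>k\<in>I. v k)"
  have "star U * U = (\<Sum>j\<in>I. \<Sum>k\<in>I. if k = j then Q j else 0)"
    unfolding U_def star_sum sum_product by (intro sum.cong refl) (auto simp: star_v)
  then have 1: "star U * U = 1" using Q(2) \<open>finite I\<close> by simp
  have "U * star U = (\<Sum>j\<in>I. \<Sum>k\<in>I. if k = j then P j else 0)"
    unfolding U_def star_sum sum_product by (intro sum.cong refl) (auto simp: v_star)
  then have 2: "U * star U = 1" using P(2) \<open>finite I\<close> by simp
  have "star U * (\<Sum>k\<in>I. \<alpha> k *\<^sub>C P k) * U = (\<Sum>j\<in>I. star (v j)) * (\<Sum>k\<in>I. \<alpha> k *\<^sub>C v k)"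
    unfolding mult.assoc U_def sum_distrib_left[of "\<Sum>k\<in>I. \<alpha> k *\<^sub>C P k"] star_sum
    by (simp add: NP cong: sum.cong)
  also have "\<dots> = (\<Sum>j\<in>I. \<Sum>k\<in>I. if k = j then \<alpha> j *\<^sub>C Q j else 0)"
    unfolding sum_product scaleC_mult_right by (intro sum.cong refl) (auto simp: star_v)
  finally have "star U * (\<Sum>k\<in>I. \<alpha> k *\<^sub>C P k) * U = (\<Sum>k\<in>I. \<alpha> k *\<^sub>C Q k)"
    using \<open>finite I\<close> by simp
  with 1 2 show ?thesis unfolding unitary_elem_def by blast
qed

lemma projection_unitary_conj:
  assumes "unitary_elem U" "projection_elem p" shows "projection_elem (star U * p * (U :: 'a::cstar_algebra))"
  using projection_conj_isometry(1)[of "star U" p] assms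
  by (simp add: unitary_elem_def isometry_elem_def star_star)

text \<open>A chain of approximations: \<open>A k\<close> is near a diagonal element with entries
  \<open>b k \<mu>\<close>, these are near fractions with denominator \<open>Suc M\<close>, and the
  fractions are realised exactly by \<open>ED (Q k)\<close>. As all \<open>P k\<close> and
  \<open>Q k\<close> are nonzero, one unitary carries \<open>N\<close> to the corresponding
  combination of the \<open>Q k\<close>.\<close>

lemma (in diagonal_expectation) orbit_image_approximation:
  assumes N: "N = (\<Sum>k=1..n. \<alpha> k *\<^sub>C P k)"
    and P: "\<And>k. k \<in> {1..n} \<Longrightarrow> projection_elem (P k)" "\<And>k. k \<in> {1..n} \<Longrightarrow> P k \<noteq> 0"
      "\<And>j k. j \<in> {1..n} \<Longrightarrow> k \<in> {1..n} \<Longrightarrow> j \<noteq> k \<Longrightarrow> P j * P k = 0" "(\<Sum>k=1..n. P k) = 1"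
    and A: "partition_of_unity_in (diagonal_subalgebra S) n A" and "e > 0"
  shows "\<exists>U. unitary_elem U \<and> norm (ED (star U * N * U) - (\<Sum>k=1..n. \<alpha> k *\<^sub>C A k)) < e"
proof -
  have A: "\<And>k. k \<in> {1..n} \<Longrightarrow> A k \<in> diagonal_subalgebra S" "\<And>k. k \<in> {1..n} \<Longrightarrow> positive_elem (A k)"
    "(\<Sum>k=1..n. A k) = 1"
    using A by (auto simp: partition_of_unity_in_def cstar_le_def)
  have n: "n \<ge> 1" using A(3) by (cases n) auto
  define a where "a = (\<Sum>k=1..n. cmod (\<alpha> k))"
  have "a \<ge> 0" by (simp add: a_def sum_nonneg)
  \<comment> \<open>The first bound is the one required for rounding. The second makes the weighted
    total error \<open>a * (4 * n + 1) * \<epsilon>\<close> smaller than \<open>e\<close>;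
    \<open>a + 1\<close> avoids division by zero.\<close>
  define \<epsilon> where "\<epsilon> = min (1 / (4 * real n)) (e / (2 * (a + 1) * (4 * real n + 1)))"
  have "e / (2 * (a + 1) * (4 * real n + 1)) > 0"
    using \<open>e > 0\<close> \<open>a \<ge> 0\<close> by (intro divide_pos_pos mult_pos_pos) auto
  then have \<epsilon>: "\<epsilon> > 0" using n by (simp add: \<epsilon>_def)
  have "\<epsilon> \<le> 1 / (4 * real n)" by (simp add: \<epsilon>_def)
  then have \<epsilon>1: "4 * real n * \<epsilon> \<le> 1" using n by (simp add: field_simps)
  have \<epsilon>2: "a * (4 * real n * \<epsilon> + \<epsilon>) < e"
  proof -
    have "\<epsilon> * (2 * (a + 1) * (4 * real n + 1)) \<le> e"
    proof -
      have "\<epsilon> \<le> e / (2 * (a + 1) * (4 * real n + 1))" by (simp add: \<epsilon>_def)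
      moreover have "0 < 2 * (a + 1) * (4 * real n + 1)" using \<open>a \<ge> 0\<close> by (intro mult_pos_pos) auto
      ultimately show ?thesis by (simp only: pos_le_divide_eq)
    qed
    moreover have "a * (4 * real n * \<epsilon> + \<epsilon>) < 2 * (a + 1) * (4 * real n * \<epsilon> + \<epsilon>)"
      using \<open>a \<ge> 0\<close> \<epsilon> n by (intro mult_strict_right_mono) (auto intro: add_pos_pos)
    moreover have "2 * (a + 1) * (4 * real n * \<epsilon> + \<epsilon>) = \<epsilon> * (2 * (a + 1) * (4 * real n + 1))"
      by (simp add: algebra_simps)
    ultimately show ?thesis by linarith
  qed
  have sa: "star (A k) = A k" if "k \<in> {1..n}" for k using A(2)[OF that] by (simp add: positive_elem_def)
  have "\<exists>m b. \<forall>k\<in>{1..n}. norm (A k - diag S m (\<lambda>\<mu>. complex_of_real (b k \<mu>))) \<le> \<epsilon>"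
    by (rule diagonal_approximation[OF family finite_atLeastAtMost A(1) sa \<epsilon>])
  then obtain m b where "\<forall>k\<in>{1..n}. norm (A k - diag S m (\<lambda>\<mu>. complex_of_real (b k \<mu>))) \<le> \<epsilon>"
    by blast
  then have b: "norm (A k - diag S m (\<lambda>\<mu>. complex_of_real (b k \<mu>))) \<le> \<epsilon>" if "k \<in> {1..n}" for k
    using that by blast
  have b_ge: "b k \<mu> \<ge> - \<epsilon>" if "\<mu> \<in> words_of m" "k \<in> {1..n}" for k \<mu>
    using diag_entry_ge[OF family A(2)[OF that(2)] that(1) b[OF that(2)]] .
  \<comment> \<open>The \<open>A k\<close> add up to 1, so the entry sums differ from 1 by at most
    the sum of the \<open>n\<close> approximation errors.\<close>
  have b_sum: "\<bar>(\<Sum>k=1..n. b k \<mu>) - 1\<bar> \<le> real n * \<epsilon>" if "\<mu> \<in> words_of m" for \<mu>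
  proof -
    have "diag S m (\<lambda>\<mu>. complex_of_real ((\<Sum>k=1..n. b k \<mu>) - 1)) =
        (\<Sum>k=1..n. diag S m (\<lambda>\<mu>. complex_of_real (b k \<mu>)) - A k)"
      using diag_one[OF family, of m 1] by (simp add: diag_diff diag_sum sum_subtractf A(3))
    moreover have "norm (\<Sum>k=1..n. diag S m (\<lambda>\<mu>. complex_of_real (b k \<mu>)) - A k) \<le> (\<Sum>k=1..n. \<epsilon>)"
      using b by (intro order_trans[OF norm_sum] sum_mono) (simp add: norm_minus_commute)
    ultimately show ?thesis
      using diag_entry_bound[OF family that, of "\<lambda>\<mu>. (\<Sum>k=1..n. b k \<mu>) - 1"] by simp
  qed
  obtain M0 :: nat where M0: "2 * real n / \<epsilon> < real M0" using reals_Archimedean2 by blast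
  \<comment> \<open>The denominator will be \<open>Suc M\<close>: large enough for
    \<open>2 * n / Suc M \<le> \<epsilon>\<close>, and at least \<open>n\<close>, so that every
    index can receive one unit.\<close>
  define M where "M = M0 + n"
  have "2 * real n < real M0 * \<epsilon>" using M0 \<epsilon> by (simp add: pos_divide_less_eq)
  moreover have "real M0 * \<epsilon> \<le> real (Suc M) * \<epsilon>" using \<epsilon> by (intro mult_right_mono) (auto simp: M_def)
  ultimately have M: "n \<le> Suc M" "2 * real n \<le> real (Suc M) * \<epsilon>" by (auto simp: M_def simp del: of_nat_Suc)
  have "\<exists>r :: nat \<Rightarrow> nat. (\<forall>k\<in>{1..n}. r k \<ge> 1 \<and> \<bar>real (r k) / real (Suc M) - b k \<mu>\<bar> \<le> 4 * real n * \<epsilon>) \<and>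
      (\<Sum>k=1..n. r k) = Suc M" if \<mu>: "\<mu> \<in> words_of m" for \<mu>
    using round_almost_probability_vector[OF b_ge[OF \<mu>] b_sum[OF \<mu>] n \<epsilon> \<epsilon>1 M] .
  then obtain r :: "nat list \<Rightarrow> nat \<Rightarrow> nat" where
    r: "\<And>\<mu> k. \<mu> \<in> words_of m \<Longrightarrow> k \<in> {1..n} \<Longrightarrow> r \<mu> k \<ge> 1"
      "\<And>\<mu> k. \<mu> \<in> words_of m \<Longrightarrow> k \<in> {1..n} \<Longrightarrow> \<bar>real (r \<mu> k) / real (Suc M) - b k \<mu>\<bar> \<le> 4 * real n * \<epsilon>"
      "\<And>\<mu>. \<mu> \<in> words_of m \<Longrightarrow> (\<Sum>k=1..n. r \<mu> k) = Suc M"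
    by metis
  have "\<exists>Q. (\<forall>k\<in>{1..n}. projection_elem (Q k) \<and> Q k \<noteq> 0 \<and>
      ED (Q k) = diag S m (\<lambda>\<mu>. complex_of_real (real (r \<mu> k) / real (Suc M)))) \<and>
    (\<forall>j\<in>{1..n}. \<forall>k\<in>{1..n}. j \<noteq> k \<longrightarrow> Q j * Q k = 0) \<and> (\<Sum>k=1..n. Q k) = 1"
    by (rule projections_with_diagonal[OF r(3,1)])
  then obtain Q where Q: "\<And>k. k \<in> {1..n} \<Longrightarrow> projection_elem (Q k)" "\<And>k. k \<in> {1..n} \<Longrightarrow> Q k \<noteq> 0"
    "\<And>k. k \<in> {1..n} \<Longrightarrow> ED (Q k) = diag S m (\<lambda>\<mu>. complex_of_real (real (r \<mu> k) / real (Suc M)))"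
    "\<And>j k. j \<in> {1..n} \<Longrightarrow> k \<in> {1..n} \<Longrightarrow> j \<noteq> k \<Longrightarrow> Q j * Q k = 0" "(\<Sum>k=1..n. Q k) = 1"
    by blast
  have equiv: "Q k \<sim> P k" if k: "k \<in> {1..n}" for k
    by (rule nonzero_projections_equiv[OF Q(1)[OF k] Q(2)[OF k] P(1)[OF k] P(2)[OF k]])
  have "\<exists>U. unitary_elem U \<and> star U * (\<Sum>k\<in>{1..n}. \<alpha> k *\<^sub>C P k) * U = (\<Sum>k\<in>{1..n}. \<alpha> k *\<^sub>C Q k)"
    by (rule unitary_between_decompositions[OF P(1) P(4) P(3) Q(1) Q(5) Q(4) equiv finite_atLeastAtMost])
  then obtain U where U: "unitary_elem U" "star U * N * U = (\<Sum>k=1..n. \<alpha> k *\<^sub>C Q k)"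
    unfolding N by blast
  have close: "norm (ED (Q k) - A k) \<le> 4 * real n * \<epsilon> + \<epsilon>" if k: "k \<in> {1..n}" for k
  proof -
    have "norm (diag S m (\<lambda>\<mu>. complex_of_real (real (r \<mu> k) / real (Suc M) - b k \<mu>))) \<le> 4 * real n * \<epsilon>"
      using r(2) k \<epsilon> by (intro norm_diag_le[OF family]) auto
    moreover have "diag S m (\<lambda>\<mu>. complex_of_real (real (r \<mu> k) / real (Suc M) - b k \<mu>)) =
        ED (Q k) - diag S m (\<lambda>\<mu>. complex_of_real (b k \<mu>))"
      unfolding Q(3)[OF k] of_real_diff diag_diff ..
    moreover have "norm (diag S m (\<lambda>\<mu>. complex_of_real (b k \<mu>)) - A k) \<le> \<epsilon>"
      using b[OF k] by (simp add: norm_minus_commute)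
    ultimately show ?thesis
      using norm_triangle_ineq[of "ED (Q k) - diag S m (\<lambda>\<mu>. complex_of_real (b k \<mu>))"
          "diag S m (\<lambda>\<mu>. complex_of_real (b k \<mu>)) - A k"] by simp
  qed
  have "ED (star U * N * U) - (\<Sum>k=1..n. \<alpha> k *\<^sub>C A k) = (\<Sum>k=1..n. \<alpha> k *\<^sub>C (ED (Q k) - A k))"
    unfolding U(2) ED_sum ED_scaleC by (simp add: sum_subtractf cvector_space.scale_right_diff_distrib)
  also have "norm \<dots> \<le> (\<Sum>k=1..n. cmod (\<alpha> k) * (4 * real n * \<epsilon> + \<epsilon>))"
    using close by (intro order_trans[OF norm_sum] sum_mono) (simp add: norm_scaleC mult_left_mono)
  also have "\<dots> = a * (4 * real n * \<epsilon> + \<epsilon>)" by (simp only: a_def sum_distrib_right)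
  finally show ?thesis using \<epsilon>2 U(1) by (intro exI[of _ U]) linarith
qed

theorem theorem4p17:
  fixes S :: "nat \<Rightarrow> 'a::cstar_algebra"
    and E\<^sub>D :: "'a \<Rightarrow> 'a"
    and N :: 'a
    and n :: nat
    and \<alpha> :: "nat \<Rightarrow> complex"
  assumes "cuntz_O2 S"
    and "canonical_expectation_diagonal S E\<^sub>D"
    and "normal_elem N"
    and "inj_on \<alpha> {1..n}"
    and "spectrum N = \<alpha> ` {1..n}"
  shows "closure (unitary_orbit_image E\<^sub>D N) =
    closure {(\<Sum>k=1..n. \<alpha> k *\<^sub>C A k) | A.
      partition_of_unity_in (diagonal_subalgebra S) n A}"
proof -
  obtain EF E where E: "canonical_expectation_UHF S EF" "canonical_expectation_UHF_diagonal S E" "E\<^sub>D = E \<circ> EF"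
    using assms(2) unfolding canonical_expectation_diagonal_def by blast
  interpret diagonal_expectation S EF E
    by unfold_locales (use assms E in auto)
  have ED: "E\<^sub>D = ED" by (auto simp: E ED_def)
  obtain P where P: "\<And>k. k \<in> {1..n} \<Longrightarrow> projection_elem (P k)" "\<And>k. k \<in> {1..n} \<Longrightarrow> P k \<noteq> 0"
    "\<And>j k. j \<in> {1..n} \<Longrightarrow> k \<in> {1..n} \<Longrightarrow> j \<noteq> k \<Longrightarrow> P j * P k = 0"
    "(\<Sum>k=1..n. P k) = 1" "N = (\<Sum>k=1..n. \<alpha> k *\<^sub>C P k)"
    using normal_finite_spectral_decomposition[OF assms(3-5)] by blast
  let ?R = "{(\<Sum>k=1..n. \<alpha> k *\<^sub>C A k) | A. partition_of_unity_in (diagonal_subalgebra S) n A}"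
  have "unitary_orbit_image ED N \<subseteq> ?R"
  proof
    fix x assume "x \<in> unitary_orbit_image ED N"
    then obtain U where U: "unitary_elem U" "x = ED (star U * N * U)"
      unfolding unitary_orbit_image_def by blast
    define A where "A k = ED (star U * P k * U)" for k
    have proj: "projection_elem (star U * P k * U)" if "k \<in> {1..n}" for k
      by (rule projection_unitary_conj[OF U(1) P(1)[OF that]])
    have "0 \<preceq> A k" "A k \<preceq> 1" if k: "k \<in> {1..n}" for k
    proof -
      show "0 \<preceq> A k"
        using ED_positive[OF positive_projection[OF proj[OF k]]] by (simp add: A_def cstar_le_def)
      \<comment> \<open>The upper bound is positivity of the expectation applied to the
        complementary projection.\<close>
      have "1 - A k = ED (1 - star U * P k * U)" by (simp only: ED_diff ED_one A_def)
      then show "A k \<preceq> 1"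
        using ED_positive[OF positive_projection[OF projection_diff_one[OF proj[OF k]]]]
        by (simp add: cstar_le_def)
    qed
    moreover have "(\<Sum>k=1..n. A k) = 1"
    proof -
      have "(\<Sum>k=1..n. A k) = ED (star U * (\<Sum>k=1..n. P k) * U)"
        unfolding A_def ED_sum[symmetric] by (simp only: sum_distrib_left sum_distrib_right)
      then show ?thesis using U(1) by (simp add: P(4) ED_one unitary_elem_def)
    qed
    ultimately have "partition_of_unity_in (diagonal_subalgebra S) n A"
      using ED_in_diagonal unfolding partition_of_unity_in_def A_def by blast
    moreover have "x = (\<Sum>k=1..n. \<alpha> k *\<^sub>C A k)"
      unfolding U(2) P(5) A_def sum_distrib_left sum_distrib_right scaleC_mult_left scaleC_mult_right
        ED_sum ED_scaleC ..
    ultimately show "x \<in> ?R" by blast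
  qed
  moreover have "?R \<subseteq> closure (unitary_orbit_image ED N)"
  proof
    fix x assume "x \<in> ?R"
    then obtain A where A: "partition_of_unity_in (diagonal_subalgebra S) n A"
      "x = (\<Sum>k=1..n. \<alpha> k *\<^sub>C A k)" by blast
    show "x \<in> closure (unitary_orbit_image ED N)"
      unfolding closure_approachable
    proof (intro allI impI)
      fix e :: real assume "e > 0"
      have "\<exists>U. unitary_elem U \<and> norm (ED (star U * N * U) - (\<Sum>k=1..n. \<alpha> k *\<^sub>C A k)) < e"
        by (rule orbit_image_approximation[OF P(5,1-4) A(1) \<open>e > 0\<close>])
      then obtain U where "unitary_elem U" "norm (ED (star U * N * U) - x) < e"
        unfolding A(2) by blast
      then show "\<exists>y\<in>unitary_orbit_image ED N. dist y x < e"
        unfolding unitary_orbit_image_def dist_norm by blast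
    qed
  qed
  ultimately show ?thesis
    unfolding ED by (intro subset_antisym closure_mono closure_minimal) auto
qed

end
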